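(* Let $X$ be a set and let $\Omega$ be a nonempty set with four binary operations $\leftarrow,\rightarrow,\lhd,\rhd:\Omega\times\Omega\to\Omega$. Let $\leq_{\mathrm{db}}$ be the monomial order on $\mathfrak{M}(\Omega_R\sqcup\Omega_S,X)$ defined in the context. (a) The set $\mathbb{S}_{\Omega S}\subseteq \mathbf{k}\mathfrak{M}(\Omega_R\sqcup\Omega_S,X)$ consisting of all elements $$\lfloor u\rfloor^R_\alpha\lfloor v\rfloor^R_\beta-\big\lfloor \lfloor u\rfloor^R_{\alpha\rhd\beta}\,v\big\rfloor^R_{\alpha\rightarrow\beta}-\big\lfloor u\,\lfloor v\rfloor^S_{\alpha\lhd\beta}\big\rfloor^R_{\alpha\leftarrow\beta},$$ $$\lfloor u\rfloor^S_\alpha\lfloor v\rfloor^S_\beta-\big\lfloor \lfloor u\rfloor^R_{\alpha\rhd\beta}\,v\big\rfloor^S_{\alpha\rightarrow\beta}-\big\lfloor u\,\lfloor v\rfloor^S_{\alpha\lhd\beta}\big\rfloor^S_{\alpha\leftarrow\beta},$$ with $u,v\in\mathfrak{M}(\Omega_R\sqcup\Omega_S,X)$ and $\alpha,\beta\in\Omega$, is a Gröbner-Shirshov basis in $\mathbf{k}\mathfrak{M}(\Omega_R\sqcup\Omega_S,X)$ with respect to $\leq_{\mathrm{db}}$ if and only if $(\Omega,\leftarrow,\rightarrow,\lhd,\rhd)$ is an extended diassociative semigroup. (b) If $(\Omega,\leftarrow,\rightarrow,\lhd,\rhd)$ is an extended diassociative semigroup, then the set $$\mathrm{Irr}(\mathbb{S}_{\Omega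 S})=\{w\in\mathfrak{M}(\Omega_R\sqcup\Omega_S,X)\mid w\neq q|_{\overline{s}}\text{ for any }q\in\mathfrak{M}^\star(\Omega_R\sqcup\Omega_S,X)\text{ and any }s\in\mathbb{S}_{\Omega S}\}$$ is a $\mathbf{k}$-basis of the free $\Omega$-Rota-Baxter system $\mathbf{k}\mathfrak{M}(\Omega_R\sqcup\Omega_S,X)/\mathrm{Id}(\mathbb{S}_{\Omega S})$ on $X$.
   Context: $\mathbf{k}$ is a fixed commutative unitary ring; algebras are unitary associative $\mathbf{k}$-algebras. **$\Omega$-Rota-Baxter system.** For a nonempty set $\Omega$ with four binary operations $\leftarrow,\rightarrow,\lhd,\rhd$, this is an algebra $A$ with linear operators $R_\omega,S_\omega:A\to A$ ($\omega\in\Omega$) such that for all $a,b\in A$, $\alpha,\beta\in\Omega$: $R_\alpha(a)R_\beta(b)=R_{\alpha\rightarrow\beta}(R_{\alpha\rhd\beta}(a)b)+R_{\alpha\leftarrow\beta}(aS_{\alpha\lhd\beta}(b))$ and $S_\alpha(a)S_\beta(b)=S_{\alpha\rightarrow\beta}(R_{\alpha\rhd\beta}(a)b)+S_{\alpha\leftarrow\beta}(aS_{\alpha\lhd\beta}(b))$. **Extended diassociative semigroup.** A nonempty set $\Omega$ with four binary operations such that for all $\alpha,\beta,\gamma\in\Omega$: $(\alpha\rightarrow\beta)\rightarrow\gamma=\alpha\rightarrow(\beta\rightarrow\gamma)$; $(\alpha\rightarrow\beta)\rhd\gamma=(\alpha\rhd(\beta\rightarrow\gamma))\rightarrow(\beta\rhd\gamma)$;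 $\alpha\rhd\beta=(\alpha\rhd(\beta\rightarrow\gamma))\rhd(\beta\rhd\gamma)$; $(\alpha\rightarrow\beta)\leftarrow\gamma=\alpha\rightarrow(\beta\leftarrow\gamma)$; $\alpha\rhd(\beta\leftarrow\gamma)=\alpha\rhd\beta$; $(\alpha\rightarrow\beta)\lhd\gamma=\beta\lhd\gamma$; $(\alpha\leftarrow\beta)\rightarrow\gamma=\alpha\rightarrow(\beta\rightarrow\gamma)$; $(\alpha\rhd(\beta\rightarrow\gamma))\leftarrow(\beta\rhd\gamma)=(\alpha\leftarrow\beta)\rhd\gamma$; $(\alpha\rhd(\beta\rightarrow\gamma))\lhd(\beta\rhd\gamma)=\alpha\lhd\beta$; $(\alpha\leftarrow\beta)\leftarrow\gamma=\alpha\leftarrow(\beta\rightarrow\gamma)$; $(\alpha\lhd\beta)\rightarrow((\alpha\leftarrow\beta)\lhd\gamma)=\alpha\lhd(\beta\rightarrow\gamma)$; $(\alpha\lhd\beta)\rhd((\alpha\leftarrow\beta)\lhd\gamma)=\beta\rhd\gamma$; $(\alpha\leftarrow\beta)\leftarrow\gamma=\alpha\leftarrow(\beta\leftarrow\gamma)$; $(\alpha\lhd\beta)\leftarrow((\alpha\leftarrow\beta)\lhd\gamma)=\alpha\lhd(\beta\leftarrow\gamma)$; $(\alpha\lhd\beta)\lhd((\alpha\leftarrow\beta)\lhd\gamma)=\beta\lhd\gamma$. **Bracketed words.** For a set $X$ and nonempty set $\Lambda$, let $M(Y)$ be the free monoid on $Y$ and, for $\omega\in\Lambda$, let $\lfloor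 Y\rfloor_\omega=\{\lfloor y\rfloor_\omega\mid y\in Y\}$ be a disjoint copy of $Y$ (disjoint for different $\omega$). Set $\mathfrak{M}_0=M(X)$, $\mathfrak{M}_n=M(X\sqcup\bigsqcup_{\omega\in\Lambda}\lfloor\mathfrak{M}_{n-1}\rfloor_\omega)$, with the natural inclusions $\mathfrak{M}_{n-1}\hookrightarrow\mathfrak{M}_n$, and $\mathfrak{M}(\Lambda,X)=\bigcup_n\mathfrak{M}_n$, a monoid with identity $1$. $\mathbf{k}\mathfrak{M}(\Lambda,X)$ is the free module on it, with multiplication extended linearly and linear operators $w\mapsto\lfloor w\rfloor_\omega$; it is the free algebra on $X$ equipped with a family of linear operators indexed by $\Lambda$. Elements of $X\sqcup\bigsqcup_\omega\lfloor\mathfrak{M}(\Lambda,X)\rfloor_\omega$ are called prime; if $u=u_1\cdots u_n$ with $u_i$ prime, the breadth is $|u|=n$ (and $|1|=0$). $\mathfrak{M}^\star(\Lambda,X)$ is the set of words in $\mathfrak{M}(\Lambda,X\sqcup\{\star\})$ in which $\star$ occurs exactly once; $q|_u$ is obtained from $q$ by replacing $\star$ by $u$, extended linearly in $u$. $\mathrm{Id}(\mathbb{S})$ is the two-sided ideal, closed under all operators $\lfloor\,\rfloor_\omega$, generated by $\mathbb{S}$. Here $\Omega_R,\Omega_S$ are two disjoint copies of $\Omega$, $\Lambda=\Omega_R\sqcup\Omega_S$, and $\lfloor\,\rfloor^R_\omega$, $\lfloor\,\rfloor^S_\omega$ ($\omega\in\Omega$) denote the operators indexed by the copies of $\omega$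 in $\Omega_R$, $\Omega_S$. In the quotient, the operators $R_\omega,S_\omega$ are those induced by $\lfloor\,\rfloor_\omega^R,\lfloor\,\rfloor_\omega^S$. **The order $\leq_{\mathrm{db}}$.** Fix well orders $\leq_X$ on $X$ and $\leq_\Omega$ on the set of operators $\{\lfloor\,\rfloor^R_\omega,\lfloor\,\rfloor^S_\omega\mid\omega\in\Omega\}$. Let $\deg(u)$ be the total number of occurrences in $u$ of letters of $X$ and of operators, counted with multiplicity. For $u=u_1\cdots u_m$, $v=v_1\cdots v_n$ with prime factors $u_i,v_j$, $u\leq_{\mathrm{db}}v$ is defined recursively by lexicographic comparison of $(\deg(u),|u|,u_1,\dots,u_m)$ and $(\deg(v),|v|,v_1,\dots,v_n)$, i.e. first by degree, then by breadth, then by prime factors lexicographically; two prime elements of equal degree are compared as follows: elements of $X$ by $\leq_X$; an element of $X$ is smaller than any bracket $\lfloor\tilde v\rfloor$; two brackets $\lfloor\tilde u\rfloor^{\ast_1}_\alpha,\lfloor\tilde v\rfloor^{\ast_2}_\beta$ by lexicographic comparison of $(\lfloor\,\rfloor^{\ast_1}_\alpha,\tilde u)$ and $(\lfloor\,\rfloor^{\ast_2}_\beta,\tilde v)$, using $\leq_\Omega$ and then $\leq_{\mathrm{db}}$. **Gröbner-Shirshov basis.** A monomial order is a well order $\leq$ on $\mathfrak{M}(\Lambda,X)$ such that $u<v$ implies $q|_u<q|_v$ for all $q\in\mathfrak{M}^\star(\Lambda,X)$. Given one, $\overline{f}$ denotes the leading monomial of $f\neq0$; $f$ is monic if its leading coefficient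 is $1$. Let $f,g$ be distinct monic elements. If $w=\overline{f}u=v\overline{g}$ for words $u,v,w$ with $\max\{|\overline f|,|\overline g|\}<|w|<|\overline f|+|\overline g|$, then $fu-vg$ is an intersection composition of $f,g$ with ambiguity $w$. If $w=\overline f=q|_{\overline g}$ with $q\in\mathfrak{M}^\star(\Lambda,X)$, then $f-q|_g$ is an including composition with ambiguity $w$. For a set $\mathbb{S}$ of monic elements, a composition $h$ with ambiguity $w$ is trivial modulo $(\mathbb{S},w)$ if $h=\sum_ic_iq_i|_{s_i}$ (finite sum) with $c_i\in\mathbf{k}\setminus\{0\}$, $q_i\in\mathfrak{M}^\star(\Lambda,X)$, $s_i\in\mathbb{S}$, $q_i|_{\overline{s_i}}<w$. $\mathbb{S}$ is a Gröbner-Shirshov basis if all intersection and including compositions of all pairs $f,g\in\mathbb{S}$ are trivial modulo $(\mathbb{S},w)$. *)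

theory Defs
  imports "HOL-Library.Poly_Mapping" "HOL-Algebra.Module" "HOL-Algebra.QuotRing"
begin

section \<open>Operations on the index set\<close>

text \<open>The nonempty index set is the type \<open>'w\<close>. The four operations are always passed in the
  order left arrow, right arrow, left triangle, right triangle.\<close>

locale four_operations =
  fixes larr :: "'w \<Rightarrow> 'w \<Rightarrow> 'w" (infix \<open>\<^bold>\<leftarrow>\<close> 70)
    and rarr :: "'w \<Rightarrow> 'w \<Rightarrow> 'w" (infix \<open>\<^bold>\<rightarrow>\<close> 70)
    and ltri :: "'w \<Rightarrow> 'w \<Rightarrow> 'w" (infix \<open>\<^bold>\<lhd>\<close> 70)
    and rtri :: "'w \<Rightarrow> 'w \<Rightarrow> 'w" (infix \<open>\<^bold>\<rhd>\<close> 70)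

locale extended_diassociative_semigroup = four_operations +
  assumes eds1: "(\<alpha> \<^bold>\<rightarrow> \<beta>) \<^bold>\<rightarrow> \<gamma> = \<alpha> \<^bold>\<rightarrow> (\<beta> \<^bold>\<rightarrow> \<gamma>)"
    and eds2: "(\<alpha> \<^bold>\<rightarrow> \<beta>) \<^bold>\<rhd> \<gamma> = (\<alpha> \<^bold>\<rhd> (\<beta> \<^bold>\<rightarrow> \<gamma>)) \<^bold>\<rightarrow> (\<beta> \<^bold>\<rhd> \<gamma>)"
    and eds3: "\<alpha> \<^bold>\<rhd> \<beta> = (\<alpha> \<^bold>\<rhd> (\<beta> \<^bold>\<rightarrow> \<gamma>)) \<^bold>\<rhd> (\<beta> \<^bold>\<rhd> \<gamma>)"
    and eds4: "(\<alpha> \<^bold>\<rightarrow> \<beta>) \<^bold>\<leftarrow> \<gamma> = \<alpha> \<^bold>\<rightarrow> (\<beta> \<^bold>\<leftarrow> \<gamma>)"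
    and eds5: "\<alpha> \<^bold>\<rhd> (\<beta> \<^bold>\<leftarrow> \<gamma>) = \<alpha> \<^bold>\<rhd> \<beta>"
    and eds6: "(\<alpha> \<^bold>\<rightarrow> \<beta>) \<^bold>\<lhd> \<gamma> = \<beta> \<^bold>\<lhd> \<gamma>"
    and eds7: "(\<alpha> \<^bold>\<leftarrow> \<beta>) \<^bold>\<rightarrow> \<gamma> = \<alpha> \<^bold>\<rightarrow> (\<beta> \<^bold>\<rightarrow> \<gamma>)"
    and eds8: "(\<alpha> \<^bold>\<rhd> (\<beta> \<^bold>\<rightarrow> \<gamma>)) \<^bold>\<leftarrow> (\<beta> \<^bold>\<rhd> \<gamma>) = (\<alpha> \<^bold>\<leftarrow> \<beta>) \<^bold>\<rhd> \<gamma>"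
    and eds9: "(\<alpha> \<^bold>\<rhd> (\<beta> \<^bold>\<rightarrow> \<gamma>)) \<^bold>\<lhd> (\<beta> \<^bold>\<rhd> \<gamma>) = \<alpha> \<^bold>\<lhd> \<beta>"
    and eds10: "(\<alpha> \<^bold>\<leftarrow> \<beta>) \<^bold>\<leftarrow> \<gamma> = \<alpha> \<^bold>\<leftarrow> (\<beta> \<^bold>\<rightarrow> \<gamma>)"
    and eds11: "(\<alpha> \<^bold>\<lhd> \<beta>) \<^bold>\<rightarrow> ((\<alpha> \<^bold>\<leftarrow> \<beta>) \<^bold>\<lhd> \<gamma>) = \<alpha> \<^bold>\<lhd> (\<beta> \<^bold>\<rightarrow> \<gamma>)"
    and eds12: "(\<alpha> \<^bold>\<lhd> \<beta>) \<^bold>\<rhd> ((\<alpha> \<^bold>\<leftarrow> \<beta>) \<^bold>\<lhd> \<gamma>) = \<beta> \<^bold>\<rhd> \<gamma>"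
    and eds13: "(\<alpha> \<^bold>\<leftarrow> \<beta>) \<^bold>\<leftarrow> \<gamma> = \<alpha> \<^bold>\<leftarrow> (\<beta> \<^bold>\<leftarrow> \<gamma>)"
    and eds14: "(\<alpha> \<^bold>\<lhd> \<beta>) \<^bold>\<leftarrow> ((\<alpha> \<^bold>\<leftarrow> \<beta>) \<^bold>\<lhd> \<gamma>) = \<alpha> \<^bold>\<lhd> (\<beta> \<^bold>\<leftarrow> \<gamma>)"
    and eds15: "(\<alpha> \<^bold>\<lhd> \<beta>) \<^bold>\<lhd> ((\<alpha> \<^bold>\<leftarrow> \<beta>) \<^bold>\<lhd> \<gamma>) = \<beta> \<^bold>\<lhd> \<gamma>"


section \<open>Algebras and Rota-Baxter systems\<close>

text \<open>The library locale \<open>algebra\<close> requires a commutative multiplication.\<close>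

locale assoc_algebra = module K A + ring A for K (structure) and A (structure) +
  assumes smult_mult_left: "\<lbrakk>c \<in> carrier K; x \<in> carrier A; y \<in> carrier A\<rbrakk>
      \<Longrightarrow> (c \<odot>\<^bsub>A\<^esub> x) \<otimes>\<^bsub>A\<^esub> y = c \<odot>\<^bsub>A\<^esub> (x \<otimes>\<^bsub>A\<^esub> y)"
    and smult_mult_right: "\<lbrakk>c \<in> carrier K; x \<in> carrier A; y \<in> carrier A\<rbrakk>
      \<Longrightarrow> x \<otimes>\<^bsub>A\<^esub> (c \<odot>\<^bsub>A\<^esub> y) = c \<odot>\<^bsub>A\<^esub> (x \<otimes>\<^bsub>A\<^esub> y)"

definition linear_operator :: "'k ring \<Rightarrow> ('k, 'a) module \<Rightarrow> ('a \<Rightarrow> 'a) \<Rightarrow> bool" where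
  "linear_operator K A F \<longleftrightarrow>
     F \<in> carrier A \<rightarrow> carrier A \<and>
     (\<forall>x\<in>carrier A. \<forall>y\<in>carrier A. F (x \<oplus>\<^bsub>A\<^esub> y) = F x \<oplus>\<^bsub>A\<^esub> F y) \<and>
     (\<forall>c\<in>carrier K. \<forall>x\<in>carrier A. F (c \<odot>\<^bsub>A\<^esub> x) = c \<odot>\<^bsub>A\<^esub> F x)"

locale rota_baxter_system = four_operations + assoc_algebra K A
  for K :: "'k ring" and A :: "('k, 'a) module" +
  fixes R :: "'w \<Rightarrow> 'a \<Rightarrow> 'a" and S :: "'w \<Rightarrow> 'a \<Rightarrow> 'a"
  assumes R_linear: "linear_operator K A (R \<alpha>)"
    and S_linear: "linear_operator K A (S \<alpha>)"
    and R_mult: "\<lbrakk>a \<in> carrier A; b \<in> carrier A\<rbrakk> \<Longrightarrow>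
      R \<alpha> a \<otimes>\<^bsub>A\<^esub> R \<beta> b =
        R (\<alpha> \<^bold>\<rightarrow> \<beta>) (R (\<alpha> \<^bold>\<rhd> \<beta>) a \<otimes>\<^bsub>A\<^esub> b) \<oplus>\<^bsub>A\<^esub> R (\<alpha> \<^bold>\<leftarrow> \<beta>) (a \<otimes>\<^bsub>A\<^esub> S (\<alpha> \<^bold>\<lhd> \<beta>) b)"
    and S_mult: "\<lbrakk>a \<in> carrier A; b \<in> carrier A\<rbrakk> \<Longrightarrow>
      S \<alpha> a \<otimes>\<^bsub>A\<^esub> S \<beta> b =
        S (\<alpha> \<^bold>\<rightarrow> \<beta>) (R (\<alpha> \<^bold>\<rhd> \<beta>) a \<otimes>\<^bsub>A\<^esub> b) \<oplus>\<^bsub>A\<^esub> S (\<alpha> \<^bold>\<leftarrow> \<beta>) (a \<otimes>\<^bsub>A\<^esub> S (\<alpha> \<^bold>\<lhd> \<beta>) b)"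

definition rb_hom ::
  "'k ring \<Rightarrow> ('k, 'a) module \<Rightarrow> ('w \<Rightarrow> 'a \<Rightarrow> 'a) \<Rightarrow> ('w \<Rightarrow> 'a \<Rightarrow> 'a)
    \<Rightarrow> ('k, 'b) module \<Rightarrow> ('w \<Rightarrow> 'b \<Rightarrow> 'b) \<Rightarrow> ('w \<Rightarrow> 'b \<Rightarrow> 'b) \<Rightarrow> ('a \<Rightarrow> 'b) set" where
  "rb_hom K A R S B R' S' = {h \<in> ring_hom A B.
     (\<forall>c\<in>carrier K. \<forall>x\<in>carrier A. h (c \<odot>\<^bsub>A\<^esub> x) = c \<odot>\<^bsub>B\<^esub> h x) \<and>
     (\<forall>\<omega>. \<forall>x\<in>carrier A. h (R \<omega> x) = R' \<omega> (h x) \<and> h (S \<omega> x) = S' \<omega> (h x))}"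

text \<open>The universal property of the free Rota-Baxter system on \<open>X\<close>, tested against all systems whose
  elements are taken from the type \<open>'b\<close>; a theorem stated for an arbitrary type variable \<open>'b\<close>
  covers all of them.\<close>

definition free_rota_baxter_system ::
  "'b itself \<Rightarrow> ('w \<Rightarrow> 'w \<Rightarrow> 'w) \<Rightarrow> ('w \<Rightarrow> 'w \<Rightarrow> 'w) \<Rightarrow> ('w \<Rightarrow> 'w \<Rightarrow> 'w) \<Rightarrow> ('w \<Rightarrow> 'w \<Rightarrow> 'w)
    \<Rightarrow> 'k ring \<Rightarrow> 'x set \<Rightarrow> ('k, 'a) module \<Rightarrow> ('w \<Rightarrow> 'a \<Rightarrow> 'a) \<Rightarrow> ('w \<Rightarrow> 'a \<Rightarrow> 'a) \<Rightarrow> ('x \<Rightarrow> 'a)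
    \<Rightarrow> bool" where
  "free_rota_baxter_system (_ :: 'b itself) larr rarr ltri rtri K X A R S j \<longleftrightarrow>
     rota_baxter_system larr rarr ltri rtri K A R S \<and>
     j \<in> X \<rightarrow> carrier A \<and>
     (\<forall>(B :: ('k, 'b) module) R' S' f.
        rota_baxter_system larr rarr ltri rtri K B R' S' \<and> f \<in> X \<rightarrow> carrier B \<longrightarrow>
        (\<exists>h \<in> rb_hom K A R S B R' S'. (\<forall>x\<in>X. h (j x) = f x) \<and>
           (\<forall>h' \<in> rb_hom K A R S B R' S'. (\<forall>x\<in>X. h' (j x) = f x) \<longrightarrow>
              (\<forall>a\<in>carrier A. h' a = h a))))"

text \<open>\<open>b\<close>, indexed by \<open>J\<close>, is a basis of the module \<open>M\<close>: spanning and linearly independent as a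
  family.\<close>

definition module_basis :: "'k ring \<Rightarrow> ('k, 'a) module \<Rightarrow> 'i set \<Rightarrow> ('i \<Rightarrow> 'a) \<Rightarrow> bool" where
  "module_basis K M J b \<longleftrightarrow>
     b \<in> J \<rightarrow> carrier M \<and>
     (\<forall>m\<in>carrier M. \<exists>F c. finite F \<and> F \<subseteq> J \<and> c \<in> F \<rightarrow> carrier K \<and>
        m = (\<Oplus>\<^bsub>M\<^esub>i\<in>F. c i \<odot>\<^bsub>M\<^esub> b i)) \<and>
     (\<forall>F c. finite F \<and> F \<subseteq> J \<and> c \<in> F \<rightarrow> carrier K \<and>
        (\<Oplus>\<^bsub>M\<^esub>i\<in>F. c i \<odot>\<^bsub>M\<^esub> b i) = \<zero>\<^bsub>M\<^esub> \<longrightarrow> (\<forall>i\<in>F. c i = \<zero>\<^bsub>K\<^esub>))"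

text \<open>The map induced by \<open>F\<close> on cosets of \<open>I\<close>, in the style of \<^const>\<open>rcoset_mult\<close>.\<close>

definition coset_map :: "('k, 'a) module \<Rightarrow> 'a set \<Rightarrow> ('a \<Rightarrow> 'a) \<Rightarrow> 'a set \<Rightarrow> 'a set" where
  "coset_map A I F C = (\<Union>x\<in>C. I +>\<^bsub>A\<^esub> F x)"

definition quotient_algebra :: "('k, 'a) module \<Rightarrow> 'a set \<Rightarrow> ('k, 'a set) module" where
  "quotient_algebra A I =
     \<lparr>carrier = carrier (A Quot I), mult = mult (A Quot I), one = one (A Quot I),
      zero = zero (A Quot I), add = add (A Quot I),
      smult = (\<lambda>c. coset_map A I (\<lambda>x. c \<odot>\<^bsub>A\<^esub> x))\<rparr>"


section \<open>Bracketed words\<close>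

text \<open>The datatype \<open>bword\<close> is the union of the chain of free monoids: a word is a list of prime
  elements, and a prime element is a letter or a bracket, labelled by an operator, around a word.
  The monoid of words is written additively so that \<open>\<Rightarrow>\<^sub>0\<close> of \<^theory>\<open>HOL-Library.Poly_Mapping\<close>
  provides the (noncommutative) monoid algebra: \<open>0\<close> is the empty word, \<open>+\<close> is concatenation.\<close>

datatype ('l, prime_letters: 'x) bprime =
    Letter 'x
  | Bracket 'l "('l, 'x) bword"
and ('l, letters: 'x) bword =
    BWord (factors: "('l, 'x) bprime list")

instantiation bword :: (type, type) monoid_add
begin

definition zero_bword :: "('a, 'b) bword" where
  "0 = BWord []"

definition plus_bword :: "('a, 'b) bword \<Rightarrow> ('a, 'b) bword \<Rightarrow> ('a, 'b) bword" where
  "u + v = BWord (factors u @ factors v)"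

instance
  by standard (simp_all add: zero_bword_def plus_bword_def)

end

definition bwords :: "'x set \<Rightarrow> ('l, 'x) bword set" where
  "bwords X = {w. letters w \<subseteq> X}"

definition letter :: "'x \<Rightarrow> ('l, 'x) bword" where
  "letter x = BWord [Letter x]"

definition bracket :: "'l \<Rightarrow> ('l, 'x) bword \<Rightarrow> ('l, 'x) bword" where
  "bracket l w = BWord [Bracket l w]"

definition breadth :: "('l, 'x) bword \<Rightarrow> nat" where
  "breadth w = length (factors w)"

primrec prime_degree :: "('l, 'x) bprime \<Rightarrow> nat" and word_degree :: "('l, 'x) bword \<Rightarrow> nat" where
  "prime_degree (Letter x) = 1"
| "prime_degree (Bracket l w) = Suc (word_degree w)"
| "word_degree (BWord ps) = sum_list (map prime_degree ps)"

text \<open>The letter \<^term>\<open>None\<close> plays the role of the star, so words with stars have letters in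
  \<open>'x option\<close>.\<close>

primrec prime_stars :: "('l, 'x option) bprime \<Rightarrow> nat" and stars :: "('l, 'x option) bword \<Rightarrow> nat" where
  "prime_stars (Letter y) = (if y = None then 1 else 0)"
| "prime_stars (Bracket l w) = stars w"
| "stars (BWord ps) = sum_list (map prime_stars ps)"

definition star_bwords :: "'x set \<Rightarrow> ('l, 'x option) bword set" where
  "star_bwords X = {q \<in> bwords (insert None (Some ` X)). stars q = 1}"

primrec prime_subst :: "('l, 'x) bword \<Rightarrow> ('l, 'x option) bprime \<Rightarrow> ('l, 'x) bword"
  and subst :: "('l, 'x) bword \<Rightarrow> ('l, 'x option) bword \<Rightarrow> ('l, 'x) bword" where
  "prime_subst u (Letter y) = (case y of None \<Rightarrow> u | Some x \<Rightarrow> letter x)"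
| "prime_subst u (Bracket l w) = bracket l (subst u w)"
| "subst u (BWord ps) = sum_list (map (prime_subst u) ps)"


section \<open>The free operated algebra\<close>

abbreviation mon :: "('l, 'x) bword \<Rightarrow> (('l, 'x) bword \<Rightarrow>\<^sub>0 'k::comm_ring_1)" where
  "mon w \<equiv> Poly_Mapping.single w 1"

definition scalar_ring :: "'k::comm_ring_1 ring" where
  "scalar_ring = \<lparr>carrier = UNIV, mult = (*), one = 1, zero = 0, add = (+)\<rparr>"

definition scale :: "'k \<Rightarrow> ('a \<Rightarrow>\<^sub>0 'k) \<Rightarrow> ('a \<Rightarrow>\<^sub>0 'k::comm_ring_1)" where
  "scale c f = Poly_Mapping.map (\<lambda>a. c * a) f"

definition linear_extension :: "('a \<Rightarrow> 'b) \<Rightarrow> ('a \<Rightarrow>\<^sub>0 'k) \<Rightarrow> ('b \<Rightarrow>\<^sub>0 'k::comm_ring_1)" where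
  "linear_extension \<phi> f =
     (\<Sum>w\<in>Poly_Mapping.keys f. Poly_Mapping.single (\<phi> w) (Poly_Mapping.lookup f w))"

definition free_algebra :: "'x set \<Rightarrow> ('k::comm_ring_1, ('l, 'x) bword \<Rightarrow>\<^sub>0 'k) module" where
  "free_algebra X =
     \<lparr>carrier = {f. Poly_Mapping.keys f \<subseteq> bwords X}, mult = (*), one = 1, zero = 0, add = (+),
      smult = scale\<rparr>"

definition operated_ideal ::
  "'x set \<Rightarrow> (('l, 'x) bword \<Rightarrow>\<^sub>0 'k) set \<Rightarrow> (('l, 'x) bword \<Rightarrow>\<^sub>0 'k::comm_ring_1) set" where
  "operated_ideal X S =
     \<Inter>{J. ideal J (free_algebra X) \<and> (\<forall>l. \<forall>f\<in>J. linear_extension (bracket l) f \<in> J) \<and> S \<subseteq> J}"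


section \<open>The order by degree and breadth\<close>

text \<open>Strict order, for orders \<open>rX\<close> on letters and \<open>rL\<close> on operators. Prime elements are compared as
  words of breadth one, hence first by degree.\<close>

inductive db_less :: "'x rel \<Rightarrow> 'l rel \<Rightarrow> ('l, 'x) bword \<Rightarrow> ('l, 'x) bword \<Rightarrow> bool"
  and db_prime_less :: "'x rel \<Rightarrow> 'l rel \<Rightarrow> ('l, 'x) bprime \<Rightarrow> ('l, 'x) bprime \<Rightarrow> bool"
  for rX :: "'x rel" and rL :: "'l rel" where
  degree: "word_degree u < word_degree v \<Longrightarrow> db_less rX rL u v"
| breadth: "\<lbrakk>word_degree u = word_degree v; breadth u < breadth v\<rbrakk> \<Longrightarrow> db_less rX rL u v"
| factors: "\<lbrakk>word_degree u = word_degree v; breadth u = breadth v;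
     factors u = ps @ p # us; factors v = ps @ q # vs; db_prime_less rX rL p q\<rbrakk>
     \<Longrightarrow> db_less rX rL u v"
| prime_degree: "prime_degree p < prime_degree q \<Longrightarrow> db_prime_less rX rL p q"
| letters: "\<lbrakk>(x, y) \<in> rX; x \<noteq> y\<rbrakk> \<Longrightarrow> db_prime_less rX rL (Letter x) (Letter y)"
| letter_bracket: "prime_degree (Letter x :: ('l, 'x) bprime) = prime_degree (Bracket l v)
     \<Longrightarrow> db_prime_less rX rL (Letter x) (Bracket l v)"
| operators: "\<lbrakk>prime_degree (Bracket l u) = prime_degree (Bracket m v); (l, m) \<in> rL; l \<noteq> m\<rbrakk>
     \<Longrightarrow> db_prime_less rX rL (Bracket l u) (Bracket m v)"
| brackets: "\<lbrakk>prime_degree (Bracket l u) = prime_degree (Bracket l v); db_less rX rL u v\<rbrakk>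
     \<Longrightarrow> db_prime_less rX rL (Bracket l u) (Bracket l v)"

definition db_order :: "'x set \<Rightarrow> 'x rel \<Rightarrow> 'l rel \<Rightarrow> ('l, 'x) bword rel" where
  "db_order X rX rL =
     {(u, v). u \<in> bwords X \<and> v \<in> bwords X \<and> (u = v \<or> db_less rX rL u v)}"


section \<open>Groebner-Shirshov bases\<close>

text \<open>In this section \<open>r\<close> is the (reflexive) monomial order on \<^term>\<open>bwords X\<close>.\<close>

definition monomial_order :: "'x set \<Rightarrow> ('l, 'x) bword rel \<Rightarrow> bool" where
  "monomial_order X r \<longleftrightarrow>
     well_order_on (bwords X) r \<and>
     (\<forall>u v. (u, v) \<in> r - Id \<longrightarrow> (\<forall>q\<in>star_bwords X. (subst u q, subst v q) \<in> r - Id))"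

definition lead :: "('l, 'x) bword rel \<Rightarrow> (('l, 'x) bword \<Rightarrow>\<^sub>0 'k::comm_ring_1) \<Rightarrow> ('l, 'x) bword" where
  "lead r f = (THE w. w \<in> Poly_Mapping.keys f \<and> (\<forall>v\<in>Poly_Mapping.keys f. (v, w) \<in> r))"

definition monic :: "('l, 'x) bword rel \<Rightarrow> (('l, 'x) bword \<Rightarrow>\<^sub>0 'k::comm_ring_1) \<Rightarrow> bool" where
  "monic r f \<longleftrightarrow> f \<noteq> 0 \<and> Poly_Mapping.lookup f (lead r f) = 1"

definition poly_subst ::
  "('l, 'x option) bword \<Rightarrow> (('l, 'x) bword \<Rightarrow>\<^sub>0 'k) \<Rightarrow> (('l, 'x) bword \<Rightarrow>\<^sub>0 'k::comm_ring_1)" where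
  "poly_subst q f = linear_extension (\<lambda>u. subst u q) f"

definition intersection_composition ::
  "'x set \<Rightarrow> ('l, 'x) bword rel \<Rightarrow> (('l, 'x) bword \<Rightarrow>\<^sub>0 'k::comm_ring_1)
    \<Rightarrow> (('l, 'x) bword \<Rightarrow>\<^sub>0 'k) \<Rightarrow> ('l, 'x) bword \<Rightarrow> (('l, 'x) bword \<Rightarrow>\<^sub>0 'k) \<Rightarrow> bool" where
  "intersection_composition X r f g w h \<longleftrightarrow>
     (\<exists>u\<in>bwords X. \<exists>v\<in>bwords X.
        w = lead r f + u \<and> w = v + lead r g \<and>
        max (breadth (lead r f)) (breadth (lead r g)) < breadth w \<and>
        breadth w < breadth (lead r f) + breadth (lead r g) \<and>
        h = f * mon u - mon v * g)"

definition including_composition ::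
  "'x set \<Rightarrow> ('l, 'x) bword rel \<Rightarrow> (('l, 'x) bword \<Rightarrow>\<^sub>0 'k::comm_ring_1)
    \<Rightarrow> (('l, 'x) bword \<Rightarrow>\<^sub>0 'k) \<Rightarrow> ('l, 'x) bword \<Rightarrow> (('l, 'x) bword \<Rightarrow>\<^sub>0 'k) \<Rightarrow> bool" where
  "including_composition X r f g w h \<longleftrightarrow>
     (\<exists>q\<in>star_bwords X.
        w = lead r f \<and> w = subst (lead r g) q \<and> h = f - poly_subst q g)"

definition trivial_modulo ::
  "'x set \<Rightarrow> ('l, 'x) bword rel \<Rightarrow> (('l, 'x) bword \<Rightarrow>\<^sub>0 'k::comm_ring_1) set
    \<Rightarrow> ('l, 'x) bword \<Rightarrow> (('l, 'x) bword \<Rightarrow>\<^sub>0 'k) \<Rightarrow> bool" where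
  "trivial_modulo X r S w h \<longleftrightarrow>
     (\<exists>(n::nat) c q s.
        (\<forall>i<n. c i \<noteq> 0 \<and> q i \<in> star_bwords X \<and> s i \<in> S \<and>
           (subst (lead r (s i)) (q i), w) \<in> r - Id) \<and>
        h = (\<Sum>i<n. scale (c i) (poly_subst (q i) (s i))))"

text \<open>Compositions are formed for distinct \<open>f\<close> and \<open>g\<close> only.\<close>

definition groebner_shirshov_basis ::
  "'x set \<Rightarrow> ('l, 'x) bword rel \<Rightarrow> (('l, 'x) bword \<Rightarrow>\<^sub>0 'k::comm_ring_1) set \<Rightarrow> bool" where
  "groebner_shirshov_basis X r S \<longleftrightarrow>
     S \<subseteq> carrier (free_algebra X) \<and> (\<forall>s\<in>S. monic r s) \<and>
     (\<forall>f\<in>S. \<forall>g\<in>S. f \<noteq> g \<longrightarrow>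
        (\<forall>w h. intersection_composition X r f g w h \<or> including_composition X r f g w h \<longrightarrow>
           trivial_modulo X r S w h))"

definition irreducible_words ::
  "'x set \<Rightarrow> ('l, 'x) bword rel \<Rightarrow> (('l, 'x) bword \<Rightarrow>\<^sub>0 'k::comm_ring_1) set \<Rightarrow> ('l, 'x) bword set" where
  "irreducible_words X r S =
     {w \<in> bwords X. \<not> (\<exists>q\<in>star_bwords X. \<exists>s\<in>S. w = subst (lead r s) q)}"


section \<open>The defining relations of Rota-Baxter systems\<close>

text \<open>The set of operators is \<open>'w + 'w\<close>.\<close>

abbreviation bracketR :: "'w \<Rightarrow> ('w + 'w, 'x) bword \<Rightarrow> ('w + 'w, 'x) bword" where
  "bracketR \<omega> \<equiv> bracket (Inl \<omega>)"

abbreviation bracketS :: "'w \<Rightarrow> ('w + 'w, 'x) bword \<Rightarrow> ('w + 'w, 'x) bword" where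
  "bracketS \<omega> \<equiv> bracket (Inr \<omega>)"

context four_operations
begin

definition relationR ::
  "'w \<Rightarrow> 'w \<Rightarrow> ('w + 'w, 'x) bword \<Rightarrow> ('w + 'w, 'x) bword \<Rightarrow> (('w + 'w, 'x) bword \<Rightarrow>\<^sub>0 'k::comm_ring_1)" where
  "relationR \<alpha> \<beta> u v =
     mon (bracketR \<alpha> u + bracketR \<beta> v)
     - mon (bracketR (\<alpha> \<^bold>\<rightarrow> \<beta>) (bracketR (\<alpha> \<^bold>\<rhd> \<beta>) u + v))
     - mon (bracketR (\<alpha> \<^bold>\<leftarrow> \<beta>) (u + bracketS (\<alpha> \<^bold>\<lhd> \<beta>) v))"

definition relationS ::
  "'w \<Rightarrow> 'w \<Rightarrow> ('w + 'w, 'x) bword \<Rightarrow> ('w + 'w, 'x) bword \<Rightarrow> (('w + 'w, 'x) bword \<Rightarrow>\<^sub>0 'k::comm_ring_1)" where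
  "relationS \<alpha> \<beta> u v =
     mon (bracketS \<alpha> u + bracketS \<beta> v)
     - mon (bracketS (\<alpha> \<^bold>\<rightarrow> \<beta>) (bracketR (\<alpha> \<^bold>\<rhd> \<beta>) u + v))
     - mon (bracketS (\<alpha> \<^bold>\<leftarrow> \<beta>) (u + bracketS (\<alpha> \<^bold>\<lhd> \<beta>) v))"

definition rb_relations :: "'x set \<Rightarrow> (('w + 'w, 'x) bword \<Rightarrow>\<^sub>0 'k::comm_ring_1) set" where
  "rb_relations X =
     {relationR \<alpha> \<beta> u v | \<alpha> \<beta> u v. u \<in> bwords X \<and> v \<in> bwords X} \<union>
     {relationS \<alpha> \<beta> u v | \<alpha> \<beta> u v. u \<in> bwords X \<and> v \<in> bwords X}"

end

end

theory Submission
  imports Defs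
begin

text \<open>The relations rewrite two neighbouring brackets of the same kind, so every irreducible word is
  its own normal form under the product that merges two words by resolving the clash at the seam. This
  product is defined on all words. Multiplying three brackets of the same kind in the two possible ways
  gives five terms on either side, and the axioms of an extended diassociative semigroup say exactly that
  they agree term by term; associativity of the whole product follows by induction on the degree. Reading
  words with respect to this product is then an algebra morphism that kills the ideal and fixes the
  irreducible words, which makes the latter independent; they span by rewriting along the order.
  Conversely, if all compositions are trivial, the defect of associativity on overlaps of degree four
  vanishes up to terms that do not interfere, and comparing terms yields the fifteen axioms.\<close>

section \<open>Linear maps between free modules\<close>

text \<open>Independence is not drawn from a general diamond lemma: the quotient is compared
  directly with the module of words under the new product. The map \<open>nf\<close>, which reads
  words in that product, is defined for arbitrary operations, and this makes it usable in the
  converse as well. There it is not a morphism, but it nests to the right, so a relation followed by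
  one more factor is read as an associator. Triviality of a composition then expresses this
  associator through those of smaller overlaps, and an induction along the order removes them all.
  Two obstacles shape the converse. An overlap of a relation with itself gives no information, so
  some associators of degree three stay uncontrolled; one extra degree in the test words makes the
  two relations distinct, and a projection removes the uncontrolled part. Moreover \<open>X\<close>
  may be empty, so the words that finally yield the axioms are built from brackets around the empty
  word. The scalars form an arbitrary nontrivial commutative ring, so terms are compared through
  coefficients 0 and 1 only, without division.\<close>

abbreviation keys :: "('a \<Rightarrow>\<^sub>0 'b::zero) \<Rightarrow> 'a set" where
  "keys \<equiv> Poly_Mapping.keys"

abbreviation lookup :: "('a \<Rightarrow>\<^sub>0 'b::zero) \<Rightarrow> 'a \<Rightarrow> 'b" where
  "lookup \<equiv> Poly_Mapping.lookup"

abbreviation single :: "'a \<Rightarrow> 'b \<Rightarrow> 'a \<Rightarrow>\<^sub>0 'b::zero" where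
  "single \<equiv> Poly_Mapping.single"

definition klinear :: "(('a \<Rightarrow>\<^sub>0 'k::comm_ring_1) \<Rightarrow> ('b \<Rightarrow>\<^sub>0 'k)) \<Rightarrow> bool" where
  "klinear F \<longleftrightarrow> (\<forall>f g. F (f + g) = F f + F g) \<and> (\<forall>c f. F (scale c f) = scale c (F f))"

text \<open>Values may be arbitrary combinations, so this covers products and normal forms;
  \<open>linear_extension\<close> is the case in which words go to words
  (\<open>linear_extension_lin\<close>).\<close>

definition lin :: "('a \<Rightarrow> ('b \<Rightarrow>\<^sub>0 'k)) \<Rightarrow> ('a \<Rightarrow>\<^sub>0 'k::comm_ring_1) \<Rightarrow> ('b \<Rightarrow>\<^sub>0 'k)" where
  "lin \<phi> f = (\<Sum>w\<in>keys f. scale (lookup f w) (\<phi> w))"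

lemma lookup_scale [simp]: "lookup (scale c f) k = c * lookup f k"
  by (simp add: scale_def Poly_Mapping.map.rep_eq when_def)

lemma scale_zero_left [simp]: "scale 0 f = 0"
  and scale_zero_right [simp]: "scale c 0 = 0"
  and scale_one [simp]: "scale 1 f = f"
  and scale_scale [simp]: "scale c (scale d f) = scale (c * d) f"
  and scale_add_left: "scale (c + d) f = scale c f + scale d f"
  and scale_add_right: "scale c (f + g) = scale c f + scale c g"
  and scale_minus_one: "scale (- 1) f = - f"
  and scale_single [simp]: "scale c (single k d) = single k (c * d)"
  by (rule poly_mapping_eqI; simp add: lookup_add algebra_simps lookup_single when_def)+

lemma scale_sum: "scale c (\<Sum>i\<in>I. f i) = (\<Sum>i\<in>I. scale c (f i))"
  by (induction I rule: infinite_finite_induct) (simp_all add: scale_add_right)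

lemma scale_mult_left: "scale c f * g = scale c (f * g)"
  for f :: "'a::monoid_add \<Rightarrow>\<^sub>0 'k::comm_ring_1"
  by (simp add: scale_def mult_map_scale_conv_mult mult.assoc)

text \<open>The scalar passes the coefficients of \<open>f\<close> because \<open>'k\<close> is
  commutative. Pulling it out of the two nested \<open>Sum_any\<close> requires finite supports,
  which are bounded by \<open>keys g\<close> and \<open>keys f\<close>.\<close>

lemma scale_mult_right: "f * scale c g = scale c (f * g)"
  for f :: "'a::monoid_add \<Rightarrow>\<^sub>0 'k::comm_ring_1"
proof (rule poly_mapping_eqI)
  fix k
  have "lookup (f * scale c g) k =
      (\<Sum>l. c * (lookup f l * (\<Sum>q. lookup g q when k = l + q)))"
  proof -
    have "(\<Sum>q. c * lookup g q when k = l + q) =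
        c * (\<Sum>q. lookup g q when k = l + q)" for l
    proof -
      have "finite {q. (lookup g q when k = l + q) \<noteq> 0}"
        by (rule finite_subset[of _ "keys g"]) (auto simp: in_keys_iff when_def)
      then show ?thesis
        by (simp add: Sum_any_right_distrib mult_when)
    qed
    then show ?thesis
      by (simp add: lookup_mult mult.left_commute)
  qed
  also have "\<dots> = c * lookup (f * g) k"
  proof -
    have "finite {l. lookup f l * (\<Sum>q. lookup g q when k = l + q) \<noteq> 0}"
      by (rule finite_subset[of _ "keys f"]) (auto simp: in_keys_iff)
    then show ?thesis
      by (simp add: lookup_mult Sum_any_right_distrib)
  qed
  finally show "lookup (f * scale c g) k = lookup (scale c (f * g)) k"
    by simp
qed

lemma klinearD:
  assumes "klinear F"
  shows klinear_add: "F (f + g) = F f + F g"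
    and klinear_scale: "F (scale c f) = scale c (F f)"
    and klinear_zero: "F 0 = 0"
    and klinear_minus: "F (- f) = - F f"
    and klinear_diff: "F (f - g) = F f - F g"
    and klinear_sum: "F (\<Sum>i\<in>I. h i) = (\<Sum>i\<in>I. F (h i))"
proof -
  show add: "F (f + g) = F f + F g" for f g
    using assms by (simp add: klinear_def)
  show scale: "F (scale c f) = scale c (F f)" for c f
    using assms by (simp add: klinear_def)
  show zero: "F 0 = 0"
    using scale[of 0 0] by simp
  show minus: "F (- f) = - F f" for f
    using scale[of "-1" f] by (simp add: scale_minus_one)
  show "F (f - g) = F f - F g"
    using add[of f "- g"] by (simp add: minus)
  show "F (\<Sum>i\<in>I. h i) = (\<Sum>i\<in>I. F (h i))"
    by (induction I rule: infinite_finite_induct) (simp_all add: zero add)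
qed

lemma klinear_lin: "klinear (lin \<phi>)"
  unfolding klinear_def
proof (intro conjI allI)
  fix f g :: "'a \<Rightarrow>\<^sub>0 'b"
  show "lin \<phi> (f + g) = lin \<phi> f + lin \<phi> g"
    unfolding lin_def by (rule setsum_keys_plus_distrib) (simp_all add: scale_add_left)
next
  fix c and f :: "'a \<Rightarrow>\<^sub>0 'b"
  have "lin \<phi> (scale c f) =
      (\<Sum>w\<in>keys f. scale (lookup (scale c f) w) (\<phi> w))"
    unfolding lin_def by (rule sum.mono_neutral_left) (auto simp: in_keys_iff)
  then show "lin \<phi> (scale c f) = scale c (lin \<phi> f)"
    by (simp add: lin_def scale_sum)
qed

lemma lin_single [simp]: "lin \<phi> (single w 1) = \<phi> w"
  by (simp add: lin_def)

lemma lin_mon_id: "lin (\<lambda>w. single w 1) f = f"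
  by (rule poly_mapping_eqI) (auto simp: lin_def lookup_sum lookup_single when_def in_keys_iff)

lemma klinear_expand:
  assumes "klinear F"
  shows "F f = lin (\<lambda>w. F (single w 1)) f"
proof -
  have "F f = F (lin (\<lambda>w. single w 1) f)"
    by (simp add: lin_mon_id)
  also have "\<dots> = (\<Sum>w\<in>keys f.
      scale (lookup f w) (F (single w 1)))"
    unfolding lin_def by (simp only: klinear_sum[OF assms] klinear_scale[OF assms])
  finally show ?thesis
    by (simp add: lin_def)
qed

text \<open>Most identities between linear or bilinear maps below are checked on monomials in this
  way. Only monomials in the support of \<open>f\<close> matter, so facts about
  \<open>keys f\<close>, such as the absence of the empty word, remain available.\<close>

lemma klinear_eqI:
  assumes "klinear F" "klinear G"
    and "\<And>w. w \<in> keys f \<Longrightarrow> F (single w 1) = G (single w 1)"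
  shows "F f = G f"
  unfolding klinear_expand[OF assms(1), of f] klinear_expand[OF assms(2), of f]
  by (auto simp: lin_def assms(3) intro: sum.cong)

lemma klinear_id: "klinear (\<lambda>f. f)"
  by (simp add: klinear_def)

lemma klinear_comp: "klinear F \<Longrightarrow> klinear G \<Longrightarrow> klinear (\<lambda>f. F (G f))"
  by (simp add: klinear_def)

lemma klinear_plus: "klinear F \<Longrightarrow> klinear G \<Longrightarrow> klinear (\<lambda>f. F f + G f)"
  by (simp add: klinear_def scale_add_right algebra_simps)

lemma klinear_mult_left: "klinear (\<lambda>f. g * f)"
  and klinear_mult_right: "klinear (\<lambda>f. f * g)"
  for g :: "'a::monoid_add \<Rightarrow>\<^sub>0 'k::comm_ring_1"
  by (simp_all add: klinear_def scale_mult_left scale_mult_right distrib_left distrib_right)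

lemma linear_extension_lin: "linear_extension \<phi> = lin (\<lambda>w. single (\<phi> w) 1)"
  by (simp add: linear_extension_def lin_def fun_eq_iff)

lemma klinear_linear_extension: "klinear (linear_extension \<phi>)"
  unfolding linear_extension_lin by (rule klinear_lin)

lemma linear_extension_single [simp]:
  "linear_extension \<phi> (single w 1) = single (\<phi> w) 1"
  by (simp add: linear_extension_lin)

lemma linear_extension_comp:
  "linear_extension \<phi> (linear_extension \<psi> f) = linear_extension (\<lambda>w. \<phi> (\<psi> w)) f"
  by (rule klinear_eqI[OF klinear_comp[OF klinear_linear_extension klinear_linear_extension]
        klinear_linear_extension]) simp

lemma linear_extension_id: "linear_extension (\<lambda>w. w) f = f"
  by (rule klinear_eqI[OF klinear_linear_extension klinear_id]) simp

lemma linear_extension_plus_left: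
  "linear_extension (\<lambda>w. a + \<phi> w) f = single a 1 * linear_extension \<phi> f"
  by (rule klinear_eqI[OF klinear_linear_extension
        klinear_comp[OF klinear_mult_left klinear_linear_extension]]) (simp add: mult_single)

lemma linear_extension_plus_right:
  "linear_extension (\<lambda>w. \<phi> w + a) f = linear_extension \<phi> f * single a 1"
  by (rule klinear_eqI[OF klinear_linear_extension
        klinear_comp[OF klinear_mult_right klinear_linear_extension]]) (simp add: mult_single)

lemma keys_sum: "keys (\<Sum>i\<in>I. f i) \<subseteq> (\<Union>i\<in>I. keys (f i))"
proof
  fix k
  assume "k \<in> keys (\<Sum>i\<in>I. f i)"
  then have "(\<Sum>i\<in>I. lookup (f i) k) \<noteq> 0"
    by (simp add: in_keys_iff lookup_sum)
  then obtain i where "i \<in> I" "lookup (f i) k \<noteq> 0"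
    by (rule sum.not_neutral_contains_not_neutral)
  then show "k \<in> (\<Union>i\<in>I. keys (f i))"
    by (auto simp: in_keys_iff)
qed

lemma keys_linear_extension: "keys (linear_extension \<phi> f) \<subseteq> \<phi> ` keys f"
  unfolding linear_extension_def by (rule order_trans[OF keys_sum]) (auto split: if_splits)

lemma keys_scale: "keys (scale c f) \<subseteq> keys f"
  by (auto simp: in_keys_iff)

section \<open>Words and contexts\<close>

lemma factors_plus [simp]: "factors (u + v) = factors u @ factors v"
  and factors_zero [simp]: "factors 0 = []"
  by (simp_all add: plus_bword_def zero_bword_def)

lemma bword_eq_iff: "u = v \<longleftrightarrow> factors u = factors v"
  by (metis bword.expand)

lemma factors_eq_Nil: "factors u = [] \<longleftrightarrow> u = 0"
  by (simp add: bword_eq_iff)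

lemma plus_eq_0_bword [simp]: "u + v = 0 \<longleftrightarrow> u = 0 \<and> v = 0" for u v :: "('l, 'x) bword"
  by (simp add: bword_eq_iff)

lemma bracket_neq_0 [simp]: "bracket l u \<noteq> 0" and letter_neq_0 [simp]: "letter x \<noteq> 0"
  by (simp_all add: bword_eq_iff bracket_def letter_def)

lemma factors_bracket [simp]: "factors (bracket l u) = [Bracket l u]"
  and factors_letter [simp]: "factors (letter x) = [Letter x]"
  by (simp_all add: bracket_def letter_def)

lemma breadth_simps [simp]:
  "breadth (u + v) = breadth u + breadth v" "breadth 0 = 0"
  "breadth (bracket l u) = 1" "breadth (letter x) = 1" "breadth (BWord ps) = length ps"
  by (simp_all add: breadth_def)

lemma breadth_eq_0 [simp]: "breadth u = 0 \<longleftrightarrow> u = 0"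
  by (simp add: breadth_def factors_eq_Nil)

lemma word_degree_factors: "word_degree u = sum_list (map prime_degree (factors u))"
  by (cases u) simp

lemma word_degree_simps [simp]:
  "word_degree (u + v) = word_degree u + word_degree v" "word_degree 0 = 0"
  "word_degree (bracket l u) = Suc (word_degree u)" "word_degree (letter x) = 1"
  by (simp_all add: word_degree_factors)

lemma prime_degree_neq_0 [simp]: "prime_degree p \<noteq> 0"
  by (cases p) auto

lemma word_degree_eq_0 [simp]: "word_degree u = 0 \<longleftrightarrow> u = 0"
proof
  assume "word_degree u = 0"
  then have "factors u = []"
    by (cases "factors u") (simp_all add: word_degree_factors)
  then show "u = 0" by (simp add: factors_eq_Nil)
qed simp

lemma word_degree_pos [simp]: "0 < word_degree u \<longleftrightarrow> u \<noteq> 0"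
  using word_degree_eq_0[of u] by linarith

text \<open>One step peels off the first prime factor and, if it is a bracket, also descends into
  it. Both parts have smaller degree, so a single predicate replaces mutual induction on primes,
  words and factor lists.\<close>

lemma bword_induct [case_names zero plus_letter plus_bracket]:
  assumes "P 0" "\<And>x u. P u \<Longrightarrow> P (letter x + u)" "\<And>l u v. P u \<Longrightarrow> P v \<Longrightarrow> P (bracket l u + v)"
  shows "P u"
proof (induction "word_degree u" arbitrary: u rule: less_induct)
  case less
  show ?case
  proof (cases "factors u")
    case Nil
    then have "u = 0" by (simp only: factors_eq_Nil)
    then show ?thesis using assms(1) by (simp only:)
  next
    case (Cons p ps)
    then have u: "u = BWord [p] + BWord ps"
      by (cases u) (simp add: plus_bword_def)
    have ps: "P (BWord ps)"
      by (rule less) (cases p; simp add: u)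
    show ?thesis
    proof (cases p)
      case (Letter x)
      then have "u = letter x + BWord ps"
        by (simp only: u letter_def)
      then show ?thesis
        using assms(2)[OF ps] by (simp only:)
    next
      case (Bracket l v)
      then have u': "u = bracket l v + BWord ps"
        by (simp only: u bracket_def)
      have "P v"
        by (rule less) (simp add: u')
      then show ?thesis
        using assms(3)[OF _ ps] by (simp only: u')
    qed
  qed
qed

lemma letters_factors: "letters u = (\<Union>p\<in>set (factors u). prime_letters p)"
  by (cases u) simp

lemma bwords_iff: "u \<in> bwords X \<longleftrightarrow> (\<forall>p\<in>set (factors u). prime_letters p \<subseteq> X)"
  by (auto simp: bwords_def letters_factors)

lemma bwords_simps [simp]:
  "0 \<in> bwords X" "u + v \<in> bwords X \<longleftrightarrow> u \<in> bwords X \<and> v \<in> bwords X"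
  "bracket l u \<in> bwords X \<longleftrightarrow> u \<in> bwords X" "letter x \<in> bwords X \<longleftrightarrow> x \<in> X"
  by (auto simp: bwords_iff letters_factors) 

lemma subst_factors: "subst u w = sum_list (map (prime_subst u) (factors w))"
  by (cases w) simp

lemma subst_simps [simp]:
  "subst u 0 = 0" "subst u (v + w) = subst u v + subst u w"
  "subst u (bracket l v) = bracket l (subst u v)"
  "subst u (letter y) = (case y of None \<Rightarrow> u | Some x \<Rightarrow> letter x)"
  by (simp_all add: subst_factors)

lemma stars_factors: "stars w = sum_list (map prime_stars (factors w))"
  by (cases w) simp

lemma stars_simps [simp]:
  "stars 0 = 0" "stars (v + w) = stars v + stars w" "stars (bracket l v) = stars v"
  "stars (letter y) = (if y = None then 1 else 0)"
  by (simp_all add: stars_factors)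

text \<open>Substitution into a word with one star, with the word itself forgotten.\<close>

inductive_set contexts :: "'x set \<Rightarrow> (('l, 'x) bword \<Rightarrow> ('l, 'x) bword) set" for X where
  hole: "(\<lambda>u. u) \<in> contexts X"
| left: "\<phi> \<in> contexts X \<Longrightarrow> a \<in> bwords X \<Longrightarrow> (\<lambda>u. a + \<phi> u) \<in> contexts X"
| right: "\<phi> \<in> contexts X \<Longrightarrow> a \<in> bwords X \<Longrightarrow> (\<lambda>u. \<phi> u + a) \<in> contexts X"
| under: "\<phi> \<in> contexts X \<Longrightarrow> (\<lambda>u. bracket l (\<phi> u)) \<in> contexts X"

lemma starfree_subst:
  assumes "q \<in> bwords (insert None (Some ` X))" "stars q = 0"
  shows "\<exists>a\<in>bwords X. \<forall>u. subst u q = a"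
  using assms
proof (induction q rule: bword_induct)
  case zero
  then show ?case by (auto intro: bexI[of _ 0])
next
  case (plus_letter x u)
  then obtain a y where "a \<in> bwords X" "\<forall>v. subst v u = a" "x = Some y" "y \<in> X"
    by (auto split: if_splits)
  then show ?case by (auto intro!: bexI[of _ "letter y + a"])
next
  case (plus_bracket l u v)
  then obtain a b where "a \<in> bwords X" "\<forall>w. subst w u = a" "b \<in> bwords X" "\<forall>w. subst w v = b"
    by auto
  then show ?case by (auto intro!: bexI[of _ "bracket l a + b"])
qed

text \<open>Exactly one factor carries the star. The others are free of it, so substitution leaves
  them constant and they become the \<open>a\<close> of a \<open>left\<close> or
  \<open>right\<close> step.\<close>

lemma subst_in_contexts:
  assumes "q \<in> star_bwords X"
  shows "(\<lambda>u. subst u q) \<in> contexts X"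
proof -
  have "q \<in> bwords (insert None (Some ` X)) \<Longrightarrow> stars q = 1 \<Longrightarrow> (\<lambda>u. subst u q) \<in> contexts X"
  proof (induction q rule: bword_induct)
    case zero
    then show ?case by simp
  next
    case (plus_letter x u)
    show ?case
    proof (cases x)
      case None
      then obtain a where "a \<in> bwords X" "\<And>v. subst v u = a"
        using plus_letter starfree_subst[of u X] by auto
      then show ?thesis
        using contexts.right[OF contexts.hole, of a X] None by simp
    next
      case (Some y)
      then show ?thesis
        using plus_letter contexts.left[of "\<lambda>v. subst v u" X "letter y"] by auto
    qed
  next
    case (plus_bracket l u v)
    show ?case
    proof (cases "stars u = 0")
      case True
      then obtain a where "a \<in> bwords X" "\<And>w. subst w u = a"
        using plus_bracket starfree_subst[of u X] by auto
      then show ?thesis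
        using True plus_bracket contexts.left[of "\<lambda>w. subst w v" X "bracket l a"] by simp
    next
      case False
      then have "stars u = 1" "stars v = 0"
        using plus_bracket by auto
      moreover obtain a where "a \<in> bwords X" "\<And>w. subst w v = a"
        using plus_bracket starfree_subst[of v X] \<open>stars v = 0\<close> by auto
      ultimately show ?thesis
        using plus_bracket contexts.right[OF contexts.under, of "\<lambda>w. subst w u" X a] by simp
    qed
  qed
  then show ?thesis
    using assms by (simp add: star_bwords_def)
qed

lemma starfree_lift:
  "a \<in> bwords X \<Longrightarrow> \<exists>q\<in>bwords (insert None (Some ` X)). stars q = 0 \<and> (\<forall>u. subst u q = a)"
proof (induction a rule: bword_induct)
  case zero
  then show ?case by (intro bexI[of _ 0]) auto
next
  case (plus_letter x u)
  then obtain q where "q\<in>bwords (insert None (Some ` X))" "stars q = 0" "\<forall>v. subst v q = u" by auto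
  then show ?case using plus_letter by (intro bexI[of _ "letter (Some x) + q"]) auto
next
  case (plus_bracket l u v)
  then obtain q q' where "q\<in>bwords (insert None (Some ` X))" "stars q = 0" "\<forall>v. subst v q = u"
    "q'\<in>bwords (insert None (Some ` X))" "stars q' = 0" "\<forall>w. subst w q' = v" by auto
  then show ?case by (intro bexI[of _ "bracket l q + q'"]) auto
qed

lemma contexts_subst:
  assumes "\<phi> \<in> contexts X"
  obtains q where "q \<in> star_bwords X" "\<And>u. subst u q = \<phi> u"
proof -
  have "\<exists>q\<in>star_bwords X. \<forall>u. subst u q = \<phi> u"
    using assms
  proof induction
    case hole
    then show ?case
      by (intro bexI[of _ "letter None"]) (auto simp: star_bwords_def)
  next
    case (left \<phi> a)
    then obtain q b where "q \<in> star_bwords X" "\<forall>u. subst u q = \<phi> u"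
        "b \<in> bwords (insert None (Some ` X))" "stars b = 0" "\<forall>u. subst u b = a"
      using starfree_lift[OF left(2)] by auto
    then show ?case
      by (intro bexI[of _ "b + q"]) (auto simp: star_bwords_def)
  next
    case (right \<phi> a)
    then obtain q b where "q \<in> star_bwords X" "\<forall>u. subst u q = \<phi> u"
        "b \<in> bwords (insert None (Some ` X))" "stars b = 0" "\<forall>u. subst u b = a"
      using starfree_lift[OF right(2)] by auto
    then show ?case
      by (intro bexI[of _ "q + b"]) (auto simp: star_bwords_def)
  next
    case (under \<phi> l)
    then obtain q where "q \<in> star_bwords X" "\<forall>u. subst u q = \<phi> u" by auto
    then show ?case
      by (intro bexI[of _ "bracket l q"]) (auto simp: star_bwords_def)
  qed
  then show ?thesis using that by auto
qed

lemma contexts_closed: "\<phi> \<in> contexts X \<Longrightarrow> \<phi> u \<in> bwords X \<longleftrightarrow> u \<in> bwords X"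
  by (induction rule: contexts.induct) auto

text \<open>The hole lies either among the top-level factors or strictly inside one top-level
  bracket. This dichotomy drives the case distinctions about relations placed in a context.\<close>

lemma contexts_cases:
  assumes "\<phi> \<in> contexts X"
  obtains (top) a b where "a \<in> bwords X" "b \<in> bwords X" "\<phi> = (\<lambda>u. a + u + b)"
  | (nested) a l \<psi> b where "a \<in> bwords X" "b \<in> bwords X" "\<psi> \<in> contexts X"
      "\<phi> = (\<lambda>u. a + bracket l (\<psi> u) + b)"
proof -
  have "(\<exists>a\<in>bwords X. \<exists>b\<in>bwords X. \<phi> = (\<lambda>u. a + u + b)) \<or>
    (\<exists>a\<in>bwords X. \<exists>b\<in>bwords X. \<exists>\<psi>\<in>contexts X. \<exists>l. \<phi> = (\<lambda>u. a + bracket l (\<psi> u) + b))"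
    using assms
  proof induction
    case hole
    show ?case by (rule disjI1, intro bexI[of _ 0]) auto
  next
    case (left \<phi> c)
    from left(3) show ?case
    proof (elim disjE bexE exE)
      fix a b assume *: "a \<in> bwords X" "b \<in> bwords X" "\<phi> = (\<lambda>u. a + u + b)"
      then show ?thesis
        by (intro disjI1 bexI[of _ "c + a"] bexI[of _ b]) (auto simp: left add.assoc)
    next
      fix a b \<psi> l
      assume *: "a \<in> bwords X" "b \<in> bwords X" "\<psi> \<in> contexts X" "\<phi> = (\<lambda>u. a + bracket l (\<psi> u) + b)"
      then show ?thesis
        by (intro disjI2 bexI[of _ "c + a"] bexI[of _ b] bexI[of _ \<psi>] exI[of _ l])
          (auto simp: left add.assoc)
    qed
  next
    case (right \<phi> c)
    from right(3) show ?case
    proof (elim disjE bexE exE)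
      fix a b assume *: "a \<in> bwords X" "b \<in> bwords X" "\<phi> = (\<lambda>u. a + u + b)"
      then show ?thesis
        by (intro disjI1 bexI[of _ a] bexI[of _ "b + c"]) (auto simp: right add.assoc)
    next
      fix a b \<psi> l
      assume *: "a \<in> bwords X" "b \<in> bwords X" "\<psi> \<in> contexts X" "\<phi> = (\<lambda>u. a + bracket l (\<psi> u) + b)"
      then show ?thesis
        by (intro disjI2 bexI[of _ a] bexI[of _ "b + c"] bexI[of _ \<psi>] exI[of _ l])
          (auto simp: right add.assoc)
    qed
  next
    case (under \<phi> l)
    then show ?case
      by (intro disjI2 bexI[of _ 0] bexI[of _ \<phi>] exI[of _ l]) auto
  qed
  then show ?thesis using that by blast
qed

section \<open>The order by degree and breadth\<close>

text \<open>For factor lists of equal length, comparison at the first difference is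
  \<open>lex\<close>, so compatibility with concatenation and totality reduce to facts about
  \<open>lex\<close>.\<close>

lemma db_less_simp:
  "db_less rX rL u v \<longleftrightarrow>
     word_degree u < word_degree v \<or>
     word_degree u = word_degree v \<and>
       (breadth u < breadth v \<or>
        breadth u = breadth v \<and> (factors u, factors v) \<in> lex {(p, q). db_prime_less rX rL p q})"
proof -
  have lex: "(factors u, factors v) \<in> lex {(p, q). db_prime_less rX rL p q} \<longleftrightarrow>
      length (factors u) = length (factors v) \<and> (\<exists>ps p us q vs. factors u = ps @ p # us \<and>
        factors v = ps @ q # vs \<and> db_prime_less rX rL p q)"
    by (auto simp: lex_conv)
  show ?thesis
    unfolding lex by (subst db_less.simps) (auto simp: breadth_def)
qed

lemma db_less_degree: "db_less rX rL u v \<Longrightarrow> word_degree u \<le> word_degree v"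
  by (auto simp: db_less_simp)

lemma db_less_mono_left: "db_less rX rL u v \<Longrightarrow> db_less rX rL (a + u) (a + v)"
  by (auto simp: db_less_simp lex_append_leftI)

lemma db_less_mono_right: "db_less rX rL u v \<Longrightarrow> db_less rX rL (u + a) (v + a)"
  by (auto simp: db_less_simp breadth_def lex_append_rightI)

text \<open>A smaller degree stays smaller under one more operator. At equal degree both sides are
  words of breadth one with the same operator, so the comparison passes to their contents.\<close>

lemma db_less_mono_bracket:
  assumes "db_less rX rL u v"
  shows "db_less rX rL (bracket l u) (bracket l v)"
proof (cases "word_degree u = word_degree v")
  case True
  have "db_prime_less rX rL (Bracket l u) (Bracket l v)"
    by (rule db_less_db_prime_less.brackets) (use True assms in auto)
  with True show ?thesis
    by (simp add: db_less_simp[of _ _ "bracket l u"])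
next
  case False
  then show ?thesis
    using db_less_degree[OF assms] by (auto intro!: db_less_db_prime_less.degree)
qed

lemma db_less_contexts: "\<phi> \<in> contexts X \<Longrightarrow> db_less rX rL u v \<Longrightarrow> db_less rX rL (\<phi> u) (\<phi> v)"
  by (induction rule: contexts.induct)
    (auto intro: db_less_mono_left db_less_mono_right db_less_mono_bracket)

lemma db_order_iff:
  "(u, v) \<in> db_order X rX rL \<longleftrightarrow> u \<in> bwords X \<and> v \<in> bwords X \<and> (u = v \<or> db_less rX rL u v)"
  by (simp add: db_order_def)

text \<open>Encodes the comparison of primes as a lexicographic product. The tag 0 or 1 puts letters
  before brackets of the same degree. Absent components are filled by \<open>undefined\<close>,
  which agrees on both sides, so the comparison moves on to the next component.\<close>

definition prime_key :: "('l, 'x) bprime \<Rightarrow> nat \<times> nat \<times> 'x \<times> 'l \<times> ('l, 'x) bword" where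
  "prime_key p = (prime_degree p, case p of
     Letter x \<Rightarrow> (0, x, undefined, undefined) | Bracket l w \<Rightarrow> (1, undefined, l, w))"

section \<open>Well-foundedness and totality of the order\<close>

context
  fixes X :: "'x set" and rX :: "'x rel" and rL :: "'l rel"
  assumes rX: "well_order_on X rX" and rL: "well_order_on UNIV rL"
begin

text \<open>The orders on words and on primes are mutually recursive. Bounding the degree breaks the
  circle: a bracket of degree at most \<open>d + 1\<close> contains a word of degree at most
  \<open>d\<close>, and such a word has factors of degree at most \<open>d\<close>. So
  well-foundedness climbs from \<open>prime_rel 0\<close>, which is empty.\<close>

private definition word_rel :: "nat \<Rightarrow> ('l, 'x) bword rel" where
  "word_rel d = {(u, v). u \<in> bwords X \<and> v \<in> bwords X \<and> word_degree u \<le> d \<and>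
     word_degree v \<le> d \<and> db_less rX rL u v}"

private definition prime_rel :: "nat \<Rightarrow> ('l, 'x) bprime rel" where
  "prime_rel d = {(p, q). prime_letters p \<subseteq> X \<and> prime_letters q \<subseteq> X \<and> prime_degree p \<le> d \<and>
     prime_degree q \<le> d \<and> db_prime_less rX rL p q}"

private lemma wf_letters: "wf (rX - Id)" and wf_operators: "wf (rL - Id)"
  using rX rL by (auto simp: well_order_on_def)

private lemma wf_prime_rel_0: "wf (prime_rel 0)"
  by (rule wf_subset[of "{}"]) (auto simp: prime_rel_def)

private lemma wf_prime_rel_Suc:
  assumes "wf (word_rel d)"
  shows "wf (prime_rel (Suc d))"
proof (rule wf_subset)
  show "wf (inv_image (less_than <*lex*> less_than <*lex*> (rX - Id) <*lex*> (rL - Id) <*lex*> word_rel d)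
    prime_key)"
    by (intro wf_inv_image wf_lex_prod wf_less_than wf_letters wf_operators assms)
  show "prime_rel (Suc d) \<subseteq> inv_image (less_than <*lex*> less_than <*lex*> (rX - Id) <*lex*>
    (rL - Id) <*lex*> word_rel d) prime_key"
  proof (clarsimp simp: prime_rel_def)
    fix p q :: "('l, 'x) bprime"
    assume *: "prime_letters p \<subseteq> X" "prime_letters q \<subseteq> X" "prime_degree p \<le> Suc d"
      "prime_degree q \<le> Suc d" and "db_prime_less rX rL p q"
    from this(5) show "(prime_key p, prime_key q) \<in>
      less_than <*lex*> less_than <*lex*> (rX - Id) <*lex*> (rL - Id) <*lex*> word_rel d"
    proof cases
      case (brackets l u v)
      then show ?thesis
        using * by (auto simp: prime_key_def word_rel_def bwords_def)
    qed (auto simp: prime_key_def)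
  qed
qed

text \<open>\<open>lex\<close> relates only lists of equal length, so it inherits well-foundedness
  from the primes; words of different breadth are separated by the component before it.\<close>

private lemma wf_word_rel:
  assumes "wf (prime_rel d)"
  shows "wf (word_rel d)"
proof (rule wf_subset)
  show "wf (inv_image (less_than <*lex*> less_than <*lex*> lex (prime_rel d))
    (\<lambda>w. (word_degree w, breadth w, factors w)))"
    by (intro wf_inv_image wf_lex_prod wf_less_than wf_lex assms)
  show "word_rel d \<subseteq> inv_image (less_than <*lex*> less_than <*lex*> lex (prime_rel d))
    (\<lambda>w. (word_degree w, breadth w, factors w))"
  proof (rule subrelI)
    fix u v :: "('l, 'x) bword"
    assume "(u, v) \<in> word_rel d"
    then have *: "u \<in> bwords X" "v \<in> bwords X" "word_degree u \<le> d" "word_degree v \<le> d"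
      and "db_less rX rL u v"
      by (simp_all add: word_rel_def)
    from this(5) show "(u, v) \<in> inv_image (less_than <*lex*> less_than <*lex*> lex (prime_rel d))
      (\<lambda>w. (word_degree w, breadth w, factors w))"
    proof cases
      case (factors ps p us q vs)
      have "(p, q) \<in> prime_rel d"
        using * factors by (auto simp: prime_rel_def bwords_iff word_degree_factors)
      then show ?thesis
        using factors by (auto simp: lex_conv breadth_def)
    qed auto
  qed
qed

private lemma wf_word_rel_all: "wf (word_rel d)"
proof -
  have "wf (prime_rel d)"
    by (induction d) (auto intro: wf_prime_rel_0 wf_prime_rel_Suc wf_word_rel)
  then show ?thesis by (rule wf_word_rel)
qed

text \<open>Going down never raises the degree, so a minimal element of \<open>Q\<close> can be
  sought among the words of degree at most that of \<open>w\<close>, where \<open>word_rel\<close>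
  is the whole order.\<close>

lemma wf_db_less: "wf {(u, v). u \<in> bwords X \<and> v \<in> bwords X \<and> db_less rX rL u v}"
proof (rule wfI_min)
  fix w :: "('l, 'x) bword" and Q
  assume "w \<in> Q"
  then have "w \<in> {u \<in> Q. word_degree u \<le> word_degree w}" by simp
  then obtain z where z: "z \<in> Q" "word_degree z \<le> word_degree w"
      and min: "\<And>y. (y, z) \<in> word_rel (word_degree w) \<Longrightarrow> y \<notin> {u \<in> Q. word_degree u \<le> word_degree w}"
    using wfE_min[OF wf_word_rel_all] by (metis (no_types, lifting) mem_Collect_eq)
  show "\<exists>z\<in>Q. \<forall>y. (y, z) \<in> {(u, v). u \<in> bwords X \<and> v \<in> bwords X \<and> db_less rX rL u v} \<longrightarrow> y \<notin> Q"
  proof (intro bexI[of _ z] allI impI notI)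
    fix y
    assume *: "(y, z) \<in> {(u, v). u \<in> bwords X \<and> v \<in> bwords X \<and> db_less rX rL u v}" "y \<in> Q"
    then have "word_degree y \<le> word_degree w"
      using z(2) db_less_degree[of rX rL y z] by auto
    then show False
      using min[of y] * z by (auto simp: word_rel_def)
  qed (rule z)
qed

private lemma db_total_lists:
  assumes "\<And>p q. p \<in> set ps \<Longrightarrow> q \<in> set qs \<Longrightarrow> p = q \<or> db_prime_less rX rL p q \<or> db_prime_less rX rL q p"
    and "length ps = length qs"
  shows "ps = qs \<or> (ps, qs) \<in> lex {(p, q). db_prime_less rX rL p q} \<or>
    (qs, ps) \<in> lex {(p, q). db_prime_less rX rL p q}"
  using assms(2,1)
proof (induction ps qs rule: list_induct2)
  case (Cons p ps q qs)
  then have "p = q \<or> db_prime_less rX rL p q \<or> db_prime_less rX rL q p" by simp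
  moreover have "ps = qs \<or> (ps, qs) \<in> lex {(p, q). db_prime_less rX rL p q} \<or>
      (qs, ps) \<in> lex {(p, q). db_prime_less rX rL p q}"
    using Cons by simp
  ultimately show ?case
    using Cons.hyps by auto
qed simp

private lemma db_total_words:
  assumes "\<And>p q. p \<in> set (factors u) \<Longrightarrow> q \<in> set (factors v) \<Longrightarrow>
    p = q \<or> db_prime_less rX rL p q \<or> db_prime_less rX rL q p"
  shows "u = v \<or> db_less rX rL u v \<or> db_less rX rL v u"
proof (cases "word_degree u = word_degree v \<and> breadth u = breadth v")
  case True
  then have "factors u = factors v \<or> (factors u, factors v) \<in> lex {(p, q). db_prime_less rX rL p q} \<or>
    (factors v, factors u) \<in> lex {(p, q). db_prime_less rX rL p q}"
    by (intro db_total_lists assms) (auto simp: breadth_def)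
  then show ?thesis
    using True unfolding db_less_simp[of rX rL u v] db_less_simp[of rX rL v u] bword_eq_iff[of u v]
    by auto
qed (auto simp: db_less_simp)

text \<open>Induction on the degree of \<open>p\<close>: for two brackets with the same operator,
  the factors of the content of \<open>p\<close> are primes of smaller degree, and totality of the
  contents follows factor by factor.\<close>

private lemma db_total_primes:
  fixes p q :: "('l, 'x) bprime"
  assumes "prime_letters p \<subseteq> X" "prime_letters q \<subseteq> X"
  shows "p = q \<or> db_prime_less rX rL p q \<or> db_prime_less rX rL q p"
  using assms
proof (induction "prime_degree p" arbitrary: p q rule: less_induct)
  case less
  show ?case
  proof (cases "prime_degree p = prime_degree q")
    case False
    then show ?thesis by (metis db_less_db_prime_less.prime_degree nat_neq_iff)
  next
    case deg: True
    show ?thesis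
    proof (cases p)
      case p: (Letter x)
      show ?thesis
      proof (cases q)
        case q: (Letter y)
        have "x = y \<or> (x, y) \<in> rX \<or> (y, x) \<in> rX"
          using rX less(2,3) p q
          by (auto simp: well_order_on_def linear_order_on_def total_on_def)
        then show ?thesis
          unfolding p q by (metis db_less_db_prime_less.letters)
      next
        case q: (Bracket m v)
        then show ?thesis
          using deg unfolding p q by (metis db_less_db_prime_less.letter_bracket)
      qed
    next
      case p: (Bracket l u)
      show ?thesis
      proof (cases q)
        case q: (Letter y)
        then show ?thesis
          using deg unfolding p q by (metis db_less_db_prime_less.letter_bracket)
      next
        case q: (Bracket m v)
        show ?thesis
        proof (cases "l = m")
          case True
          have "u = v \<or> db_less rX rL u v \<or> db_less rX rL v u"
          proof (rule db_total_words)
            fix p' q' assume *: "p' \<in> set (factors u)" "q' \<in> set (factors v)"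
            have "prime_letters p' \<subseteq> X" "prime_letters q' \<subseteq> X"
              using less(2,3) * by (auto simp: p q letters_factors)
            moreover have "prime_degree p' < prime_degree p"
              using *(1) member_le_sum_list[of "prime_degree p'" "map prime_degree (factors u)"]
              by (auto simp: p word_degree_factors)
            ultimately show "p' = q' \<or> db_prime_less rX rL p' q' \<or> db_prime_less rX rL q' p'"
              by (intro less(1))
          qed
          then show ?thesis
            using deg unfolding p q True by (metis db_less_db_prime_less.brackets)
        next
          case False
          then have "(l, m) \<in> rL \<or> (m, l) \<in> rL"
            using rL by (auto simp: well_order_on_def linear_order_on_def total_on_def)
          then show ?thesis
            using False deg unfolding p q by (metis db_less_db_prime_less.operators)
        qed
      qed
    qed
  qed
qed

lemma db_less_total:
  assumes "u \<in> bwords X" "v \<in> bwords X"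
  shows "u = v \<or> db_less rX rL u v \<or> db_less rX rL v u"
  by (rule db_total_words) (use assms db_total_primes in \<open>auto simp: bwords_iff\<close>)

lemma db_less_irrefl: "u \<in> bwords X \<Longrightarrow> \<not> db_less rX rL u u"
  using wf_irrefl[OF wf_db_less, of u] by auto

lemma db_less_asym: "u \<in> bwords X \<Longrightarrow> v \<in> bwords X \<Longrightarrow> db_less rX rL u v \<Longrightarrow> \<not> db_less rX rL v u"
  using wf_not_sym[OF wf_db_less, of u v] by auto

text \<open>A well-founded total relation has no cycle of length two or three, so it is transitive.\<close>

lemma db_less_trans:
  assumes "u \<in> bwords X" "v \<in> bwords X" "w \<in> bwords X" "db_less rX rL u v" "db_less rX rL v w"
  shows "db_less rX rL u w"
proof (rule ccontr)
  assume "\<not> db_less rX rL u w"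
  then have "u = w \<or> db_less rX rL w u"
    using assms db_less_total[of u w] by auto
  then show False
  proof
    assume "u = w"
    then show False using assms db_less_asym[of u v] by auto
  next
    assume "db_less rX rL w u"
    moreover obtain z where "z \<in> {u, v, w}"
      "\<And>y. y \<in> bwords X \<and> z \<in> bwords X \<and> db_less rX rL y z \<Longrightarrow> y \<notin> {u, v, w}"
      using wfE_min[OF wf_db_less, of u "{u, v, w}"] by auto
    ultimately show False using assms by auto
  qed
qed

lemma db_order_strict_iff:
  "(u, v) \<in> db_order X rX rL - Id \<longleftrightarrow> u \<in> bwords X \<and> v \<in> bwords X \<and> db_less rX rL u v"
  using db_less_irrefl by (auto simp: db_order_def)

lemma monomial_order_db: "monomial_order X (db_order X rX rL)"
  unfolding monomial_order_def
proof (intro conjI allI impI ballI)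
  have "db_order X rX rL - Id = {(u, v). u \<in> bwords X \<and> v \<in> bwords X \<and> db_less rX rL u v}"
    using db_order_strict_iff by auto
  then have "wf (db_order X rX rL - Id)"
    using wf_db_less by simp
  moreover have "refl_on (bwords X) (db_order X rX rL)"
    by (auto simp: refl_on_def db_order_def)
  moreover have "trans (db_order X rX rL)"
    by (rule transI) (use db_less_trans in \<open>auto simp: db_order_def\<close>)
  moreover have "antisym (db_order X rX rL)"
    by (rule antisymI) (use db_less_asym in \<open>auto simp: db_order_def\<close>)
  moreover have "total_on (bwords X) (db_order X rX rL)"
    using db_less_total by (auto simp: total_on_def db_order_def)
  moreover have "db_order X rX rL \<subseteq> bwords X \<times> bwords X"
    by (auto simp: db_order_def)
  ultimately show "well_order_on (bwords X) (db_order X rX rL)"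
    by (auto simp: well_order_on_def linear_order_on_def partial_order_on_def preorder_on_def)
next
  fix u v :: "('l, 'x) bword" and q :: "('l, 'x option) bword"
  assume "(u, v) \<in> db_order X rX rL - Id" "q \<in> star_bwords X"
  then show "(subst u q, subst v q) \<in> db_order X rX rL - Id"
    using subst_in_contexts[of q X] contexts_closed[OF subst_in_contexts, of q X]
      db_less_contexts[of "\<lambda>u. subst u q" X rX rL u v]
    unfolding db_order_strict_iff by auto
qed

end

section \<open>The product of bracketed words\<close>

abbreviation pw :: "('l, 'x) bprime \<Rightarrow> ('l, 'x) bword" where
  "pw p \<equiv> BWord [p]"

abbreviation br :: "'l \<Rightarrow> (('l, 'x) bword \<Rightarrow>\<^sub>0 'k) \<Rightarrow> (('l, 'x) bword \<Rightarrow>\<^sub>0 'k::comm_ring_1)" where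
  "br l \<equiv> linear_extension (bracket l)"

text \<open>Two neighbouring prime factors can be rewritten iff they are brackets of the same kind
  \<open>R\<close> or \<open>S\<close>.\<close>

fun clash :: "('w + 'w, 'x) bprime \<Rightarrow> ('w + 'w, 'x) bprime \<Rightarrow> bool" where
  "clash (Bracket l a) (Bracket m b) \<longleftrightarrow> isl l = isl m"
| "clash _ _ \<longleftrightarrow> False"

text \<open>A single variable \<open>T\<close> stands for both kinds. The two families of relations
  differ only in their outer labels, while the new inner brackets are always \<open>R\<close> on the
  left and \<open>S\<close> on the right, so one proof serves both.\<close>

lemma clashE:
  assumes "clash p q"
  obtains T \<alpha> \<beta> a b where "T \<in> {Inl, Inr}" "pw p = bracket (T \<alpha>) a" "pw q = bracket (T \<beta>) b"
proof -
  from assms obtain l a m b where pq: "p = Bracket l a" "q = Bracket m b" "isl l = isl m"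
    by (cases p; cases q) auto
  show ?thesis
  proof (cases l)
    case (Inl \<alpha>)
    then obtain \<beta> where "m = Inl \<beta>" using pq by (cases m) auto
    then show ?thesis using that[of Inl \<alpha> a \<beta> b] Inl pq by (simp add: bracket_def)
  next
    case (Inr \<alpha>)
    then obtain \<beta> where "m = Inr \<beta>" using pq by (cases m) auto
    then show ?thesis using that[of Inr \<alpha> a \<beta> b] Inr pq by (simp add: bracket_def)
  qed
qed

lemma bword_nonzero_first: "u \<noteq> 0 \<Longrightarrow> \<exists>p v. u = pw p + v"
proof -
  assume "u \<noteq> 0"
  then have "u = pw (hd (factors u)) + BWord (tl (factors u))"
    by (cases u) (simp add: plus_bword_def zero_bword_def)
  then show ?thesis by blast
qed

lemma pw_neq_0 [simp]: "pw p \<noteq> 0"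
  by (simp add: zero_bword_def)

lemma bword_nonzero_last: "u \<noteq> 0 \<Longrightarrow> \<exists>v p. u = v + pw p"
proof -
  assume "u \<noteq> 0"
  then have "u = BWord (butlast (factors u)) + pw (last (factors u))"
    by (cases u) (simp add: plus_bword_def zero_bword_def)
  then show ?thesis by blast
qed

lemma pw_cases:
  obtains (letter) x where "pw p = letter x" | (bracket) l u where "pw p = bracket l u"
  by (cases p) (auto simp: letter_def bracket_def)

context four_operations
begin

lemma word_degree_bracket_factor: "Bracket l a \<in> set (factors u) \<Longrightarrow> word_degree a < word_degree u"
  using member_le_sum_list[of "prime_degree (Bracket l a)" "map prime_degree (factors u)"]
  by (force simp: word_degree_factors)

text \<open>The termination measure: both recursive calls of the product have total degree
  \<open>word_degree a + word_degree b + 1\<close>, while the two words at the seam still contain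
  both outer brackets.\<close>

lemma word_degree_seam:
  assumes "u \<noteq> 0" "v \<noteq> 0" "Bracket l a = last (factors u)" "Bracket m b = hd (factors v)"
  shows "Suc (word_degree a + word_degree b) < word_degree u + word_degree v"
proof -
  have "word_degree a < word_degree u" "word_degree b < word_degree v"
    using assms by (metis word_degree_bracket_factor last_in_set hd_in_set factors_eq_Nil)+
  then show ?thesis by simp
qed

text \<open>The product in which the relations hold, by resolving the clash at the seam. It is defined
  on all words, not only on irreducible ones: this makes it associative without any side condition.\<close>

function wp :: "('w + 'w, 'x) bword \<Rightarrow> ('w + 'w, 'x) bword \<Rightarrow> (('w + 'w, 'x) bword \<Rightarrow>\<^sub>0 'k::comm_ring_1)"
  where
  "wp u v =
    (if u = 0 then mon v else if v = 0 then mon u else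
     case (last (factors u), hd (factors v)) of
       (Bracket (Inl \<alpha>) a, Bracket (Inl \<beta>) b) \<Rightarrow>
          mon (BWord (butlast (factors u))) *
          (br (Inl (\<alpha> \<^bold>\<rightarrow> \<beta>)) (wp (bracketR (\<alpha> \<^bold>\<rhd> \<beta>) a) b) +
           br (Inl (\<alpha> \<^bold>\<leftarrow> \<beta>)) (wp a (bracketS (\<alpha> \<^bold>\<lhd> \<beta>) b))) *
          mon (BWord (tl (factors v)))
     | (Bracket (Inr \<alpha>) a, Bracket (Inr \<beta>) b) \<Rightarrow>
          mon (BWord (butlast (factors u))) *
          (br (Inr (\<alpha> \<^bold>\<rightarrow> \<beta>)) (wp (bracketR (\<alpha> \<^bold>\<rhd> \<beta>) a) b) +
           br (Inr (\<alpha> \<^bold>\<leftarrow> \<beta>)) (wp a (bracketS (\<alpha> \<^bold>\<lhd> \<beta>) b))) *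
          mon (BWord (tl (factors v)))
     | _ \<Rightarrow> mon (u + v))"
  by pat_completeness auto

termination
  by (relation "measure (\<lambda>(u, v). word_degree u + word_degree v)")
    (auto intro: word_degree_seam)

declare wp.simps [simp del]

lemma wp_0_left [simp]: "wp 0 v = mon v"
  by (subst wp.simps) simp

lemma wp_0_right [simp]: "wp u 0 = mon u"
  by (subst wp.simps) simp

lemma wp_clash:
  assumes "T \<in> {Inl, Inr}"
  shows "wp (a + bracket (T \<alpha>) u) (bracket (T \<beta>) v + b) =
    mon a * (br (T (\<alpha> \<^bold>\<rightarrow> \<beta>)) (wp (bracketR (\<alpha> \<^bold>\<rhd> \<beta>) u) v) +
      br (T (\<alpha> \<^bold>\<leftarrow> \<beta>)) (wp u (bracketS (\<alpha> \<^bold>\<lhd> \<beta>) v))) * mon b"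
  using assms by (subst wp.simps) (auto simp: butlast_append)

lemma wp_noclash:
  assumes "\<not> clash p q"
  shows "wp (a + pw p) (pw q + b) = mon (a + pw p + pw q + b)"
proof -
  show ?thesis
    using assms by (subst wp.simps) (auto split: bprime.splits sum.splits simp: add.assoc)
qed

lemma wp_clash_brackets:
  assumes "T \<in> {Inl, Inr}"
  shows "wp (bracket (T \<alpha>) u) (bracket (T \<beta>) v) =
    br (T (\<alpha> \<^bold>\<rightarrow> \<beta>)) (wp (bracketR (\<alpha> \<^bold>\<rhd> \<beta>) u) v) +
      br (T (\<alpha> \<^bold>\<leftarrow> \<beta>)) (wp u (bracketS (\<alpha> \<^bold>\<lhd> \<beta>) v))"
  using wp_clash[OF assms, of 0 \<alpha> u \<beta> v 0] by simp

lemma wp_noclash_pw: "\<not> clash p q \<Longrightarrow> wp (pw p) (pw q) = mon (pw p + pw q)"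
  using wp_noclash[of p q 0 0] by simp

text \<open>Only the last factor of the left word meets \<open>v\<close>. As \<open>u\<close> is
  nonempty, this factor belongs to \<open>u\<close>, and \<open>a\<close> stays outside.\<close>

lemma wp_left:
  assumes "u \<noteq> 0"
  shows "wp (a + u) v = mon a * wp u v"
proof (cases "v = 0")
  case False
  obtain u' p where u: "u = u' + pw p" using bword_nonzero_last assms by blast
  obtain q v' where v: "v = pw q + v'" using bword_nonzero_first False by blast
  show ?thesis
  proof (cases "clash p q")
    case True
    then obtain T \<alpha> \<beta> c d where T: "T \<in> {Inl, Inr}" "pw p = bracket (T \<alpha>) c" "pw q = bracket (T \<beta>) d"
      by (rule clashE)
    show ?thesis
      unfolding u v T(2,3) add.assoc[symmetric] wp_clash[OF T(1)]
      by (simp flip: mult.assoc add: mult_single)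
  next
    case False
    show ?thesis
      unfolding u v add.assoc[symmetric] wp_noclash[OF False] by (simp add: mult_single add.assoc)
  qed
qed (simp add: mult_single)

lemma wp_right:
  assumes "v \<noteq> 0"
  shows "wp u (v + b) = wp u v * mon b"
proof (cases "u = 0")
  case False
  obtain u' p where u: "u = u' + pw p" using bword_nonzero_last False by blast
  obtain q v' where v: "v = pw q + v'" using bword_nonzero_first assms by blast
  show ?thesis
  proof (cases "clash p q")
    case True
    then obtain T \<alpha> \<beta> c d where T: "T \<in> {Inl, Inr}" "pw p = bracket (T \<alpha>) c" "pw q = bracket (T \<beta>) d"
      by (rule clashE)
    show ?thesis
      unfolding u v T(2,3) add.assoc wp_clash[OF T(1)]
      by (simp add: mult.assoc mult_single)
  next
    case False
    show ?thesis
      unfolding u v add.assoc wp_noclash[OF False] by (simp add: mult_single add.assoc)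
  qed
qed (simp add: mult_single)

lemma keys_mult_left_nonzero: "0 \<notin> keys f \<Longrightarrow> 0 \<notin> keys (g * f)"
  and keys_mult_right_nonzero: "0 \<notin> keys f \<Longrightarrow> 0 \<notin> keys (f * g)"
  for f :: "('l, 'x) bword \<Rightarrow>\<^sub>0 'k::comm_ring_1"
  using keys_mult[of g f] keys_mult[of f g] by (force dest: plus_eq_0_bword[THEN iffD1, OF sym])+

lemma keys_br_nonzero: "0 \<notin> keys (br l f)"
  using keys_linear_extension[of "bracket l" f] by (metis bracket_neq_0 imageE subsetD)

text \<open>Lets \<open>wp_left\<close> and \<open>wp_right\<close> act on every monomial of a
  product: next to an empty word the seam would move into the neighbouring prefix or suffix.\<close>

lemma keys_wp_nonzero:
  assumes "u \<noteq> 0 \<or> v \<noteq> 0"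
  shows "0 \<notin> keys (wp u v)"
proof (cases "u = 0 \<or> v = 0")
  case False
  obtain u' p where u: "u = u' + pw p" using bword_nonzero_last False by blast
  obtain q v' where v: "v = pw q + v'" using bword_nonzero_first False by blast
  show ?thesis
  proof (cases "clash p q")
    case True
    then obtain T \<alpha> \<beta> c d where T: "T \<in> {Inl, Inr}" "pw p = bracket (T \<alpha>) c" "pw q = bracket (T \<beta>) d"
      by (rule clashE)
    show ?thesis
      unfolding u v T(2,3) wp_clash[OF T(1)]
      by (intro keys_mult_left_nonzero keys_mult_right_nonzero notI)
        (drule subsetD[OF keys_add], auto simp: keys_br_nonzero)
  next
    case noclash: False
    show ?thesis
      using False unfolding u v wp_noclash[OF noclash] by auto
  qed
qed (use assms in auto)

section \<open>The bilinear product of polynomials\<close>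

definition dm :: "(('w + 'w, 'x) bword \<Rightarrow>\<^sub>0 'k) \<Rightarrow> (('w + 'w, 'x) bword \<Rightarrow>\<^sub>0 'k)
    \<Rightarrow> (('w + 'w, 'x) bword \<Rightarrow>\<^sub>0 'k::comm_ring_1)" (infixl \<open>\<diamond>\<close> 70) where
  "f \<diamond> g = lin (\<lambda>u. lin (wp u) g) f"

lemma klinear_dm_left: "klinear (\<lambda>f. f \<diamond> g)"
  unfolding dm_def by (rule klinear_lin)

lemma klinear_dm_right:
  fixes f :: "('w + 'w, 'x) bword \<Rightarrow>\<^sub>0 'k::comm_ring_1"
  shows "klinear (\<lambda>g. f \<diamond> g)"
proof -
  have "lin (wp u) (g + h) = lin (wp u) g + lin (wp u) h"
    "lin (wp u) (scale c g) = scale c (lin (wp u) g)" for u and g h :: "('w + 'w, 'x) bword \<Rightarrow>\<^sub>0 'k::comm_ring_1" and c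
    by (rule klinear_add[OF klinear_lin] klinear_scale[OF klinear_lin])+
  then show ?thesis
    unfolding klinear_def dm_def
    by (simp add: lin_def[of "\<lambda>u. _ u + _ u"] lin_def[of "\<lambda>u. scale _ (_ u)"] lin_def[of _ f]
        scale_add_right sum.distrib scale_sum mult.commute)
qed

lemma dm_mon [simp]: "mon u \<diamond> mon v = wp u v"
  by (simp add: dm_def)

lemmas dm_add_left = klinear_add[OF klinear_dm_left]
  and dm_add_right = klinear_add[OF klinear_dm_right]
  and dm_diff_left = klinear_diff[OF klinear_dm_left]
  and dm_diff_right = klinear_diff[OF klinear_dm_right]

lemma dm_one_left [simp]: "1 \<diamond> f = f"
  by (rule klinear_eqI[OF klinear_dm_right klinear_id]) (simp flip: single_one)

lemma dm_one_right [simp]: "f \<diamond> 1 = f"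
  by (rule klinear_eqI[OF klinear_dm_left klinear_id]) (simp flip: single_one)

lemma mult_dm_left:
  assumes "0 \<notin> keys f"
  shows "(mon a * f) \<diamond> g = mon a * (f \<diamond> g)"
proof (rule klinear_eqI[OF klinear_comp[OF klinear_dm_left klinear_mult_left]
      klinear_comp[OF klinear_mult_left klinear_dm_left]])
  fix w
  assume "w \<in> keys f"
  then have w: "w \<noteq> 0" using assms by auto
  show "(mon a * mon w) \<diamond> g = mon a * (mon w \<diamond> g)"
    by (rule klinear_eqI[OF klinear_dm_right klinear_comp[OF klinear_mult_left klinear_dm_right]])
      (simp add: mult_single wp_left[OF w])
qed

lemma mult_dm_right:
  assumes "0 \<notin> keys g"
  shows "f \<diamond> (g * mon b) = (f \<diamond> g) * mon b"
proof (rule klinear_eqI[OF klinear_comp[OF klinear_dm_right klinear_mult_right]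
      klinear_comp[OF klinear_mult_right klinear_dm_right]])
  fix w
  assume "w \<in> keys g"
  then have w: "w \<noteq> 0" using assms by auto
  show "f \<diamond> (mon w * mon b) = (f \<diamond> mon w) * mon b"
    by (rule klinear_eqI[OF klinear_dm_left klinear_comp[OF klinear_mult_right klinear_dm_left]])
      (simp add: mult_single wp_right[OF w])
qed

text \<open>Every monomial on the left ends in the nonempty \<open>v\<close>, so the seam lies in
  \<open>v\<close> whatever the support of \<open>f\<close>.\<close>

lemma mult_dm_plus_left: "v \<noteq> 0 \<Longrightarrow> (f * mon v) \<diamond> g = f * (mon v \<diamond> g)"
proof -
  assume v: "v \<noteq> 0"
  show ?thesis
  proof (rule klinear_eqI[OF klinear_comp[OF klinear_dm_left klinear_mult_right] klinear_mult_right])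
    fix w
    show "(mon w * mon v) \<diamond> g = mon w * (mon v \<diamond> g)"
      by (rule mult_dm_left) (use v in simp)
  qed
qed

lemma mult_dm_plus_right: "v \<noteq> 0 \<Longrightarrow> f \<diamond> (mon v * g) = (f \<diamond> mon v) * g"
proof -
  assume v: "v \<noteq> 0"
  show ?thesis
  proof (rule klinear_eqI[OF klinear_comp[OF klinear_dm_right klinear_mult_left] klinear_mult_left])
    fix w
    show "f \<diamond> (mon v * mon w) = (f \<diamond> mon v) * mon w"
      by (rule mult_dm_right) (use v in simp)
  qed
qed

text \<open>By construction the Rota-Baxter equations hold for this product and the operators
  \<open>br\<close>, whatever the four operations are. What may fail is associativity.\<close>

lemma dm_brackets:
  assumes "T \<in> {Inl, Inr}"
  shows "br (T \<alpha>) f \<diamond> br (T \<beta>) g =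
    br (T (\<alpha> \<^bold>\<rightarrow> \<beta>)) (br (Inl (\<alpha> \<^bold>\<rhd> \<beta>)) f \<diamond> g) + br (T (\<alpha> \<^bold>\<leftarrow> \<beta>)) (f \<diamond> br (Inr (\<alpha> \<^bold>\<lhd> \<beta>)) g)"
proof -
  note kl = klinear_comp klinear_plus klinear_linear_extension klinear_dm_left klinear_dm_right
  have word: "mon (bracket (T \<alpha>) u) \<diamond> br (T \<beta>) g = br (T (\<alpha> \<^bold>\<rightarrow> \<beta>)) (mon (bracketR (\<alpha> \<^bold>\<rhd> \<beta>) u) \<diamond> g)
      + br (T (\<alpha> \<^bold>\<leftarrow> \<beta>)) (mon u \<diamond> br (Inr (\<alpha> \<^bold>\<lhd> \<beta>)) g)" for u
  proof (rule klinear_eqI[where f=g and F="\<lambda>g. mon (bracket (T \<alpha>) u) \<diamond> br (T \<beta>) g"])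
    show "klinear (\<lambda>g. mon (bracket (T \<alpha>) u) \<diamond> br (T \<beta>) g)"
      by (rule klinear_comp[OF klinear_dm_right klinear_linear_extension])
    show "klinear (\<lambda>g. br (T (\<alpha> \<^bold>\<rightarrow> \<beta>)) (mon (bracketR (\<alpha> \<^bold>\<rhd> \<beta>) u) \<diamond> g)
      + br (T (\<alpha> \<^bold>\<leftarrow> \<beta>)) (mon u \<diamond> br (Inr (\<alpha> \<^bold>\<lhd> \<beta>)) g))"
      by (rule klinear_plus[OF klinear_comp[OF klinear_linear_extension klinear_dm_right]
        klinear_comp[OF klinear_linear_extension klinear_comp[OF klinear_dm_right klinear_linear_extension]]])
  qed (simp add: wp_clash_brackets[OF assms])
  show ?thesis
  proof (rule klinear_eqI[where f=f and F="\<lambda>f. br (T \<alpha>) f \<diamond> br (T \<beta>) g"])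
    show "klinear (\<lambda>f. br (T \<alpha>) f \<diamond> br (T \<beta>) g)"
      by (rule klinear_comp[OF klinear_dm_left klinear_linear_extension])
    show "klinear (\<lambda>f. br (T (\<alpha> \<^bold>\<rightarrow> \<beta>)) (br (Inl (\<alpha> \<^bold>\<rhd> \<beta>)) f \<diamond> g)
      + br (T (\<alpha> \<^bold>\<leftarrow> \<beta>)) (f \<diamond> br (Inr (\<alpha> \<^bold>\<lhd> \<beta>)) g))"
      by (rule klinear_plus[OF klinear_comp[OF klinear_linear_extension
        klinear_comp[OF klinear_dm_left klinear_linear_extension]]
        klinear_comp[OF klinear_linear_extension klinear_dm_left]])
  qed (simp add: word)
qed

lemma dm_noclash_left:
  assumes "\<And>b. \<not> clash p (Bracket l b)"
  shows "mon (pw p) \<diamond> br l f = mon (pw p) * br l f"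
proof (rule klinear_eqI[OF klinear_comp[OF klinear_dm_right klinear_linear_extension]
      klinear_comp[OF klinear_mult_left klinear_linear_extension]])
  fix w
  show "mon (pw p) \<diamond> br l (mon w) = mon (pw p) * br l (mon w)"
    using wp_noclash_pw[OF assms, of w] by (simp add: mult_single bracket_def)
qed

lemma dm_noclash_right:
  assumes "\<And>b. \<not> clash (Bracket l b) p"
  shows "br l f \<diamond> mon (pw p) = br l f * mon (pw p)"
proof (rule klinear_eqI[OF klinear_comp[OF klinear_dm_left klinear_linear_extension]
      klinear_comp[OF klinear_mult_right klinear_linear_extension]])
  fix w
  show "br l (mon w) \<diamond> mon (pw p) = br l (mon w) * mon (pw p)"
    using wp_noclash_pw[OF assms, of w] by (simp add: mult_single bracket_def)
qed

text \<open>If \<open>q\<close> and \<open>r\<close> clash, their product is a sum of single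
  brackets of the kind of \<open>q\<close>, and these do not clash with \<open>p\<close> either. So
  on both sides \<open>p\<close> merely stands in front of the product of the other two.\<close>

lemma assoc_noclash_left:
  fixes p q r :: "('w + 'w, 'x) bprime"
  assumes "\<not> clash p q"
  shows "(mon (pw p) \<diamond> mon (pw q)) \<diamond> mon (pw r) =
    (mon (pw p) \<diamond> (mon (pw q) \<diamond> mon (pw r)) :: _ \<Rightarrow>\<^sub>0 'k::comm_ring_1)"
proof -
  have nz: "pw q \<noteq> 0" by simp
  have left: "(mon (pw p) \<diamond> mon (pw q)) \<diamond> mon (pw r) = (mon (pw p) * wp (pw q) (pw r) :: _ \<Rightarrow>\<^sub>0 'k)"
    using mult_dm_plus_left[OF nz, of "mon (pw p)" "mon (pw r)"]
    by (simp add: wp_noclash_pw[OF assms] mult_single)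
  show ?thesis
  proof (cases "clash q r")
    case True
    then obtain T \<beta> \<gamma> b c where T: "T \<in> {Inl, Inr}" "pw q = bracket (T \<beta>) b" "pw r = bracket (T \<gamma>) c"
      by (rule clashE)
    have "\<not> clash p (Bracket (T \<delta>) d)" for \<delta> d
      using assms T by (cases p; cases q) (auto simp: bracket_def)
    then have "mon (pw p) \<diamond> wp (pw q) (pw r) = (mon (pw p) * wp (pw q) (pw r) :: _ \<Rightarrow>\<^sub>0 'k)"
      unfolding T(2,3) wp_clash_brackets[OF T(1)]
      by (simp add: dm_add_right dm_noclash_left distrib_left)
    then show ?thesis
      unfolding left by simp
  next
    case False
    have "mon (pw p) \<diamond> (mon (pw q) * mon (pw r)) = (wp (pw p) (pw q) * mon (pw r) :: _ \<Rightarrow>\<^sub>0 'k)"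
      using mult_dm_plus_right[OF nz, of "mon (pw p)" "mon (pw r)"] by simp
    then show ?thesis
      unfolding left by (simp add: wp_noclash_pw[OF False] wp_noclash_pw[OF assms] mult_single add.assoc)
  qed
qed

text \<open>If \<open>p\<close> and \<open>q\<close> clash, the argument of
  \<open>assoc_noclash_left\<close> is mirrored; otherwise that lemma applies directly.\<close>

lemma assoc_noclash_right:
  fixes p q r :: "('w + 'w, 'x) bprime"
  assumes "\<not> clash q r"
  shows "(mon (pw p) \<diamond> mon (pw q)) \<diamond> mon (pw r) =
    (mon (pw p) \<diamond> (mon (pw q) \<diamond> mon (pw r)) :: _ \<Rightarrow>\<^sub>0 'k::comm_ring_1)"
proof (cases "clash p q")
  case True
  then obtain T \<alpha> \<beta> a b where T: "T \<in> {Inl, Inr}" "pw p = bracket (T \<alpha>) a" "pw q = bracket (T \<beta>) b"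
    by (rule clashE)
  have nz: "pw q \<noteq> 0" by simp
  have right: "mon (pw p) \<diamond> (mon (pw q) \<diamond> mon (pw r)) = (wp (pw p) (pw q) * mon (pw r) :: _ \<Rightarrow>\<^sub>0 'k)"
    using mult_dm_plus_right[OF nz, of "mon (pw p)" "mon (pw r)"]
    by (simp add: wp_noclash_pw[OF assms] mult_single)
  have "\<not> clash (Bracket (T \<delta>) d) r" for \<delta> d
    using assms T by (cases r; cases q) (auto simp: bracket_def)
  then have "wp (pw p) (pw q) \<diamond> mon (pw r) = (wp (pw p) (pw q) * mon (pw r) :: _ \<Rightarrow>\<^sub>0 'k)"
    unfolding T(2,3) wp_clash_brackets[OF T(1)]
    by (simp add: dm_add_left dm_noclash_right distrib_right)
  then show ?thesis
    unfolding right by simp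
qed (rule assoc_noclash_left)

end

type_synonym ('w, 'x, 'k) rb_poly = "('w + 'w, 'x) bword \<Rightarrow>\<^sub>0 'k"

context four_operations
begin

section \<open>Associativity\<close>

text \<open>The two ways of multiplying three brackets of the same kind. The hypotheses are instances of
  associativity in smaller degree; the five summands on each side correspond to each other, and the
  fifteen axioms say exactly that their labels agree.\<close>

lemma triple_left:
  fixes a b c :: "('w + 'w, 'x) bword"
  assumes T: "T \<in> {Inl, Inr}"
    and 1: "(mon (bracketR (\<alpha> \<^bold>\<rhd> \<beta>) a) \<diamond> mon b) \<diamond> mon (bracketS ((\<alpha> \<^bold>\<rightarrow> \<beta>) \<^bold>\<lhd> \<gamma>) c) =
      (mon (bracketR (\<alpha> \<^bold>\<rhd> \<beta>) a) \<diamond> (mon b \<diamond> mon (bracketS ((\<alpha> \<^bold>\<rightarrow> \<beta>) \<^bold>\<lhd> \<gamma>) c)) :: _ \<Rightarrow>\<^sub>0 'k::comm_ring_1)"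
    and 2: "(mon a \<diamond> mon (bracketS (\<alpha> \<^bold>\<lhd> \<beta>) b)) \<diamond> mon (bracketS ((\<alpha> \<^bold>\<leftarrow> \<beta>) \<^bold>\<lhd> \<gamma>) c) =
      (mon a \<diamond> (mon (bracketS (\<alpha> \<^bold>\<lhd> \<beta>) b) \<diamond> mon (bracketS ((\<alpha> \<^bold>\<leftarrow> \<beta>) \<^bold>\<lhd> \<gamma>) c)) :: _ \<Rightarrow>\<^sub>0 'k)"
  shows "(mon (bracket (T \<alpha>) a) \<diamond> mon (bracket (T \<beta>) b)) \<diamond> mon (bracket (T \<gamma>) c) =
    (br (T ((\<alpha> \<^bold>\<rightarrow> \<beta>) \<^bold>\<rightarrow> \<gamma>)) (br (Inl ((\<alpha> \<^bold>\<rightarrow> \<beta>) \<^bold>\<rhd> \<gamma>)) (mon (bracketR (\<alpha> \<^bold>\<rhd> \<beta>) a) \<diamond> mon b) \<diamond> mon c)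
    + br (T ((\<alpha> \<^bold>\<rightarrow> \<beta>) \<^bold>\<leftarrow> \<gamma>)) (mon (bracketR (\<alpha> \<^bold>\<rhd> \<beta>) a) \<diamond> (mon b \<diamond> mon (bracketS ((\<alpha> \<^bold>\<rightarrow> \<beta>) \<^bold>\<lhd> \<gamma>) c)))
    + br (T ((\<alpha> \<^bold>\<leftarrow> \<beta>) \<^bold>\<rightarrow> \<gamma>)) (br (Inl ((\<alpha> \<^bold>\<leftarrow> \<beta>) \<^bold>\<rhd> \<gamma>)) (mon a \<diamond> mon (bracketS (\<alpha> \<^bold>\<lhd> \<beta>) b)) \<diamond> mon c)
    + br (T ((\<alpha> \<^bold>\<leftarrow> \<beta>) \<^bold>\<leftarrow> \<gamma>)) (mon a \<diamond> br (Inr ((\<alpha> \<^bold>\<lhd> \<beta>) \<^bold>\<rightarrow> ((\<alpha> \<^bold>\<leftarrow> \<beta>) \<^bold>\<lhd> \<gamma>)))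
        (mon (bracketR ((\<alpha> \<^bold>\<lhd> \<beta>) \<^bold>\<rhd> ((\<alpha> \<^bold>\<leftarrow> \<beta>) \<^bold>\<lhd> \<gamma>)) b) \<diamond> mon c))
    + br (T ((\<alpha> \<^bold>\<leftarrow> \<beta>) \<^bold>\<leftarrow> \<gamma>)) (mon a \<diamond> br (Inr ((\<alpha> \<^bold>\<lhd> \<beta>) \<^bold>\<leftarrow> ((\<alpha> \<^bold>\<leftarrow> \<beta>) \<^bold>\<lhd> \<gamma>)))
        (mon b \<diamond> mon (bracketS ((\<alpha> \<^bold>\<lhd> \<beta>) \<^bold>\<lhd> ((\<alpha> \<^bold>\<leftarrow> \<beta>) \<^bold>\<lhd> \<gamma>)) c))) :: _ \<Rightarrow>\<^sub>0 'k)"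
proof -
  \<comment> \<open>The monomials are hidden behind names because \<open>br l (mon a)\<close> would
    simplify to one monomial, whereas \<open>dm_brackets\<close> needs the operators to stay
    visible.\<close>
  define fab ga gb gc where "fab = (mon (bracketR (\<alpha> \<^bold>\<rhd> \<beta>) a) \<diamond> mon b :: _ \<Rightarrow>\<^sub>0 'k)"
    and "ga = (mon a :: _ \<Rightarrow>\<^sub>0 'k)" and "gb = (mon b :: _ \<Rightarrow>\<^sub>0 'k)" and "gc = (mon c :: _ \<Rightarrow>\<^sub>0 'k)"
  have mon_br: "mon (bracket l a) = br l ga" "mon (bracket l b) = br l gb" "mon (bracket l c) = br l gc" for l
    by (simp_all add: ga_def gb_def gc_def)
  note dmb = dm_brackets[OF T] dm_brackets[of Inr, simplified]
  show ?thesis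
    using 1 2 unfolding mon_br ga_def[symmetric] gb_def[symmetric] gc_def[symmetric]
    by (simp add: dmb klinear_add[OF klinear_linear_extension] dm_add_left dm_add_right algebra_simps)
qed

lemma triple_right:
  fixes a b c :: "('w + 'w, 'x) bword"
  assumes T: "T \<in> {Inl, Inr}"
    and 1: "(mon (bracketR (\<alpha> \<^bold>\<rhd> (\<beta> \<^bold>\<rightarrow> \<gamma>)) a) \<diamond> mon (bracketR (\<beta> \<^bold>\<rhd> \<gamma>) b)) \<diamond> mon c =
      (mon (bracketR (\<alpha> \<^bold>\<rhd> (\<beta> \<^bold>\<rightarrow> \<gamma>)) a) \<diamond> (mon (bracketR (\<beta> \<^bold>\<rhd> \<gamma>) b) \<diamond> mon c) :: _ \<Rightarrow>\<^sub>0 'k::comm_ring_1)"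
  shows "mon (bracket (T \<alpha>) a) \<diamond> (mon (bracket (T \<beta>) b) \<diamond> mon (bracket (T \<gamma>) c)) =
    (br (T (\<alpha> \<^bold>\<rightarrow> (\<beta> \<^bold>\<rightarrow> \<gamma>))) (br (Inl ((\<alpha> \<^bold>\<rhd> (\<beta> \<^bold>\<rightarrow> \<gamma>)) \<^bold>\<rightarrow> (\<beta> \<^bold>\<rhd> \<gamma>)))
        (mon (bracketR ((\<alpha> \<^bold>\<rhd> (\<beta> \<^bold>\<rightarrow> \<gamma>)) \<^bold>\<rhd> (\<beta> \<^bold>\<rhd> \<gamma>)) a) \<diamond> mon b) \<diamond> mon c)
    + br (T (\<alpha> \<^bold>\<rightarrow> (\<beta> \<^bold>\<leftarrow> \<gamma>))) (mon (bracketR (\<alpha> \<^bold>\<rhd> (\<beta> \<^bold>\<leftarrow> \<gamma>)) a) \<diamond> (mon b \<diamond> mon (bracketS (\<beta> \<^bold>\<lhd> \<gamma>) c)))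
    + br (T (\<alpha> \<^bold>\<rightarrow> (\<beta> \<^bold>\<rightarrow> \<gamma>))) (br (Inl ((\<alpha> \<^bold>\<rhd> (\<beta> \<^bold>\<rightarrow> \<gamma>)) \<^bold>\<leftarrow> (\<beta> \<^bold>\<rhd> \<gamma>)))
        (mon a \<diamond> mon (bracketS ((\<alpha> \<^bold>\<rhd> (\<beta> \<^bold>\<rightarrow> \<gamma>)) \<^bold>\<lhd> (\<beta> \<^bold>\<rhd> \<gamma>)) b)) \<diamond> mon c)
    + br (T (\<alpha> \<^bold>\<leftarrow> (\<beta> \<^bold>\<rightarrow> \<gamma>))) (mon a \<diamond> br (Inr (\<alpha> \<^bold>\<lhd> (\<beta> \<^bold>\<rightarrow> \<gamma>))) (mon (bracketR (\<beta> \<^bold>\<rhd> \<gamma>) b) \<diamond> mon c))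
    + br (T (\<alpha> \<^bold>\<leftarrow> (\<beta> \<^bold>\<leftarrow> \<gamma>))) (mon a \<diamond> br (Inr (\<alpha> \<^bold>\<lhd> (\<beta> \<^bold>\<leftarrow> \<gamma>))) (mon b \<diamond> mon (bracketS (\<beta> \<^bold>\<lhd> \<gamma>) c)))
      :: _ \<Rightarrow>\<^sub>0 'k)"
proof -
  define ga gb gc where "ga = (mon a :: _ \<Rightarrow>\<^sub>0 'k)" and "gb = (mon b :: _ \<Rightarrow>\<^sub>0 'k)" and "gc = (mon c :: _ \<Rightarrow>\<^sub>0 'k)"
  have mon_br: "mon (bracket l a) = br l ga" "mon (bracket l b) = br l gb" "mon (bracket l c) = br l gc" for l
    by (simp_all add: ga_def gb_def gc_def)
  note dmb = dm_brackets[OF T] dm_brackets[of Inl, simplified]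
  show ?thesis
    using 1[symmetric] unfolding mon_br ga_def[symmetric] gb_def[symmetric] gc_def[symmetric]
    by (simp add: dmb klinear_add[OF klinear_linear_extension] dm_add_left dm_add_right algebra_simps)
qed

end

context extended_diassociative_semigroup
begin

text \<open>A word with more than one factor can be shortened or separates the two seams, so only
  three primes matter; among these, only three brackets of one kind involve the axioms.\<close>

lemma dm_assoc_words:
  fixes u v w :: "('a + 'a, 'x) bword"
  shows "(mon u \<diamond> mon v) \<diamond> mon w = (mon u \<diamond> (mon v \<diamond> mon w) :: _ \<Rightarrow>\<^sub>0 'k::comm_ring_1)"
proof (induction "word_degree u + word_degree v + word_degree w" arbitrary: u v w rule: less_induct)
  case less
  show ?case
  proof (cases "u = 0 \<or> v = 0 \<or> w = 0")
    case False
    then obtain p u2 v1 q r w2 where u: "u = pw p + u2" and v: "v = v1 + pw q" and w: "w = pw r + w2"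
      using bword_nonzero_first bword_nonzero_last by metis
    consider "v1 \<noteq> 0" | "u2 \<noteq> 0" | "w2 \<noteq> 0" | "v1 = 0" "u2 = 0" "w2 = 0" by blast
    then show ?thesis
    proof cases
      \<comment> \<open>With at least two factors in the middle word the seams lie in different
        factors and are resolved independently.\<close>
      case 1
      have "(mon u \<diamond> mon v) \<diamond> mon w = (wp u v1 * mon (pw q)) \<diamond> (mon w :: _ \<Rightarrow>\<^sub>0 'k)"
        by (simp add: v wp_right[OF 1])
      also have "\<dots> = wp u v1 * (mon (pw q) \<diamond> mon w)"
        by (rule mult_dm_plus_left) simp
      also have "\<dots> = (mon u \<diamond> mon v1) * wp (pw q) w"
        by simp
      also have "\<dots> = mon u \<diamond> (mon v1 * wp (pw q) w)"
        by (rule mult_dm_plus_right[OF 1, symmetric])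
      finally show ?thesis
        by (simp add: v wp_left)
    next
      case 2
      have "(mon u \<diamond> mon v) \<diamond> mon w = (mon (pw p) * wp u2 v) \<diamond> (mon w :: _ \<Rightarrow>\<^sub>0 'k)"
        by (simp add: u wp_left[OF 2])
      also have "\<dots> = mon (pw p) * ((mon u2 \<diamond> mon v) \<diamond> mon w)"
        using 2 by (simp add: mult_dm_left keys_wp_nonzero)
      also have "\<dots> = mon (pw p) * (mon u2 \<diamond> (mon v \<diamond> mon w))"
        by (subst less) (simp_all add: u, cases p, simp_all)
      also have "\<dots> = (mon (pw p) * mon u2) \<diamond> (mon v \<diamond> mon w)"
        using 2 by (simp add: mult_dm_plus_left)
      finally show ?thesis
        by (simp add: u mult_single)
    next
      case 3
      have "mon u \<diamond> (mon v \<diamond> mon w) = mon u \<diamond> ((mon v \<diamond> mon (pw r)) * mon w2 :: _ \<Rightarrow>\<^sub>0 'k)"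
        by (simp add: w wp_right)
      also have "\<dots> = (mon u \<diamond> (mon v \<diamond> mon (pw r))) * mon w2"
        by (simp add: mult_dm_right keys_wp_nonzero)
      also have "\<dots> = ((mon u \<diamond> mon v) \<diamond> mon (pw r)) * mon w2"
        by (subst less) (use 3 in \<open>simp_all add: w\<close>)
      also have "\<dots> = (mon u \<diamond> mon v) \<diamond> (mon (pw r) * mon w2)"
        by (simp add: mult_dm_plus_right)
      finally show ?thesis
        by (simp add: w mult_single)
    next
      case 4
      then have prime: "u = pw p" "v = pw q" "w = pw r" using u v w by simp_all
      show ?thesis
      proof (cases "clash p q \<and> clash q r")
        case False
        then show ?thesis
          unfolding prime using assoc_noclash_left assoc_noclash_right by blast
      next
        case True
        then obtain T \<alpha> \<beta> a b where T: "T \<in> {Inl, Inr}" "pw p = bracket (T \<alpha>) a" "pw q = bracket (T \<beta>) b"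
          using clashE by metis
        obtain T' \<beta>' \<gamma> b' c where T': "T' \<in> {Inl, Inr}" "pw q = bracket (T' \<beta>') b'" "pw r = bracket (T' \<gamma>) c"
          using True clashE by metis
        then have "T' = T"
          using T by (auto simp: bracket_def)
        then have uvw: "u = bracket (T \<alpha>) a" "v = bracket (T \<beta>) b" "w = bracket (T \<gamma>) c"
          using T T' prime by simp_all
        \<comment> \<open>Three outer brackets are replaced by two inner ones, so each of the three
          instances has total degree one less than that of \<open>u\<close>, \<open>v\<close>,
          \<open>w\<close>.\<close>
        have 1: "(mon (bracketR (\<alpha> \<^bold>\<rhd> \<beta>) a) \<diamond> mon b) \<diamond> mon (bracketS ((\<alpha> \<^bold>\<rightarrow> \<beta>) \<^bold>\<lhd> \<gamma>) c) =
            (mon (bracketR (\<alpha> \<^bold>\<rhd> \<beta>) a) \<diamond> (mon b \<diamond> mon (bracketS ((\<alpha> \<^bold>\<rightarrow> \<beta>) \<^bold>\<lhd> \<gamma>) c)) :: _ \<Rightarrow>\<^sub>0 'k)"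
          by (rule less) (simp add: uvw)
        have 2: "(mon a \<diamond> mon (bracketS (\<alpha> \<^bold>\<lhd> \<beta>) b)) \<diamond> mon (bracketS ((\<alpha> \<^bold>\<leftarrow> \<beta>) \<^bold>\<lhd> \<gamma>) c) =
            (mon a \<diamond> (mon (bracketS (\<alpha> \<^bold>\<lhd> \<beta>) b) \<diamond> mon (bracketS ((\<alpha> \<^bold>\<leftarrow> \<beta>) \<^bold>\<lhd> \<gamma>) c)) :: _ \<Rightarrow>\<^sub>0 'k)"
          by (rule less) (simp add: uvw)
        have 3: "(mon (bracketR (\<alpha> \<^bold>\<rhd> (\<beta> \<^bold>\<rightarrow> \<gamma>)) a) \<diamond> mon (bracketR (\<beta> \<^bold>\<rhd> \<gamma>) b)) \<diamond> mon c =
            (mon (bracketR (\<alpha> \<^bold>\<rhd> (\<beta> \<^bold>\<rightarrow> \<gamma>)) a) \<diamond> (mon (bracketR (\<beta> \<^bold>\<rhd> \<gamma>) b) \<diamond> mon c) :: _ \<Rightarrow>\<^sub>0 'k)"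
          by (rule less) (simp add: uvw)
        show ?thesis
          unfolding uvw triple_left[OF T(1) 1 2] triple_right[OF T(1) 3]
          \<comment> \<open>\<open>eds10\<close> and \<open>eds13\<close> share their left side, so
            both are used backwards to bring the labels to one form; \<open>eds3\<close> is turned
            around because its left side is the simpler one.\<close>
          unfolding eds1 eds2 eds3[symmetric] eds4 eds5 eds6 eds7 eds8 eds9 eds10[of \<alpha> \<beta> \<gamma>, symmetric]
            eds11 eds12 eds13[of \<alpha> \<beta> \<gamma>, symmetric] eds14 eds15 ..
      qed
    qed
  qed auto
qed

lemma dm_assoc: "(f \<diamond> g) \<diamond> h = f \<diamond> (g \<diamond> h)"
proof (rule klinear_eqI[OF klinear_comp[OF klinear_dm_left klinear_dm_left] klinear_dm_left])
  fix u
  show "(mon u \<diamond> g) \<diamond> h = mon u \<diamond> (g \<diamond> h)"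
  proof (rule klinear_eqI[OF klinear_comp[OF klinear_dm_left klinear_dm_right]
        klinear_comp[OF klinear_dm_right klinear_dm_left]])
    fix v
    show "(mon u \<diamond> mon v) \<diamond> h = mon u \<diamond> (mon v \<diamond> h)"
      by (rule klinear_eqI[OF klinear_dm_right klinear_comp[OF klinear_dm_right klinear_dm_right]])
        (rule dm_assoc_words)
  qed
qed

end

section \<open>Normal forms\<close>

context four_operations
begin

definition relT :: "('w \<Rightarrow> 'w + 'w) \<Rightarrow> 'w \<Rightarrow> 'w \<Rightarrow> ('w + 'w, 'x) bword \<Rightarrow> ('w + 'w, 'x) bword
    \<Rightarrow> (('w, 'x, 'k::comm_ring_1) rb_poly)" where
  "relT T \<alpha> \<beta> u v =
     mon (bracket (T \<alpha>) u + bracket (T \<beta>) v)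
     - mon (bracket (T (\<alpha> \<^bold>\<rightarrow> \<beta>)) (bracketR (\<alpha> \<^bold>\<rhd> \<beta>) u + v))
     - mon (bracket (T (\<alpha> \<^bold>\<leftarrow> \<beta>)) (u + bracketS (\<alpha> \<^bold>\<lhd> \<beta>) v))"

lemma rb_relations_eq:
  fixes X :: "'x set"
  shows "(rb_relations X :: (_ \<Rightarrow>\<^sub>0 'k::comm_ring_1) set) = {relT T \<alpha> \<beta> u v | T \<alpha> \<beta> u v. T \<in> {Inl, Inr} \<and> u \<in> bwords X \<and> v \<in> bwords X}"
proof -
  have "relationR = (relT Inl :: _ \<Rightarrow> _ \<Rightarrow> ('w + 'w, 'x) bword \<Rightarrow> _ \<Rightarrow> _ \<Rightarrow>\<^sub>0 'k)"
    "relationS = (relT Inr :: _ \<Rightarrow> _ \<Rightarrow> ('w + 'w, 'x) bword \<Rightarrow> _ \<Rightarrow> _ \<Rightarrow>\<^sub>0 'k)"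
    by (simp_all add: fun_eq_iff relT_def relationR_def relationS_def)
  then show ?thesis
    unfolding rb_relations_def by (auto; blast)
qed

text \<open>The reading of words in the new product, for arbitrary operations. It nests to the
  right, so splitting off the first prime factor is always compatible with the product, whereas
  splitting \<open>nf (u + v)\<close> after a longer \<open>u\<close> takes associativity.\<close>

primrec nf_prime :: "('w + 'w, 'x) bprime \<Rightarrow> (('w, 'x, 'k::comm_ring_1) rb_poly)"
  and nf :: "('w + 'w, 'x) bword \<Rightarrow> (('w, 'x, 'k::comm_ring_1) rb_poly)" where
  "nf_prime (Letter x) = mon (letter x)"
| "nf_prime (Bracket l w) = br l (nf w)"
| "nf (BWord ps) = foldr (\<diamond>) (map nf_prime ps) 1"

lemma nf_factors: "nf w = foldr (\<diamond>) (map nf_prime (factors w)) 1"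
  by (cases w) simp

lemma nf_simps [simp]:
  "nf 0 = 1" "nf (pw p + w) = nf_prime p \<diamond> nf w" "nf (letter x + w) = mon (letter x) \<diamond> nf w"
  "nf (bracket l v + w) = br l (nf v) \<diamond> nf w" "nf (bracket l v) = br l (nf v)" "nf (letter x) = mon (letter x)"
  by (simp_all add: nf_factors)

lemma klinear_nf: "klinear (lin nf)"
  by (rule klinear_lin)

lemma nf_br: "lin nf (br l f) = br l (lin nf f)"
  by (rule klinear_eqI[OF klinear_comp[OF klinear_nf klinear_linear_extension]
        klinear_comp[OF klinear_linear_extension klinear_nf]]) simp

text \<open>If no two neighbouring brackets at any depth are of the same kind, every product taken
  by \<open>nf\<close> meets a seam without a clash and is plain concatenation.\<close>

lemma nf_irreducible:
  fixes w :: "('w + 'w, 'x) bword"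
  assumes "w \<in> bwords X"
    and "\<And>\<phi> T \<alpha> \<beta> u v. \<phi> \<in> contexts X \<Longrightarrow> T \<in> {Inl, Inr} \<Longrightarrow> w \<noteq> \<phi> (bracket (T \<alpha>) u + bracket (T \<beta>) v)"
  shows "nf w = (mon w :: _ \<Rightarrow>\<^sub>0 'k::comm_ring_1)"
  using assms
proof (induction w rule: bword_induct)
  case zero
  then show ?case by simp
next
  case (plus_letter x u)
  have "nf u = (mon u :: _ \<Rightarrow>\<^sub>0 'k)"
  proof (rule plus_letter.IH)
    fix \<phi> :: "('w + 'w, 'x) bword \<Rightarrow> ('w + 'w, 'x) bword" and T :: "'w \<Rightarrow> 'w + 'w" and \<alpha> \<beta> and u' v' :: "('w + 'w, 'x) bword"
    assume "\<phi> \<in> contexts X" "T \<in> {Inl, Inr}"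
    then show "u \<noteq> \<phi> (bracket (T \<alpha>) u' + bracket (T \<beta>) v')"
      using plus_letter.prems(2)[OF contexts.left[of \<phi> X "letter x"], of T \<alpha> u' \<beta> v'] plus_letter.prems(1)
      by auto
  qed (use plus_letter in simp)
  moreover have "wp (letter x) u = (mon (letter x + u) :: _ \<Rightarrow>\<^sub>0 'k)"
  proof (cases "u = 0")
    case False
    then obtain q v where "u = pw q + v" using bword_nonzero_first by blast
    then show ?thesis
      using wp_noclash[of "Letter x" q 0 v] by (simp add: letter_def add.assoc)
  qed simp
  ultimately show ?case by simp
next
  case (plus_bracket l u v)
  have X: "u \<in> bwords X" "v \<in> bwords X"
    using plus_bracket.prems(1) by simp_all
  have u: "nf u = (mon u :: _ \<Rightarrow>\<^sub>0 'k)"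
  proof (rule plus_bracket.IH(1)[OF X(1)])
    fix \<phi> :: "('w + 'w, 'x) bword \<Rightarrow> ('w + 'w, 'x) bword" and T :: "'w \<Rightarrow> 'w + 'w" and \<alpha> \<beta> and u' v' :: "('w + 'w, 'x) bword"
    assume "\<phi> \<in> contexts X" "T \<in> {Inl, Inr}"
    then show "u \<noteq> \<phi> (bracket (T \<alpha>) u' + bracket (T \<beta>) v')"
      using plus_bracket.prems(2)[OF contexts.right[OF contexts.under[of \<phi> X l] X(2)], of T \<alpha> u' \<beta> v']
      by auto
  qed
  have v: "nf v = (mon v :: _ \<Rightarrow>\<^sub>0 'k)"
  proof (rule plus_bracket.IH(2)[OF X(2)])
    fix \<phi> :: "('w + 'w, 'x) bword \<Rightarrow> ('w + 'w, 'x) bword" and T :: "'w \<Rightarrow> 'w + 'w" and \<alpha> \<beta> and u' v' :: "('w + 'w, 'x) bword"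
    assume "\<phi> \<in> contexts X" "T \<in> {Inl, Inr}"
    then show "v \<noteq> \<phi> (bracket (T \<alpha>) u' + bracket (T \<beta>) v')"
      using plus_bracket.prems(2)[OF contexts.left[of \<phi> X "bracket l u"], of T \<alpha> u' \<beta> v'] X
      by auto
  qed
  have "wp (bracket l u) v = (mon (bracket l u + v) :: _ \<Rightarrow>\<^sub>0 'k)"
  proof (cases "v = 0")
    case False
    then obtain q v' where q: "v = pw q + v'" using bword_nonzero_first by blast
    have "\<not> clash (Bracket l u) q"
    proof
      assume "clash (Bracket l u) q"
      then obtain T \<alpha> \<beta> a b where T: "T \<in> {Inl, Inr}" "bracket l u = bracket (T \<alpha>) a" "pw q = bracket (T \<beta>) b"
        using clashE unfolding bracket_def by metis
      have "(\<lambda>u. u + v') \<in> contexts X"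
        using X q by (auto intro!: contexts.right contexts.hole)
      from plus_bracket.prems(2)[OF this T(1), of \<alpha> a \<beta> b] show False
        by (simp add: q T add.assoc)
    qed
    then show ?thesis
      using wp_noclash[of "Bracket l u" q 0 v'] by (simp add: q bracket_def add.assoc)
  qed simp
  then show ?case by (simp add: u v)
qed

text \<open>\<open>dm_brackets\<close> expands the leading term, and its first half is exactly the
  reading of the first lower term, whose content begins with a prime. In the second lower term
  \<open>u\<close> stands in front, and what remains is the failure of \<open>nf\<close> to split
  after \<open>u\<close>.\<close>

lemma nf_relT_defect:
  assumes "T \<in> {Inl, Inr}"
  shows "lin nf (relT T \<alpha> \<beta> u v) =
    br (T (\<alpha> \<^bold>\<leftarrow> \<beta>)) (nf u \<diamond> nf (bracketS (\<alpha> \<^bold>\<lhd> \<beta>) v) - nf (u + bracketS (\<alpha> \<^bold>\<lhd> \<beta>) v))"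
  by (simp add: relT_def klinear_diff[OF klinear_nf] klinear_diff[OF klinear_linear_extension]
      dm_brackets[OF assms])

lemma nf_relT:
  fixes u v :: "('w + 'w, 'x) bword"
  assumes "T \<in> {Inl, Inr}"
    and "nf (u + bracketS (\<alpha> \<^bold>\<lhd> \<beta>) v) = (nf u \<diamond> nf (bracketS (\<alpha> \<^bold>\<lhd> \<beta>) v) :: _ \<Rightarrow>\<^sub>0 'k::comm_ring_1)"
  shows "lin nf (relT T \<alpha> \<beta> u v) = (0 :: _ \<Rightarrow>\<^sub>0 'k)"
  unfolding nf_relT_defect[OF assms(1)] assms(2) by (simp add: klinear_zero[OF klinear_linear_extension])

end

context extended_diassociative_semigroup
begin

text \<open>Splitting after the first prime holds by definition; associativity moves the split to
  the right.\<close>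

lemma nf_plus: "nf (u + v) = nf u \<diamond> nf v"
  by (induction u rule: bword_induct) (simp_all add: add.assoc dm_assoc)

lemma nf_mult: "lin nf (f * g) = lin nf f \<diamond> lin nf g"
proof (rule klinear_eqI[OF klinear_comp[OF klinear_nf klinear_mult_right]
      klinear_comp[OF klinear_dm_left klinear_nf]])
  fix u
  show "lin nf (mon u * g) = lin nf (mon u) \<diamond> lin nf g"
    by (rule klinear_eqI[OF klinear_comp[OF klinear_nf klinear_mult_left]
      klinear_comp[OF klinear_dm_right klinear_nf]]) (simp add: mult_single nf_plus)
qed

end

section \<open>Compositions\<close>

lemma sum_lessThan_add: "(\<Sum>i<n + m. g i) = (\<Sum>i<n. g i) + (\<Sum>i<m. g (n + i))"
  for g :: "nat \<Rightarrow> 'a::comm_monoid_add"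
  by (induction m) (simp_all add: add.assoc)

text \<open>The two families are laid end to end. No terms are merged, so all coefficients stay
  nonzero.\<close>

lemma trivial_modulo_add:
  fixes g h :: "('l, 'x) bword \<Rightarrow>\<^sub>0 'k::comm_ring_1"
  assumes "trivial_modulo X r S w g" "trivial_modulo X r S w h"
  shows "trivial_modulo X r S w (g + h)"
proof -
  from assms(1) obtain n :: nat and c q s where 1: "\<forall>i<n. c i \<noteq> 0 \<and> q i \<in> star_bwords X \<and> s i \<in> S \<and>
      (subst (lead r (s i)) (q i), w) \<in> r - Id" "g = (\<Sum>i<n. scale (c i) (poly_subst (q i) (s i)))"
    unfolding trivial_modulo_def by blast
  from assms(2) obtain m :: nat and c' q' s' where 2: "\<forall>i<m. c' i \<noteq> 0 \<and> q' i \<in> star_bwords X \<and> s' i \<in> S \<and>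
      (subst (lead r (s' i)) (q' i), w) \<in> r - Id" "h = (\<Sum>i<m. scale (c' i) (poly_subst (q' i) (s' i)))"
    unfolding trivial_modulo_def by blast
  show ?thesis
    unfolding trivial_modulo_def
  proof (intro exI conjI)
    show "\<forall>i<n + m. (if i < n then c i else c' (i - n)) \<noteq> 0 \<and>
        (if i < n then q i else q' (i - n)) \<in> star_bwords X \<and> (if i < n then s i else s' (i - n)) \<in> S \<and>
        (subst (lead r (if i < n then s i else s' (i - n))) (if i < n then q i else q' (i - n)), w) \<in> r - Id"
      using 1(1) 2(1) by auto
    show "g + h = (\<Sum>i<n + m. scale (if i < n then c i else c' (i - n))
        (poly_subst (if i < n then q i else q' (i - n)) (if i < n then s i else s' (i - n))))"
      by (simp add: sum_lessThan_add 1(2) 2(2))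
  qed
qed

lemma trivial_modulo_scale:
  assumes "\<phi> \<in> contexts X" "s \<in> S" "(\<phi> (lead r s), w) \<in> r - Id" "c \<noteq> 0"
  shows "trivial_modulo X r S w (scale c (linear_extension \<phi> s))"
proof -
  obtain q where q: "q \<in> star_bwords X" "\<And>u. subst u q = \<phi> u"
    using contexts_subst assms(1) by blast
  show ?thesis
    unfolding trivial_modulo_def poly_subst_def
    by (rule exI[of _ 1], rule exI[of _ "\<lambda>_. c"], rule exI[of _ "\<lambda>_. q"], rule exI[of _ "\<lambda>_. s"])
      (use q assms in auto)
qed

lemma trivial_modulo_context:
  assumes "\<phi> \<in> contexts X" "s \<in> S" "(\<phi> (lead r s), w) \<in> r - Id"
  shows "trivial_modulo X r S w (linear_extension \<phi> s)"
    and "trivial_modulo X r S w (- linear_extension \<phi> s)"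
  using trivial_modulo_scale[OF assms, of 1] trivial_modulo_scale[OF assms, of "-1"]
  by (simp_all add: scale_minus_one)

lemma poly_subst_context:
  assumes "q \<in> star_bwords X"
  obtains \<phi> where "\<phi> \<in> contexts X" "\<And>u. subst u q = \<phi> u" "poly_subst q = linear_extension \<phi>"
  using subst_in_contexts[OF assms] that[of "\<lambda>u. subst u q"] by (auto simp: poly_subst_def fun_eq_iff)

context four_operations
begin

abbreviation lt where "lt T \<alpha> \<beta> u v \<equiv> bracket (T \<alpha>) u + bracket (T \<beta>) v"

abbreviation m1 where "m1 T \<alpha> \<beta> u v \<equiv> bracket (T (\<alpha> \<^bold>\<rightarrow> \<beta>)) (bracketR (\<alpha> \<^bold>\<rhd> \<beta>) u + v)"

abbreviation m2 where "m2 T \<alpha> \<beta> u v \<equiv> bracket (T (\<alpha> \<^bold>\<leftarrow> \<beta>)) (u + bracketS (\<alpha> \<^bold>\<lhd> \<beta>) v)"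

lemma breadth_neqI: "breadth u \<noteq> breadth v \<Longrightarrow> u \<noteq> v"
  by auto

lemma linear_extension_relT:
  "linear_extension \<phi> (relT T \<alpha> \<beta> u v) = single (\<phi> (lt T \<alpha> \<beta> u v)) 1
    - single (\<phi> (m1 T \<alpha> \<beta> u v)) 1 - single (\<phi> (m2 T \<alpha> \<beta> u v)) 1"
  by (simp add: relT_def klinear_diff[OF klinear_linear_extension])

lemma keys_relT: "keys (relT T \<alpha> \<beta> u v) \<subseteq> {lt T \<alpha> \<beta> u v, m1 T \<alpha> \<beta> u v, m2 T \<alpha> \<beta> u v}"
  by (auto simp: relT_def in_keys_iff lookup_minus lookup_single when_def split: if_splits)

lemma lookup_relT: "lookup (relT T \<alpha> \<beta> u v) (lt T \<alpha> \<beta> u v) = 1"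
proof -
  have "m1 T \<alpha> \<beta> u v \<noteq> lt T \<alpha> \<beta> u v" "m2 T \<alpha> \<beta> u v \<noteq> lt T \<alpha> \<beta> u v"
    by (rule breadth_neqI; simp)+
  then show ?thesis
    by (simp add: relT_def lookup_minus lookup_single)
qed

lemma relT_closed:
  "u \<in> bwords X \<Longrightarrow> v \<in> bwords X \<Longrightarrow> keys (relT T \<alpha> \<beta> u v) \<subseteq> bwords X"
  using keys_relT[of T \<alpha> \<beta> u v] by auto

lemma relT_in_relations:
  "T \<in> {Inl, Inr} \<Longrightarrow> u \<in> bwords X \<Longrightarrow> v \<in> bwords X \<Longrightarrow> relT T \<alpha> \<beta> u v \<in> rb_relations X"
  unfolding rb_relations_eq by blast

end

section \<open>Leading words and the shape of compositions\<close>

locale ordered_operations = four_operations larr rarr ltri rtri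
  for larr :: "'w \<Rightarrow> 'w \<Rightarrow> 'w" (infix \<open>\<^bold>\<leftarrow>\<close> 70)
    and rarr :: "'w \<Rightarrow> 'w \<Rightarrow> 'w" (infix \<open>\<^bold>\<rightarrow>\<close> 70)
    and ltri :: "'w \<Rightarrow> 'w \<Rightarrow> 'w" (infix \<open>\<^bold>\<lhd>\<close> 70)
    and rtri :: "'w \<Rightarrow> 'w \<Rightarrow> 'w" (infix \<open>\<^bold>\<rhd>\<close> 70) +
  fixes X :: "'x set" and rX :: "'x rel" and rL :: "('w + 'w) rel"
  assumes rX: "well_order_on X rX" and rL: "well_order_on UNIV rL"
begin

abbreviation db where "db \<equiv> db_order X rX rL"

abbreviation ord (infix \<open>\<prec>\<close> 50) where "u \<prec> v \<equiv> db_less rX rL u v"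

lemma ord_breadth: "word_degree u = word_degree v \<Longrightarrow> breadth u < breadth v \<Longrightarrow> u \<prec> v"
  by (simp add: db_less_simp)

lemma ord_strict_iff: "(u, v) \<in> db - Id \<longleftrightarrow> u \<in> bwords X \<and> v \<in> bwords X \<and> u \<prec> v"
  by (rule db_order_strict_iff[OF rX rL])

text \<open>All three words of a relation have the same degree, and the lower ones have breadth one
  instead of two. So the leading word is the same for every choice of well orders on letters and
  operators.\<close>

lemma m1_less: "m1 T \<alpha> \<beta> u v \<prec> lt T \<alpha> \<beta> u v" and m2_less: "m2 T \<alpha> \<beta> u v \<prec> lt T \<alpha> \<beta> u v"
  by (rule ord_breadth; simp)+

lemma lead_relT:
  assumes "u \<in> bwords X" "v \<in> bwords X"
  shows "lead db (relT T \<alpha> \<beta> u v :: _ \<Rightarrow>\<^sub>0 'k::comm_ring_1) = lt T \<alpha> \<beta> u v"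
  unfolding lead_def
proof (rule the_equality)
  have "lt T \<alpha> \<beta> u v \<in> keys (relT T \<alpha> \<beta> u v :: _ \<Rightarrow>\<^sub>0 'k)"
    by (simp add: in_keys_iff lookup_relT)
  moreover have "\<forall>w\<in>keys (relT T \<alpha> \<beta> u v :: _ \<Rightarrow>\<^sub>0 'k).
      (w, lt T \<alpha> \<beta> u v) \<in> db"
  proof
    fix w
    assume "w \<in> keys (relT T \<alpha> \<beta> u v :: _ \<Rightarrow>\<^sub>0 'k)"
    then have "w = lt T \<alpha> \<beta> u v \<or> w = m1 T \<alpha> \<beta> u v \<or> w = m2 T \<alpha> \<beta> u v"
      using keys_relT[of T \<alpha> \<beta> u v] by blast
    then show "(w, lt T \<alpha> \<beta> u v) \<in> db"
      using assms m1_less m2_less unfolding db_order_iff by (elim disjE) simp_all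
  qed
  ultimately show *: "lt T \<alpha> \<beta> u v \<in> keys (relT T \<alpha> \<beta> u v :: _ \<Rightarrow>\<^sub>0 'k) \<and>
      (\<forall>w\<in>keys (relT T \<alpha> \<beta> u v :: _ \<Rightarrow>\<^sub>0 'k). (w, lt T \<alpha> \<beta> u v) \<in> db)"
    by blast
  fix w
  assume w: "w \<in> keys (relT T \<alpha> \<beta> u v :: _ \<Rightarrow>\<^sub>0 'k) \<and>
      (\<forall>v\<in>keys (relT T \<alpha> \<beta> u v :: _ \<Rightarrow>\<^sub>0 'k). (v, w) \<in> db)"
  then have "(w, lt T \<alpha> \<beta> u v) \<in> db" "(lt T \<alpha> \<beta> u v, w) \<in> db"
    using * by blast+
  then show "w = lt T \<alpha> \<beta> u v"
    using db_less_asym[OF rX rL] by (auto simp: db_order_iff)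
qed

lemma monic_relT:
  assumes "u \<in> bwords X" "v \<in> bwords X"
  shows "monic db (relT T \<alpha> \<beta> u v :: _ \<Rightarrow>\<^sub>0 'k::comm_ring_1)"
proof -
  have "(relT T \<alpha> \<beta> u v :: _ \<Rightarrow>\<^sub>0 'k) \<noteq> 0"
  proof
    assume "(relT T \<alpha> \<beta> u v :: _ \<Rightarrow>\<^sub>0 'k) = 0"
    then have "lookup (relT T \<alpha> \<beta> u v :: _ \<Rightarrow>\<^sub>0 'k) (lt T \<alpha> \<beta> u v) = 0"
      by simp
    then show False by (simp add: lookup_relT)
  qed
  then show ?thesis
    by (simp add: monic_def lead_relT[OF assms] lookup_relT)
qed

lemma trivial_modulo_relT:
  assumes "T \<in> {Inl, Inr}" "u \<in> bwords X" "v \<in> bwords X" "\<phi> \<in> contexts X" "w \<in> bwords X"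
    and "\<phi> (lt T \<alpha> \<beta> u v) \<prec> w"
  shows "trivial_modulo X db (rb_relations X) w (linear_extension \<phi> (relT T \<alpha> \<beta> u v))"
    and "trivial_modulo X db (rb_relations X) w (- linear_extension \<phi> (relT T \<alpha> \<beta> u v))"
proof -
  have *: "(\<phi> (lead db (relT T \<alpha> \<beta> u v :: _ \<Rightarrow>\<^sub>0 'k::comm_ring_1)), w) \<in> db - Id"
    using assms by (simp only: lead_relT ord_strict_iff contexts_closed) simp
  show "trivial_modulo X db (rb_relations X) w (linear_extension \<phi> (relT T \<alpha> \<beta> u v))"
    "trivial_modulo X db (rb_relations X) w (- linear_extension \<phi> (relT T \<alpha> \<beta> u v))"
    by (rule trivial_modulo_context[OF assms(4) relT_in_relations[OF assms(1-3)]],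
        use * in \<open>simp add: lead_relT assms\<close>)+
qed

text \<open>Replacing a leading term inside \<open>[u][v]\<close> by the two lower terms of its relation, and then
  expanding, gives the same as expanding first and then replacing.\<close>

lemma including_context:
  assumes T: "T \<in> {Inl, Inr}" "T' \<in> {Inl, Inr}" and X: "u' \<in> bwords X" "v' \<in> bwords X"
    and U: "\<And>x. x \<in> bwords X \<Longrightarrow> U x \<in> bwords X" and V: "\<And>x. x \<in> bwords X \<Longrightarrow> V x \<in> bwords X"
    and ctx: "(\<lambda>x. lt T \<alpha> \<beta> (U x) (V x)) \<in> contexts X" "(\<lambda>x. m1 T \<alpha> \<beta> (U x) (V x)) \<in> contexts X"
      "(\<lambda>x. m2 T \<alpha> \<beta> (U x) (V x)) \<in> contexts X"
    and u: "u = U (lt T' \<gamma> \<delta> u' v')" and v: "v = V (lt T' \<gamma> \<delta> u' v')"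
  shows "trivial_modulo X db (rb_relations X) (lt T \<alpha> \<beta> u v)
    (relT T \<alpha> \<beta> u v - linear_extension (\<lambda>x. lt T \<alpha> \<beta> (U x) (V x)) (relT T' \<gamma> \<delta> u' v')
      :: _ \<Rightarrow>\<^sub>0 'k::comm_ring_1)"
proof -
  let ?triv = "trivial_modulo X db (rb_relations X) (lt T \<alpha> \<beta> u v) :: (_ \<Rightarrow>\<^sub>0 'k) \<Rightarrow> _"
  let ?g = "relT T' \<gamma> \<delta> u' v' :: _ \<Rightarrow>\<^sub>0 'k"
  let ?l = "lt T' \<gamma> \<delta> u' v'" and ?m1 = "m1 T' \<gamma> \<delta> u' v'" and ?m2 = "m2 T' \<gamma> \<delta> u' v'"
  \<comment> \<open>In use, one of \<open>U\<close> and \<open>V\<close> is a context and the other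
    is constant, so that both positions of the inner relation are covered at once.\<close>
  let ?\<phi> = "\<lambda>x. lt T \<alpha> \<beta> (U x) (V x)"
  let ?A = "\<lambda>x. m1 T \<alpha> \<beta> (U x) (V x)" and ?B = "\<lambda>x. m2 T \<alpha> \<beta> (U x) (V x)"
  have cl: "?l \<in> bwords X" "?m1 \<in> bwords X" "?m2 \<in> bwords X"
    using X by simp_all
  have w: "lt T \<alpha> \<beta> u v \<in> bwords X"
    using U[OF cl(1)] V[OF cl(1)] by (simp add: u v)
  have less: "?\<phi> ?m1 \<prec> lt T \<alpha> \<beta> u v" "?\<phi> ?m2 \<prec> lt T \<alpha> \<beta> u v"
    unfolding u v by (rule db_less_contexts[OF ctx(1)] m1_less m2_less)+
  have lessAB: "?A ?l \<prec> lt T \<alpha> \<beta> u v" "?B ?l \<prec> lt T \<alpha> \<beta> u v"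
    unfolding u v by (rule m1_less m2_less)+
  have AB: "?triv (- linear_extension ?A ?g)" "?triv (- linear_extension ?B ?g)"
    by (rule trivial_modulo_relT(2)[OF T(2) X ctx(2) w lessAB(1)]
        trivial_modulo_relT(2)[OF T(2) X ctx(3) w lessAB(2)])+
  have "?triv (relT T \<alpha> \<beta> (U ?m1) (V ?m1))" "?triv (relT T \<alpha> \<beta> (U ?m2) (V ?m2))"
    using trivial_modulo_relT(1)[OF T(1) U[OF cl(2)] V[OF cl(2)] contexts.hole w less(1)]
      trivial_modulo_relT(1)[OF T(1) U[OF cl(3)] V[OF cl(3)] contexts.hole w less(2)]
    by (simp_all add: linear_extension_id)
  \<comment> \<open>Both orders of rewriting lead to the four words \<open>?A ?m1\<close>,
    \<open>?A ?m2\<close>, \<open>?B ?m1\<close>, \<open>?B ?m2\<close>. These cancel in the sum,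
    and the remaining words form the composition.\<close>
  moreover have "relT T \<alpha> \<beta> u v - linear_extension ?\<phi> ?g = relT T \<alpha> \<beta> (U ?m1) (V ?m1) +
      relT T \<alpha> \<beta> (U ?m2) (V ?m2) + - linear_extension ?A ?g + - linear_extension ?B ?g"
    unfolding linear_extension_relT by (simp add: u v relT_def[of T])
  ultimately show ?thesis
    using AB by (simp only:) (intro trivial_modulo_add)
qed

text \<open>At top level, equal breadth forces an empty context, and since the leading word
  determines the relation, \<open>f\<close> and \<open>g\<close> would coincide. Otherwise the
  smaller leading word lies inside \<open>u\<close> or \<open>v\<close>, and the two rewritings act
  at different depths. This works for any four operations, so the axioms are governed by the
  intersection compositions alone.\<close>

lemma including_trivial:
  fixes f g :: "('w, 'x, 'k::comm_ring_1) rb_poly"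
  assumes "f \<in> rb_relations X" "g \<in> rb_relations X" "f \<noteq> g"
    and "including_composition X db f g w h"
  shows "trivial_modulo X db (rb_relations X) w h"
proof -
  from assms(1) obtain T \<alpha> \<beta> u v where f: "f = relT T \<alpha> \<beta> u v" "T \<in> {Inl, Inr}" "u \<in> bwords X" "v \<in> bwords X"
    unfolding rb_relations_eq by blast
  from assms(2) obtain T' \<gamma> \<delta> u' v' where g: "g = relT T' \<gamma> \<delta> u' v'" "T' \<in> {Inl, Inr}" "u' \<in> bwords X" "v' \<in> bwords X"
    unfolding rb_relations_eq by blast
  have lead: "lead db f = lt T \<alpha> \<beta> u v" "lead db g = lt T' \<gamma> \<delta> u' v'"
    using f g by (simp_all add: lead_relT)
  from assms(4) obtain \<phi> where \<phi>: "\<phi> \<in> contexts X" "w = lt T \<alpha> \<beta> u v" "lt T \<alpha> \<beta> u v = \<phi> (lt T' \<gamma> \<delta> u' v')"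
      "h = f - linear_extension \<phi> g"
    unfolding including_composition_def lead by (metis poly_subst_context)
  from \<phi>(1) show ?thesis
  proof (cases rule: contexts_cases)
    case (top a b)
    then have "breadth (lt T \<alpha> \<beta> u v) = breadth a + breadth (lt T' \<gamma> \<delta> u' v') + breadth b"
      by (simp only: \<phi>(3) top(3) breadth_simps(1))
    then have "a = 0" "b = 0" by simp_all
    then have "lt T \<alpha> \<beta> u v = lt T' \<gamma> \<delta> u' v'"
      unfolding \<phi>(3) top(3) by (simp only: add_0_left add_0_right)
    then have "T \<alpha> = T' \<gamma>" "T \<beta> = T' \<delta>" "u = u'" "v = v'"
      by (simp_all add: bword_eq_iff[of "lt T \<alpha> \<beta> u v"])
    moreover from this have "T = T'" "\<alpha> = \<gamma>" "\<beta> = \<delta>"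
      using f(2) g(2) by auto
    ultimately have "f = g"
      by (simp only: f(1) g(1))
    then show ?thesis using assms(3) by contradiction
  next
    case (nested a l \<psi> b)
    let ?p = "Bracket l (\<psi> (lt T' \<gamma> \<delta> u' v'))"
    have split: "(xs = [] \<and> p = q \<and> ys = [r]) \<or> (xs = [q] \<and> p = r \<and> ys = [])"
      if "xs @ p # ys = [q, r]" for xs ys and p q r :: "('w + 'w, 'x) bprime"
      using that by (cases xs) (auto simp: append_eq_Cons_conv)
    have "lt T \<alpha> \<beta> u v = a + bracket l (\<psi> (lt T' \<gamma> \<delta> u' v')) + b"
      by (simp only: \<phi>(3) nested(4))
    then have "factors a @ ?p # factors b = [Bracket (T \<alpha>) u, Bracket (T \<beta>) v]"
      unfolding bword_eq_iff by simp
    from split[OF this] consider "factors a = factors 0" "?p = Bracket (T \<alpha>) u" "factors b = factors (bracket (T \<beta>) v)"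
      | "factors a = factors (bracket (T \<alpha>) u)" "?p = Bracket (T \<beta>) v" "factors b = factors 0"
      by auto
    then consider "a = 0" "l = T \<alpha>" "u = \<psi> (lt T' \<gamma> \<delta> u' v')" "b = bracket (T \<beta>) v"
      | "a = bracket (T \<alpha>) u" "l = T \<beta>" "v = \<psi> (lt T' \<gamma> \<delta> u' v')" "b = 0"
      unfolding bword_eq_iff[symmetric] by auto
    then show ?thesis
    proof cases
      case 1
      then show ?thesis
        unfolding \<phi>(2,4) nested(4) f(1) g(1) 1(1,2,4) add_0_left
        by (intro including_context[where U=\<psi> and V="\<lambda>_. v", OF f(2) g(2-4)])
          (use nested(3) f(4) 1(3) in \<open>auto simp: contexts_closed intro!: contexts.under contexts.right\<close>)
    next
      case 2
      then show ?thesis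
        unfolding \<phi>(2,4) nested(4) f(1) g(1) 2(1,2,4) add_0_right
        by (intro including_context[where U="\<lambda>_. u" and V=\<psi>, OF f(2) g(2-4)])
          (use nested(3) f(3) 2(3) in \<open>auto simp: contexts_closed intro!: contexts.under contexts.left\<close>)
    qed
  qed
qed

text \<open>Both leading words have breadth two, so the ambiguity has breadth exactly three. The
  relations share the middle bracket, which forces them to be of the same kind and fixes all
  parameters.\<close>

lemma intersection_form:
  fixes f g :: "('w, 'x, 'k::comm_ring_1) rb_poly"
  assumes "f \<in> rb_relations X" "g \<in> rb_relations X"
    and "intersection_composition X db f g w h"
  obtains T \<alpha> \<beta> \<gamma> a b c where "T \<in> {Inl, Inr}" "a \<in> bwords X" "b \<in> bwords X" "c \<in> bwords X"
    "w = bracket (T \<alpha>) a + bracket (T \<beta>) b + bracket (T \<gamma>) c"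
    "h = relT T \<alpha> \<beta> a b * mon (bracket (T \<gamma>) c) - mon (bracket (T \<alpha>) a) * relT T \<beta> \<gamma> b c"
proof -
  from assms(1) obtain T \<alpha> \<beta> a b where f: "f = relT T \<alpha> \<beta> a b" "T \<in> {Inl, Inr}" "a \<in> bwords X" "b \<in> bwords X"
    unfolding rb_relations_eq by blast
  from assms(2) obtain T' \<beta>' \<gamma> b' c where g: "g = relT T' \<beta>' \<gamma> b' c" "T' \<in> {Inl, Inr}" "b' \<in> bwords X" "c \<in> bwords X"
    unfolding rb_relations_eq by blast
  have lead: "lead db f = lt T \<alpha> \<beta> a b" "lead db g = lt T' \<beta>' \<gamma> b' c"
    using f g by (simp_all add: lead_relT)
  from assms(3) obtain u v where uv: "w = lt T \<alpha> \<beta> a b + u" "w = v + lt T' \<beta>' \<gamma> b' c"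
      "h = f * mon u - mon v * g"
      and br: "max (breadth (lt T \<alpha> \<beta> a b)) (breadth (lt T' \<beta>' \<gamma> b' c)) < breadth w"
        "breadth w < breadth (lt T \<alpha> \<beta> a b) + breadth (lt T' \<beta>' \<gamma> b' c)"
    unfolding intersection_composition_def lead by blast
  have "breadth w = 2 + breadth u" "breadth w = breadth v + 2"
    using arg_cong[OF uv(1), of breadth] arg_cong[OF uv(2), of breadth] by simp_all
  moreover have "2 < breadth w" "breadth w < 4"
    using br by simp_all
  ultimately have "breadth u = 1" "breadth v = 1" by linarith+
  then have "length (factors u) = 1" "length (factors v) = 1"
    by (simp_all add: breadth_def)
  then obtain p q where pq: "factors u = [p]" "factors v = [q]"
    by (auto simp: length_Suc_conv)
  have "factors (lt T \<alpha> \<beta> a b + u) = factors (v + lt T' \<beta>' \<gamma> b' c)"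
    using uv by simp
  then have p: "p = Bracket (T' \<gamma>) c" and q: "q = Bracket (T \<alpha>) a" and b: "T \<beta> = T' \<beta>'" "b = b'"
    by (simp_all add: pq)
  have T: "T = T'" "\<beta> = \<beta>'"
    using f(2) g(2) b(1) by auto
  have u: "u = bracket (T \<gamma>) c"
    using pq(1) by (simp only: bword_eq_iff p T factors_bracket)
  have v: "v = bracket (T \<alpha>) a"
    using pq(2) by (simp only: bword_eq_iff q factors_bracket)
  have "g = relT T \<beta> \<gamma> b c"
    by (simp only: g(1) T b)
  then have "h = relT T \<alpha> \<beta> a b * mon (bracket (T \<gamma>) c) - mon (bracket (T \<alpha>) a) * relT T \<beta> \<gamma> b c"
    using uv(3) by (simp only: f(1) u v)
  moreover have "w = bracket (T \<alpha>) a + bracket (T \<beta>) b + bracket (T \<gamma>) c"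
    using uv(1) by (simp only: u)
  ultimately show ?thesis
    by (intro that[OF f(2,3,4) g(4)])
qed

end

locale ordered_eds = ordered_operations larr rarr ltri rtri X rX rL +
  extended_diassociative_semigroup larr rarr ltri rtri
  for larr :: "'w \<Rightarrow> 'w \<Rightarrow> 'w" (infix \<open>\<^bold>\<leftarrow>\<close> 70)
    and rarr :: "'w \<Rightarrow> 'w \<Rightarrow> 'w" (infix \<open>\<^bold>\<rightarrow>\<close> 70)
    and ltri :: "'w \<Rightarrow> 'w \<Rightarrow> 'w" (infix \<open>\<^bold>\<lhd>\<close> 70)
    and rtri :: "'w \<Rightarrow> 'w \<Rightarrow> 'w" (infix \<open>\<^bold>\<rhd>\<close> 70)
    and X :: "'x set" and rX :: "'x rel" and rL :: "('w + 'w) rel"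
begin

text \<open>Each side takes three reductions: \<open>?r1\<close>, \<open>?r2\<close>,
  \<open>?r3\<close> on the left and \<open>?r4\<close>, \<open>?r5\<close>, \<open>?r6\<close> on
  the right, where \<open>?r3\<close> and \<open>?r5\<close> resolve a clash newly created inside a
  bracket. All rewritten words have the degree of the ambiguity and breadth at most two, hence lie
  below it, and the five final words on either side agree by the axioms.\<close>

lemma intersection_trivial:
  assumes T: "T \<in> {Inl, Inr}" and X: "a \<in> bwords X" "b \<in> bwords X" "c \<in> bwords X"
  shows "trivial_modulo X db (rb_relations X)
    (bracket (T \<alpha>) a + bracket (T \<beta>) b + bracket (T \<gamma>) c)
    (relT T \<alpha> \<beta> a b * mon (bracket (T \<gamma>) c) - mon (bracket (T \<alpha>) a) * relT T \<beta> \<gamma> b c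
      :: _ \<Rightarrow>\<^sub>0 'k::comm_ring_1)"
proof -
  let ?w = "bracket (T \<alpha>) a + bracket (T \<beta>) b + bracket (T \<gamma>) c"
  let ?triv = "trivial_modulo X db (rb_relations X) ?w :: (_ \<Rightarrow>\<^sub>0 'k) \<Rightarrow> _"
  have w: "?w \<in> bwords X" using X by simp
  let ?r1 = "linear_extension (\<lambda>x. x) (relT T (\<alpha> \<^bold>\<rightarrow> \<beta>) \<gamma> (bracketR (\<alpha> \<^bold>\<rhd> \<beta>) a + b) c) :: _ \<Rightarrow>\<^sub>0 'k"
  let ?r2 = "linear_extension (\<lambda>x. x) (relT T (\<alpha> \<^bold>\<leftarrow> \<beta>) \<gamma> (a + bracketS (\<alpha> \<^bold>\<lhd> \<beta>) b) c) :: _ \<Rightarrow>\<^sub>0 'k"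
  let ?r3 = "linear_extension (\<lambda>x. bracket (T ((\<alpha> \<^bold>\<leftarrow> \<beta>) \<^bold>\<leftarrow> \<gamma>)) (a + x))
    (relT Inr (\<alpha> \<^bold>\<lhd> \<beta>) ((\<alpha> \<^bold>\<leftarrow> \<beta>) \<^bold>\<lhd> \<gamma>) b c) :: _ \<Rightarrow>\<^sub>0 'k"
  let ?r4 = "linear_extension (\<lambda>x. x) (relT T \<alpha> (\<beta> \<^bold>\<rightarrow> \<gamma>) a (bracketR (\<beta> \<^bold>\<rhd> \<gamma>) b + c)) :: _ \<Rightarrow>\<^sub>0 'k"
  let ?r5 = "linear_extension (\<lambda>x. bracket (T (\<alpha> \<^bold>\<rightarrow> (\<beta> \<^bold>\<rightarrow> \<gamma>))) (x + c))
    (relT Inl (\<alpha> \<^bold>\<rhd> (\<beta> \<^bold>\<rightarrow> \<gamma>)) (\<beta> \<^bold>\<rhd> \<gamma>) a b) :: _ \<Rightarrow>\<^sub>0 'k"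
  let ?r6 = "linear_extension (\<lambda>x. x) (relT T \<alpha> (\<beta> \<^bold>\<leftarrow> \<gamma>) a (b + bracketS (\<beta> \<^bold>\<lhd> \<gamma>) c)) :: _ \<Rightarrow>\<^sub>0 'k"
  have "?triv (- ?r1)" "?triv (- ?r2)"
    by (rule trivial_modulo_relT(2)[OF T _ _ contexts.hole w];
        use X in \<open>auto intro!: ord_breadth\<close>)+
  moreover have "?triv ?r4" "?triv ?r6"
    by (rule trivial_modulo_relT(1)[OF T _ _ contexts.hole w];
        use X in \<open>auto intro!: ord_breadth\<close>)+
  moreover have "?triv (- ?r3)"
    by (rule trivial_modulo_relT(2)[OF _ _ _ contexts.under[OF contexts.left[OF contexts.hole]] w];
        use X in \<open>auto intro!: ord_breadth\<close>)
  moreover have "?triv ?r5"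
    by (rule trivial_modulo_relT(1)[OF _ _ _ contexts.under[OF contexts.right[OF contexts.hole]] w];
        use X in \<open>auto intro!: ord_breadth\<close>)
  moreover have "relT T \<alpha> \<beta> a b * mon (bracket (T \<gamma>) c) - mon (bracket (T \<alpha>) a) * relT T \<beta> \<gamma> b c =
      - ?r1 + - ?r2 + - ?r3 + ?r4 + ?r5 + ?r6"
    unfolding linear_extension_relT
    by (simp add: relT_def mult_single left_diff_distrib right_diff_distrib add.assoc
       eds1[of \<alpha> \<beta> \<gamma>] eds2[of \<alpha> \<beta> \<gamma>] eds3[of \<alpha> \<beta> \<gamma>, symmetric] eds4[of \<alpha> \<beta> \<gamma>] eds5[of \<alpha> \<beta> \<gamma>] eds6[of \<alpha> \<beta> \<gamma>]
       eds7[of \<alpha> \<beta> \<gamma>] eds8[of \<alpha> \<beta> \<gamma>] eds9[of \<alpha> \<beta> \<gamma>] eds10[of \<alpha> \<beta> \<gamma>, symmetric]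
       eds11[of \<alpha> \<beta> \<gamma>] eds12[of \<alpha> \<beta> \<gamma>] eds13[of \<alpha> \<beta> \<gamma>, symmetric] eds14[of \<alpha> \<beta> \<gamma>] eds15[of \<alpha> \<beta> \<gamma>])
  ultimately show ?thesis
    by (simp only:) (intro trivial_modulo_add)
qed

theorem groebner_shirshov_basis_relations:
  "groebner_shirshov_basis X db
    (rb_relations X :: (('w, 'x, 'k::comm_ring_1) rb_poly) set)"
  unfolding groebner_shirshov_basis_def
proof (intro conjI ballI impI allI)
  show "(rb_relations X :: ('w, 'x, 'k) rb_poly set) \<subseteq> carrier (free_algebra X)"
    by (auto simp: rb_relations_eq free_algebra_def intro: relT_closed[THEN subsetD])
  show "monic db s" if "s \<in> (rb_relations X :: ('w, 'x, 'k) rb_poly set)" for s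
    using that monic_relT by (auto simp: rb_relations_eq)
  fix f g h :: "('w, 'x, 'k) rb_poly" and w
  assume fg: "f \<in> rb_relations X" "g \<in> rb_relations X" "f \<noteq> g"
    and comp: "intersection_composition X db f g w h \<or>
      including_composition X db f g w h"
  from comp show "trivial_modulo X db (rb_relations X) w h"
  proof
    assume "intersection_composition X db f g w h"
    then obtain T \<alpha> \<beta> \<gamma> a b c where "T \<in> {Inl, Inr}" "a \<in> bwords X" "b \<in> bwords X" "c \<in> bwords X"
        "w = bracket (T \<alpha>) a + bracket (T \<beta>) b + bracket (T \<gamma>) c"
        "h = relT T \<alpha> \<beta> a b * mon (bracket (T \<gamma>) c) - mon (bracket (T \<alpha>) a) * relT T \<beta> \<gamma> b c"
      by (rule intersection_form[OF fg(1,2)])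
    then show ?thesis by (simp only:) (rule intersection_trivial)
  qed (rule including_trivial[OF fg])
qed

end

section \<open>Necessity of the axioms\<close>

lemma linear_extension_one [simp]: "linear_extension \<phi> 1 = single (\<phi> 0) 1"
  by (simp flip: single_one)

text \<open>Describes the errors that can be tolerated: combinations of the empty word and single
  primes. Under one more bracket they miss \<open>wide\<close>, which asks for breadth at least two
  inside.\<close>

definition narrow :: "(('l, 'x) bword \<Rightarrow>\<^sub>0 'k::comm_ring_1) \<Rightarrow> bool" where
  "narrow f \<longleftrightarrow> (\<forall>w\<in>keys f. breadth w \<le> 1)"

lemma keys_diff_subset: "keys (f - g) \<subseteq> keys f \<union> keys g"
  for f g :: "'a \<Rightarrow>\<^sub>0 'k::comm_ring_1"
  by (auto simp: in_keys_iff lookup_minus)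

lemma narrow_simps [simp]: "narrow 0" "narrow (br l f)"
  using keys_linear_extension[of "bracket l" f] by (auto simp: narrow_def)

lemma narrow_add: "narrow f \<Longrightarrow> narrow g \<Longrightarrow> narrow (f + g)"
  using keys_add[of f g] by (auto simp: narrow_def)

lemma narrow_diff: "narrow f \<Longrightarrow> narrow g \<Longrightarrow> narrow (f - g)"
  using keys_diff_subset[of f g] by (auto simp: narrow_def)

text \<open>Only compositions of two distinct relations are available, so the labels \<open>\<alpha>, \<alpha>, \<alpha>\<close> cannot be
  tested on \<open>[1][1][1]\<close>. In degree four all overlaps are admissible, and this projection discards the
  contributions of the untested words \<open>[1][1][1]\<close>.\<close>

definition wide :: "('l, 'x) bword set" where
  "wide = {bracket l y | l y. breadth y \<ge> 2 \<and> word_degree y = 3}"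

definition prj :: "(('l, 'x) bword \<Rightarrow>\<^sub>0 'k) \<Rightarrow> (('l, 'x) bword \<Rightarrow>\<^sub>0 'k::comm_ring_1)" where
  "prj = lin (\<lambda>w. if w \<in> wide then mon w else 0)"

lemma klinear_prj: "klinear prj"
  unfolding prj_def by (rule klinear_lin)

lemma prj_mon [simp]: "prj (mon w) = (if w \<in> wide then mon w else 0)"
  by (simp add: prj_def)

lemma bracket_eq_iff [simp]: "bracket l u = bracket m v \<longleftrightarrow> l = m \<and> u = v"
  by (simp add: bracket_def)

lemma wide_bracket: "bracket l y \<in> wide \<longleftrightarrow> breadth y \<ge> 2 \<and> word_degree y = 3"
  by (auto simp: wide_def)

lemma prj_eq_0: "keys f \<inter> wide = {} \<Longrightarrow> prj f = 0"
  by (auto simp: prj_def lin_def intro!: sum.neutral)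

lemma prj_br_narrow:
  assumes "narrow f"
  shows "prj (br l f) = 0"
proof (rule prj_eq_0)
  show "keys (br l f) \<inter> wide = {}"
    using keys_linear_extension[of "bracket l" f] assms by (force simp: narrow_def wide_bracket)
qed

section \<open>Reading relations in low degree\<close>

context four_operations
begin

lemma keys_mult_mon: "w \<in> keys (f * mon v) \<Longrightarrow> \<exists>t\<in>keys f. w = t + v"
  and keys_mon_mult: "w \<in> keys (mon v * f) \<Longrightarrow> \<exists>t\<in>keys f. w = v + t"
  using keys_mult[of f "mon v"] keys_mult[of "mon v" f] by auto

text \<open>Resolving \<open>[a][b]\<close> trades two brackets for one outer and one inner bracket,
  so the product is homogeneous. This later isolates the contributions of degree four.\<close>

lemma keys_wp_degree:
  "w \<in> keys (wp u v :: _ \<Rightarrow>\<^sub>0 'k::comm_ring_1) \<Longrightarrow> word_degree w = word_degree u + word_degree v"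
proof (induction "word_degree u + word_degree v" arbitrary: u v w rule: less_induct)
  case less
  show ?case
  proof (cases "u = 0 \<or> v = 0")
    case True
    then show ?thesis using less.prems by (auto split: if_splits)
  next
    case False
    obtain u' p where u: "u = u' + pw p" using bword_nonzero_last False by blast
    obtain q v' where v: "v = pw q + v'" using bword_nonzero_first False by blast
    show ?thesis
    proof (cases "clash p q")
      case True
      then obtain T \<alpha> \<beta> a b where T: "T \<in> {Inl, Inr}" "pw p = bracket (T \<alpha>) a" "pw q = bracket (T \<beta>) b"
        by (rule clashE)
      let ?f = "wp (bracketR (\<alpha> \<^bold>\<rhd> \<beta>) a) b :: _ \<Rightarrow>\<^sub>0 'k" and ?g = "wp a (bracketS (\<alpha> \<^bold>\<lhd> \<beta>) b) :: _ \<Rightarrow>\<^sub>0 'k"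
      have "w \<in> keys (mon u' * (br (T (\<alpha> \<^bold>\<rightarrow> \<beta>)) ?f + br (T (\<alpha> \<^bold>\<leftarrow> \<beta>)) ?g) * mon v')"
        using less.prems unfolding u v T(2,3) wp_clash[OF T(1)] .
      from keys_mult_mon[OF this] obtain t where
          t: "t \<in> keys (mon u' * (br (T (\<alpha> \<^bold>\<rightarrow> \<beta>)) ?f + br (T (\<alpha> \<^bold>\<leftarrow> \<beta>)) ?g))" "w = t + v'" ..
      from keys_mon_mult[OF t(1)] obtain y where
          y: "y \<in> keys (br (T (\<alpha> \<^bold>\<rightarrow> \<beta>)) ?f + br (T (\<alpha> \<^bold>\<leftarrow> \<beta>)) ?g)" "t = u' + y" ..
      then obtain l x where x: "y = bracket l x" "x \<in> keys ?f \<or> x \<in> keys ?g"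
        using subsetD[OF keys_add y(1)] keys_linear_extension[of "bracket (T (\<alpha> \<^bold>\<rightarrow> \<beta>))" ?f]
          keys_linear_extension[of "bracket (T (\<alpha> \<^bold>\<leftarrow> \<beta>))" ?g] by auto
      have "word_degree x = word_degree a + word_degree b + 1"
        using x(2)
      proof
        assume "x \<in> keys ?f"
        then have "word_degree x = word_degree (bracketR (\<alpha> \<^bold>\<rhd> \<beta>) a) + word_degree b"
          by (rule less.hyps[rotated]) (simp add: u v T)
        then show ?thesis by simp
      next
        assume "x \<in> keys ?g"
        then have "word_degree x = word_degree a + word_degree (bracketS (\<alpha> \<^bold>\<lhd> \<beta>) b)"
          by (rule less.hyps[rotated]) (simp add: u v T)
        then show ?thesis by simp
      qed
      then show ?thesis
        by (simp add: t(2) y(2) x(1) u v T(2,3))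
    next
      case noclash: False
      show ?thesis
        using less.prems unfolding u v wp_noclash[OF noclash] by (auto split: if_splits)
    qed
  qed
qed

lemma keys_dm:
  fixes f g :: "('w, 'x, 'k::comm_ring_1) rb_poly"
  assumes "w \<in> keys (f \<diamond> g)"
  obtains u v where "u \<in> keys f" "v \<in> keys g" "w \<in> keys (wp u v :: _ \<Rightarrow>\<^sub>0 'k)"
proof -
  have lin: "\<exists>u\<in>keys h. w \<in> keys (\<phi> u)"
    if "w \<in> keys (lin \<phi> h)" for \<phi> and h :: "('w, 'x, 'k) rb_poly"
  proof -
    have "w \<in> (\<Union>u\<in>keys h. keys (scale (lookup h u) (\<phi> u)))"
      using subsetD[OF keys_sum] that unfolding lin_def .
    then show ?thesis
      using keys_scale by fast
  qed
  from lin[OF assms[unfolded dm_def]] obtain u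
    where u: "u \<in> keys f" "w \<in> keys (lin (wp u) g)" ..
  from lin[OF u(2)] obtain v where "v \<in> keys g" "w \<in> keys (wp u v :: _ \<Rightarrow>\<^sub>0 'k)" ..
  with u show ?thesis using that by blast
qed

lemma keys_nf_degree:
  "w \<in> keys (nf u :: _ \<Rightarrow>\<^sub>0 'k::comm_ring_1) \<Longrightarrow> word_degree w = word_degree u"
proof (induction u arbitrary: w rule: bword_induct)
  case zero
  then show ?case by simp
next
  case (plus_letter x u)
  then show ?case
    by (auto elim!: keys_dm dest!: keys_wp_degree split: if_splits)
next
  case (plus_bracket l u v)
  from plus_bracket.prems obtain x y where "x \<in> keys (br l (nf u :: _ \<Rightarrow>\<^sub>0 'k))"
      "y \<in> keys (nf v :: _ \<Rightarrow>\<^sub>0 'k)" "w \<in> keys (wp x y :: _ \<Rightarrow>\<^sub>0 'k)"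
    by (auto elim: keys_dm)
  moreover from this(3) have "word_degree w = word_degree x + word_degree y"
    by (rule keys_wp_degree)
  ultimately show ?case
    using plus_bracket.IH keys_linear_extension[of "bracket l" "nf u :: _ \<Rightarrow>\<^sub>0 'k"] by auto
qed

lemma prj_nf_degree:
  fixes f :: "('w, 'x, 'k::comm_ring_1) rb_poly"
  assumes "\<And>u. u \<in> keys f \<Longrightarrow> word_degree u \<noteq> 4"
  shows "prj (lin nf f) = 0"
proof -
  have "prj (nf u :: _ \<Rightarrow>\<^sub>0 'k) = 0" if "u \<in> keys f" for u
  proof (rule prj_eq_0)
    show "keys (nf u :: _ \<Rightarrow>\<^sub>0 'k) \<inter> wide = {}"
      using keys_nf_degree[of _ u] assms[OF that] by (fastforce simp: wide_def)
  qed
  then show ?thesis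
    by (simp add: lin_def klinear_sum[OF klinear_prj] klinear_scale[OF klinear_prj])
qed

lemma nf_mult_pw: "lin nf (mon (pw p) * f) = nf_prime p \<diamond> lin nf f"
  by (rule klinear_eqI[OF klinear_comp[OF klinear_nf klinear_mult_left]
        klinear_comp[OF klinear_dm_right klinear_nf]]) (simp add: mult_single)

text \<open>As \<open>nf\<close> nests to the right, left factors can be restored one prime at a
  time by a linear map. This argument has no mirror image while associativity is open, so factors
  after a relation are treated separately.\<close>

lemma nf_mult_eq_0: "lin nf f = 0 \<Longrightarrow> lin nf (mon a * f) = 0"
proof (induction "breadth a" arbitrary: a)
  case 0
  then show ?case by simp
next
  case (Suc n)
  then obtain p b where a: "a = pw p + b"
    using bword_nonzero_first[of a] by fastforce
  have "mon a * f = mon (pw p) * (mon b * f)"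
    by (simp add: a mult_single flip: mult.assoc)
  then show ?case
    using Suc a by (simp add: nf_mult_pw klinear_zero[OF klinear_dm_right])
qed

lemma nf_br_mult: "lin nf (br l f * mon b) = br l (lin nf f) \<diamond> nf b"
  by (rule klinear_eqI[OF klinear_comp[OF klinear_nf klinear_comp[OF klinear_mult_right klinear_linear_extension]]
        klinear_comp[OF klinear_dm_left klinear_comp[OF klinear_linear_extension klinear_nf]]])
    (simp add: mult_single)

text \<open>The part of \<open>nf_plus\<close> that is available without associativity.\<close>

lemma nf_plus_prime: "breadth u \<le> 1 \<Longrightarrow> nf (u + v) = nf u \<diamond> nf v"
proof -
  assume "breadth u \<le> 1"
  then have "u = 0 \<or> (\<exists>p. u = pw p)"
    using bword_nonzero_first[of u] by fastforce
  then show ?thesis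
    using nf_simps(2)[of _ 0] by auto
qed

lemma breadth_le_degree: "breadth u \<le> word_degree u"
  by (induction u rule: bword_induct) auto

lemma degree_le_1_cases:
  assumes "word_degree u \<le> 1"
  obtains "u = 0" | x where "u = letter x" | l where "u = bracket l 0"
proof (cases "u = 0")
  case False
  then obtain p v where u: "u = pw p + v" using bword_nonzero_first by blast
  show ?thesis
    by (cases p rule: pw_cases) (use assms u that in auto)
qed

lemma nf_low: "word_degree u \<le> 1 \<Longrightarrow> nf u = mon u"
  by (erule degree_le_1_cases) auto

text \<open>The associator of the product.\<close>

definition defect :: "('w + 'w, 'x) bword \<Rightarrow> ('w + 'w, 'x) bword \<Rightarrow> ('w + 'w, 'x) bword
    \<Rightarrow> (('w, 'x, 'k::comm_ring_1) rb_poly)" where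
  "defect u v w = (mon u \<diamond> mon v) \<diamond> mon w - mon u \<diamond> (mon v \<diamond> mon w)"

lemma narrow_defect:
  assumes T: "T \<in> {Inl, Inr}"
  shows "narrow (defect (bracket (T \<alpha>) a) (bracket (T \<beta>) b) (bracket (T \<gamma>) c) :: _ \<Rightarrow>\<^sub>0 'k::comm_ring_1)"
proof -
  have br: "mon (bracket l u) = br l (mon u)" for l and u :: "('w + 'w, 'x) bword"
    by simp
  show ?thesis
    unfolding defect_def br dm_brackets[OF T] dm_add_left dm_add_right
    by (intro narrow_diff narrow_add narrow_simps)
qed

lemma narrow_defect_pw: "narrow (defect (pw p) (pw q) (pw r) :: _ \<Rightarrow>\<^sub>0 'k::comm_ring_1)"
proof (cases "clash p q \<and> clash q r")
  case True
  then obtain T \<alpha> \<beta> a b where T: "T \<in> {Inl, Inr}" "pw p = bracket (T \<alpha>) a" "pw q = bracket (T \<beta>) b"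
    using clashE by metis
  obtain T' \<beta>' \<gamma> b' c where T': "T' \<in> {Inl, Inr}" "pw q = bracket (T' \<beta>') b'" "pw r = bracket (T' \<gamma>) c"
    using True clashE by metis
  then have "T' = T"
    using T by auto
  then show ?thesis
    using narrow_defect[OF T(1)] T T' by simp
next
  case False
  then have "defect (pw p) (pw q) (pw r) = (0 :: _ \<Rightarrow>\<^sub>0 'k)"
    unfolding defect_def using assoc_noclash_left assoc_noclash_right by (metis right_minus_eq)
  then show ?thesis by simp
qed

text \<open>The leading word is read as \<open>[u]\<close> times the product of \<open>[v]\<close>
  and \<open>b\<close>, while the lower words, by the Rota-Baxter equation, contribute the product
  of \<open>[u]\<close> and \<open>[v]\<close> times \<open>b\<close>. The degree bounds make
  \<open>u\<close> and \<open>v\<close> their own readings and let \<open>nf\<close> split after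
  \<open>u\<close>.\<close>

lemma nf_relT_mult:
  assumes T: "T \<in> {Inl, Inr}" and "word_degree u \<le> 1" "word_degree v \<le> 1" "nf b = (mon b :: _ \<Rightarrow>\<^sub>0 'k::comm_ring_1)"
  shows "lin nf (relT T \<alpha> \<beta> u v * mon b) = (- defect (bracket (T \<alpha>) u) (bracket (T \<beta>) v) b :: _ \<Rightarrow>\<^sub>0 'k)"
proof -
  have "breadth u \<le> 1"
    using breadth_le_degree[of u] assms(2) by simp
  then have u: "nf (u + w) = nf u \<diamond> nf w" for w
    by (rule nf_plus_prime)
  have br: "mon (bracket l y) = br l (mon y)" for l and y :: "('w + 'w, 'x) bword"
    by simp
  have "lin nf (relT T \<alpha> \<beta> u v * mon b) = (nf (bracket (T \<alpha>) u + (bracket (T \<beta>) v + b))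
      - nf (bracket (T (\<alpha> \<^bold>\<rightarrow> \<beta>)) (bracketR (\<alpha> \<^bold>\<rhd> \<beta>) u + v) + b)
      - nf (bracket (T (\<alpha> \<^bold>\<leftarrow> \<beta>)) (u + bracketS (\<alpha> \<^bold>\<lhd> \<beta>) v) + b) :: _ \<Rightarrow>\<^sub>0 'k)"
    by (simp add: relT_def left_diff_distrib mult_single klinear_diff[OF klinear_nf] add.assoc del: nf_simps)
  also have "\<dots> = br (T \<alpha>) (mon u) \<diamond> (br (T \<beta>) (mon v) \<diamond> mon b)
      - br (T (\<alpha> \<^bold>\<rightarrow> \<beta>)) (br (Inl (\<alpha> \<^bold>\<rhd> \<beta>)) (mon u) \<diamond> mon v) \<diamond> mon b
      - br (T (\<alpha> \<^bold>\<leftarrow> \<beta>)) (mon u \<diamond> br (Inr (\<alpha> \<^bold>\<lhd> \<beta>)) (mon v)) \<diamond> mon b"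
    using assms by (simp only: nf_simps u nf_low)
  also have "\<dots> = - defect (bracket (T \<alpha>) u) (bracket (T \<beta>) v) b"
    unfolding defect_def br dm_brackets[OF T] by (simp only: dm_add_left) simp
  finally show ?thesis .
qed

lemma defect_eq_0:
  assumes T: "T \<in> {Inl, Inr}" and "breadth b = 1" and no: "\<And>\<gamma> c. b \<noteq> bracket (T \<gamma>) c"
  shows "defect (bracket (T \<alpha>) u) (bracket (T \<beta>) v) b = 0"
proof -
  from assms(2) obtain r where b: "b = pw r"
    using bword_nonzero_first[of b] by fastforce
  have noclash: "\<not> clash (Bracket (T \<beta>) v) r"
  proof
    assume "clash (Bracket (T \<beta>) v) r"
    then obtain T' \<beta>' \<gamma> b' c where T': "T' \<in> {Inl, Inr}" "bracket (T \<beta>) v = bracket (T' \<beta>') b'" "pw r = bracket (T' \<gamma>) c"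
      using clashE unfolding bracket_def by metis
    then have "T' = T" using T by auto
    then show False using no T' b by blast
  qed
  then show ?thesis
    unfolding defect_def b bracket_def by (simp only: assoc_noclash_right[OF noclash] diff_self)
qed

lemma linear_extension_top: "linear_extension (\<lambda>x. a + x + b) f = mon a * (f * mon b)"
  by (simp add: linear_extension_plus_left linear_extension_plus_right linear_extension_id mult.assoc)

lemma linear_extension_nested:
  "linear_extension (\<lambda>x. a + bracket l (\<psi> x) + b) f = mon a * (br l (linear_extension \<psi> f) * mon b)"
  by (simp add: linear_extension_plus_left linear_extension_plus_right linear_extension_comp mult.assoc)

lemma nf_relT_low:
  "T \<in> {Inl, Inr} \<Longrightarrow> breadth u \<le> 1 \<Longrightarrow> lin nf (relT T \<alpha> \<beta> u v) = 0"
  by (rule nf_relT) (simp_all add: nf_plus_prime del: nf_simps)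

lemma nf_context_degree_2:
  assumes T: "T \<in> {Inl, Inr}" and \<phi>: "\<phi> \<in> contexts X" and deg: "word_degree (\<phi> (lt T \<alpha> \<beta> u v)) \<le> 2"
  shows "lin nf (linear_extension \<phi> (relT T \<alpha> \<beta> u v)) = (0 :: _ \<Rightarrow>\<^sub>0 'k::comm_ring_1)"
  using \<phi>
proof (cases rule: contexts_cases)
  case (top a b)
  then have "a = 0" "b = 0" "u = 0"
    using deg by simp_all
  then show ?thesis
    using T by (simp add: top(3) linear_extension_id nf_relT_low)
next
  case (nested a l \<psi> b)
  have "word_degree (\<psi> (lt T \<alpha> \<beta> u v)) \<ge> 2"
    using nested(3) by induction auto
  then show ?thesis
    using deg by (simp add: nested(4))
qed

lemma nf_nested_eq_0:
  assumes T: "T \<in> {Inl, Inr}" and \<psi>: "\<psi> \<in> contexts X" and "word_degree (\<psi> (lt T \<alpha> \<beta> u v)) \<le> 2"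
  shows "lin nf (mon a * (br l (linear_extension \<psi> (relT T \<alpha> \<beta> u v)) * mon b)) = (0 :: _ \<Rightarrow>\<^sub>0 'k::comm_ring_1)"
  by (rule nf_mult_eq_0)
    (simp add: nf_br_mult nf_context_degree_2[OF assms] klinear_zero[OF klinear_linear_extension]
      klinear_zero[OF klinear_dm_left])

text \<open>Here relations read as zero except in front of a factor of degree one. There an
  associator such as that of \<open>[1][1][1]\<close> may survive, but it is a combination of single
  brackets.\<close>

lemma nf_context_degree_3:
  assumes T: "T \<in> {Inl, Inr}" and \<phi>: "\<phi> \<in> contexts X" and deg: "word_degree (\<phi> (lt T \<alpha> \<beta> u v)) = 3"
  shows "narrow (lin nf (linear_extension \<phi> (relT T \<alpha> \<beta> u v)) :: _ \<Rightarrow>\<^sub>0 'k::comm_ring_1)"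
  using \<phi>
proof (cases rule: contexts_cases)
  case (top a b)
  then have sum: "word_degree a + word_degree u + word_degree v + word_degree b = 1"
    using deg by simp
  then have u: "breadth u \<le> 1"
    using breadth_le_degree[of u] by simp
  show ?thesis
  proof (cases "b = 0")
    case True
    have "lin nf (mon a * relT T \<alpha> \<beta> u v) = (0 :: _ \<Rightarrow>\<^sub>0 'k)"
      by (rule nf_mult_eq_0) (rule nf_relT_low[OF T u])
    then show ?thesis
      unfolding top(3) linear_extension_top True by simp
  next
    case False
    then have "word_degree b > 0" by simp
    then have "word_degree a = 0" "word_degree u = 0" "word_degree v = 0" "word_degree b = 1"
      using sum by linarith+
    then have 1: "a = 0" "u = 0" "v = 0" "word_degree b = 1"
      by simp_all
    then have "breadth b = 1"
      using breadth_le_degree[of b] False by (simp add: le_eq_less_or_eq)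
    have *: "lin nf (relT T \<alpha> \<beta> u v * mon b) = (- defect (bracket (T \<alpha>) u) (bracket (T \<beta>) v) b :: _ \<Rightarrow>\<^sub>0 'k)"
      by (rule nf_relT_mult[OF T]) (use 1 in \<open>simp_all add: nf_low\<close>)
    have "narrow (- defect (bracket (T \<alpha>) u) (bracket (T \<beta>) v) b :: _ \<Rightarrow>\<^sub>0 'k)"
    proof (cases "\<exists>\<gamma> c. b = bracket (T \<gamma>) c")
      case True
      then show ?thesis
        using narrow_diff[OF narrow_simps(1) narrow_defect[OF T]] by auto
    next
      case False
      then show ?thesis
        by (simp add: defect_eq_0[OF T \<open>breadth b = 1\<close>])
    qed
    then show ?thesis
      unfolding top(3) linear_extension_top 1(1) * [symmetric] by simp
  qed
next
  case (nested a l \<psi> b)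
  then have "word_degree (\<psi> (lt T \<alpha> \<beta> u v)) \<le> 2"
    using deg by simp
  then show ?thesis
    by (simp add: nested(4) linear_extension_nested nf_nested_eq_0[OF T nested(3)])
qed

text \<open>A relation inside a bracket that has a neighbouring factor reads as zero, and one inside
  a bracket that is the whole word gives a narrow error under that bracket. At the top it reads as
  zero, or as an error under a bracket, unless one factor follows. In that case the value is an
  associator, either zero or one covered by the hypothesis.\<close>

lemma prj_context:
  assumes T: "T \<in> {Inl, Inr}" and \<phi>: "\<phi> \<in> contexts X" and deg: "word_degree (\<phi> (lt T \<alpha> \<beta> u v)) = 4"
    and breadth: "breadth (\<phi> (lt T \<alpha> \<beta> u v)) \<le> 3"
    and defect: "\<And>\<gamma> c. \<phi> (lt T \<alpha> \<beta> u v) = bracket (T \<alpha>) u + bracket (T \<beta>) v + bracket (T \<gamma>) c \<Longrightarrow>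
      prj (defect (bracket (T \<alpha>) u) (bracket (T \<beta>) v) (bracket (T \<gamma>) c) :: _ \<Rightarrow>\<^sub>0 'k::comm_ring_1) = 0"
  shows "prj (lin nf (linear_extension \<phi> (relT T \<alpha> \<beta> u v)) :: _ \<Rightarrow>\<^sub>0 'k) = 0"
  using \<phi>
proof (cases rule: contexts_cases)
  case (top a b)
  then have sum: "word_degree a + word_degree u + word_degree v + word_degree b = 2"
    and breadths: "breadth a + breadth b \<le> 1"
    using deg breadth by simp_all
  consider "a \<noteq> 0" "b = 0" | "a = 0" "b = 0" | "a = 0" "breadth b = 1"
  proof -
    have "breadth b = 0 \<or> breadth a = 0 \<and> breadth b = 1"
      using breadths by linarith
    then show ?thesis
      using that unfolding breadth_eq_0 by blast
  qed
  then show ?thesis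
  proof cases
    case 1
    then have "word_degree a > 0" by simp
    then have "breadth u \<le> 1"
      using breadth_le_degree[of u] sum by linarith
    then have "lin nf (mon a * relT T \<alpha> \<beta> u v) = (0 :: _ \<Rightarrow>\<^sub>0 'k)"
      by (intro nf_mult_eq_0 nf_relT_low[OF T])
    then show ?thesis
      unfolding top(3) linear_extension_top 1(2) by (simp add: klinear_zero[OF klinear_prj])
  next
    case 2
    show ?thesis
    proof (cases "breadth u \<le> 1")
      case True
      then show ?thesis
        by (simp add: top(3) 2 linear_extension_id nf_relT_low[OF T] klinear_zero[OF klinear_prj])
    next
      \<comment> \<open>The degree leaves only two factors of degree one in \<open>u\<close> and an
        empty \<open>v\<close>. The leftover of \<open>nf_relT_defect\<close> is then a bracket
        around an associator of three primes, which \<open>prj\<close> discards.\<close>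
      case False
      then obtain p u1 where u1: "u = pw p + u1" "u1 \<noteq> 0"
        using bword_nonzero_first[of u] by fastforce
      then obtain q u2 where u2: "u1 = pw q + u2"
        using bword_nonzero_first by blast
      have "word_degree (pw p) > 0" "word_degree (pw q) > 0"
        unfolding word_degree_pos by simp_all
      then have "word_degree (pw p) \<le> 1" "word_degree (pw q) \<le> 1" "word_degree u2 = 0" "word_degree v = 0"
        using sum unfolding u1(1) u2 word_degree_simps(1) by linarith+
      then have pq: "nf (pw p) = (mon (pw p) :: _ \<Rightarrow>\<^sub>0 'k)" "nf (pw q) = (mon (pw q) :: _ \<Rightarrow>\<^sub>0 'k)"
        and u: "u = pw p + pw q" and v: "v = 0"
        by (simp_all only: nf_low u1(1) u2 word_degree_eq_0 add_0_right)
      let ?s = "bracketS (\<alpha> \<^bold>\<lhd> \<beta>) v"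
      have "nf u \<diamond> nf ?s - nf (u + ?s) = (defect (pw p) (pw q) ?s :: _ \<Rightarrow>\<^sub>0 'k)"
        using pq by (simp add: defect_def u v add.assoc)
      then have "narrow (nf u \<diamond> nf ?s - nf (u + ?s) :: _ \<Rightarrow>\<^sub>0 'k)"
        unfolding bracket_def using narrow_defect_pw by metis
      then show ?thesis
        by (simp only: top(3) 2 add_0_left add_0_right linear_extension_id nf_relT_defect[OF T] prj_br_narrow)
    qed
  next
    case 3
    then have "word_degree b > 0" by (auto simp: breadth_def)
    then have low: "word_degree u \<le> 1" "word_degree v \<le> 1"
      using sum by linarith+
    have b: "nf b = (mon b :: _ \<Rightarrow>\<^sub>0 'k)"
    proof -
      obtain r where r: "b = pw r"
        using 3 bword_nonzero_first[of b] by fastforce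
      show ?thesis
        by (cases r rule: pw_cases) (use sum r in \<open>auto simp: nf_low\<close>)
    qed
    have *: "prj (lin nf (linear_extension \<phi> (relT T \<alpha> \<beta> u v))) =
        (prj (- defect (bracket (T \<alpha>) u) (bracket (T \<beta>) v) b) :: _ \<Rightarrow>\<^sub>0 'k)"
      unfolding top(3) linear_extension_top 3(1) by (simp add: nf_relT_mult[OF T low b])
    show ?thesis
    proof (cases "\<exists>\<gamma> c. b = bracket (T \<gamma>) c")
      case True
      then obtain \<gamma> c where b: "b = bracket (T \<gamma>) c" by blast
      have "prj (defect (bracket (T \<alpha>) u) (bracket (T \<beta>) v) b :: _ \<Rightarrow>\<^sub>0 'k) = 0"
        unfolding b by (rule defect) (simp add: top(3) 3(1) b)
      then show ?thesis
        by (simp add: * klinear_minus[OF klinear_prj])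
    next
      case False
      then show ?thesis
        by (simp add: * defect_eq_0[OF T 3(2)] klinear_zero[OF klinear_prj])
    qed
  qed
next
  case (nested a l \<psi> b)
  show ?thesis
  proof (cases "a = 0 \<and> b = 0")
    case True
    then have deg3: "word_degree (\<psi> (lt T \<alpha> \<beta> u v)) = 3"
      using deg by (simp add: nested(4))
    have "linear_extension \<phi> (relT T \<alpha> \<beta> u v) = (br l (linear_extension \<psi> (relT T \<alpha> \<beta> u v)) :: _ \<Rightarrow>\<^sub>0 'k)"
      unfolding nested(4) linear_extension_nested using True by simp
    then show ?thesis
      by (simp only: nf_br prj_br_narrow[OF nf_context_degree_3[OF T nested(3) deg3]])
  next
    case False
    then have "word_degree a \<noteq> 0 \<or> word_degree b \<noteq> 0" by simp
    moreover have "word_degree a + word_degree (\<psi> (lt T \<alpha> \<beta> u v)) + word_degree b = 3"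
      using deg unfolding nested(4) by simp
    ultimately have "word_degree (\<psi> (lt T \<alpha> \<beta> u v)) \<le> 2" by linarith
    then show ?thesis
      by (simp add: nested(4) linear_extension_nested nf_nested_eq_0[OF T nested(3)] klinear_zero[OF klinear_prj])
  qed
qed

end

section \<open>From trivial compositions to the axioms\<close>

context ordered_operations
begin

text \<open>Each summand has its leading word below \<open>w\<close>. If that word has degree less
  than four, its reading keeps the degree and misses \<open>wide\<close>; if it has degree four, its
  breadth is at most three, and \<open>prj_context\<close> leaves only associators of overlaps below
  \<open>w\<close>.\<close>

lemma prj_trivial_modulo:
  fixes h :: "('w, 'x, 'k::comm_ring_1) rb_poly"
  assumes triv: "trivial_modulo X db (rb_relations X) w h"
    and w: "word_degree w = 4" "breadth w = 3"
    and defect: "\<And>T \<alpha> \<beta> \<gamma> a b c. T \<in> {Inl, Inr} \<Longrightarrow> a \<in> bwords X \<Longrightarrow> b \<in> bwords X \<Longrightarrow> c \<in> bwords X \<Longrightarrow>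
      word_degree a + word_degree b + word_degree c = 1 \<Longrightarrow>
      bracket (T \<alpha>) a + bracket (T \<beta>) b + bracket (T \<gamma>) c \<prec> w \<Longrightarrow>
      prj (defect (bracket (T \<alpha>) a) (bracket (T \<beta>) b) (bracket (T \<gamma>) c) :: _ \<Rightarrow>\<^sub>0 'k) = 0"
  shows "prj (lin nf h) = 0"
proof -
  have term_eq_0: "prj (lin nf (poly_subst q s)) = 0"
    if "q \<in> star_bwords X" "s \<in> rb_relations X" "(subst (lead db s) q, w) \<in> db - Id"
    for q and s :: "('w, 'x, 'k) rb_poly"
  proof -
    from that(2) obtain T \<alpha> \<beta> u v where s: "s = relT T \<alpha> \<beta> u v" "T \<in> {Inl, Inr}" "u \<in> bwords X" "v \<in> bwords X"
      unfolding rb_relations_eq by blast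
    from that(1) obtain \<phi> where \<phi>: "\<phi> \<in> contexts X" "\<And>u. subst u q = \<phi> u" "(poly_subst q :: (_ \<Rightarrow>\<^sub>0 'k) \<Rightarrow> _) = linear_extension \<phi>"
      by (metis poly_subst_context)
    have less: "\<phi> (lt T \<alpha> \<beta> u v) \<in> bwords X" "\<phi> (lt T \<alpha> \<beta> u v) \<prec> w"
      using that(3) unfolding s(1) lead_relT[OF s(3,4)] \<phi>(2) ord_strict_iff by simp_all
    have deg: "word_degree (\<phi> (lt T \<alpha> \<beta> u v)) \<le> 4"
      using db_less_degree[OF less(2)] w by simp
    show ?thesis
    proof (cases "word_degree (\<phi> (lt T \<alpha> \<beta> u v)) = 4")
      case True
      show ?thesis
        unfolding \<phi>(3) s(1)
      proof (rule prj_context[OF s(2) \<phi>(1) True])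
        show "breadth (\<phi> (lt T \<alpha> \<beta> u v)) \<le> 3"
          using less(2) True w by (auto simp: db_less_simp)
        fix \<gamma> c
        assume eq: "\<phi> (lt T \<alpha> \<beta> u v) = bracket (T \<alpha>) u + bracket (T \<beta>) v + bracket (T \<gamma>) c"
        show "prj (defect (bracket (T \<alpha>) u) (bracket (T \<beta>) v) (bracket (T \<gamma>) c) :: _ \<Rightarrow>\<^sub>0 'k) = 0"
          using True less s(2-4) unfolding eq by (intro defect) simp_all
      qed
    next
      case False
      have same: "word_degree (\<psi> (m1 T \<alpha> \<beta> u v)) = word_degree (\<psi> (lt T \<alpha> \<beta> u v))"
        "word_degree (\<psi> (m2 T \<alpha> \<beta> u v)) = word_degree (\<psi> (lt T \<alpha> \<beta> u v))" if "\<psi> \<in> contexts X" for \<psi>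
        using that by (induction rule: contexts.induct) simp_all
      show ?thesis
        unfolding \<phi>(3) s(1)
      proof (rule prj_nf_degree)
        fix y
        assume "y \<in> keys (linear_extension \<phi> (relT T \<alpha> \<beta> u v) :: _ \<Rightarrow>\<^sub>0 'k)"
        then have "y \<in> \<phi> ` {lt T \<alpha> \<beta> u v, m1 T \<alpha> \<beta> u v, m2 T \<alpha> \<beta> u v}"
          using subsetD[OF keys_linear_extension] keys_relT by fast
        then show "word_degree y \<noteq> 4"
          using False same[OF \<phi>(1)] by auto
      qed
    qed
  qed
  from triv obtain n :: nat and c q s where *: "\<And>i. i < n \<Longrightarrow> q i \<in> star_bwords X \<and> s i \<in> rb_relations X \<and>
      (subst (lead db (s i)) (q i), w) \<in> db - Id"
      "h = (\<Sum>i<n. scale (c i) (poly_subst (q i) (s i)))"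
    unfolding trivial_modulo_def by blast
  have "prj (lin nf h) = (\<Sum>i<n. scale (c i) (prj (lin nf (poly_subst (q i) (s i)))))"
    unfolding *(2) by (simp add: klinear_sum[OF klinear_nf] klinear_scale[OF klinear_nf]
      klinear_sum[OF klinear_prj] klinear_scale[OF klinear_prj])
  also have "\<dots> = 0"
    using *(1) term_eq_0 by (intro sum.neutral) simp
  finally show ?thesis .
qed

text \<open>Well-founded induction on the overlap word: its composition reads as minus the
  associator, and triviality expresses it through relations whose contributions vanish by the
  induction hypothesis.\<close>

lemma prj_defect:
  assumes gsb: "groebner_shirshov_basis X db
      (rb_relations X :: (('w, 'x, 'k::comm_ring_1) rb_poly) set)"
    and "T \<in> {Inl, Inr}" "a \<in> bwords X" "b \<in> bwords X" "c \<in> bwords X"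
      "word_degree a + word_degree b + word_degree c = 1"
  shows "prj (defect (bracket (T \<alpha>) a) (bracket (T \<beta>) b) (bracket (T \<gamma>) c) :: _ \<Rightarrow>\<^sub>0 'k) = 0"
proof -
  have "T \<in> {Inl, Inr} \<Longrightarrow> a \<in> bwords X \<Longrightarrow> b \<in> bwords X \<Longrightarrow> c \<in> bwords X \<Longrightarrow>
      word_degree a + word_degree b + word_degree c = 1 \<Longrightarrow>
      w = bracket (T \<alpha>) a + bracket (T \<beta>) b + bracket (T \<gamma>) c \<Longrightarrow>
      prj (defect (bracket (T \<alpha>) a) (bracket (T \<beta>) b) (bracket (T \<gamma>) c) :: _ \<Rightarrow>\<^sub>0 'k) = 0" for w T \<alpha> \<beta> \<gamma> a b c
  proof (induction w arbitrary: T \<alpha> \<beta> \<gamma> a b c rule: wf_induct_rule[OF wf_db_less[OF rX rL]])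
    case (1 w)
    note T = 1(2) and X = 1(3-5) and deg = 1(6) and w = 1(7)
    let ?f = "relT T \<alpha> \<beta> a b :: _ \<Rightarrow>\<^sub>0 'k" and ?g = "relT T \<beta> \<gamma> b c :: _ \<Rightarrow>\<^sub>0 'k"
    let ?h = "?f * mon (bracket (T \<gamma>) c) - mon (bracket (T \<alpha>) a) * ?g"
    have lead: "lead db ?f = lt T \<alpha> \<beta> a b" "lead db ?g = lt T \<beta> \<gamma> b c"
      using X by (simp_all add: lead_relT)
    \<comment> \<open>Equality would force \<open>a = b = c\<close>, making the total degree a
      multiple of three instead of 1. This is where the extra degree of the test words pays
      off.\<close>
    have "?f \<noteq> ?g"
    proof
      assume "?f = ?g"
      then have "lt T \<alpha> \<beta> a b = lt T \<beta> \<gamma> b c"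
        using lead by simp
      then have "a = b" "b = c"
        unfolding bword_eq_iff[of "lt T \<alpha> \<beta> a b"] by simp_all
      then show False
        using deg by presburger
    qed
    moreover have "intersection_composition X db ?f ?g w ?h"
      unfolding intersection_composition_def lead
      by (rule bexI[of _ "bracket (T \<gamma>) c"], rule bexI[of _ "bracket (T \<alpha>) a"])
        (use X in \<open>simp_all add: w add.assoc\<close>)
    ultimately have "trivial_modulo X db (rb_relations X) w ?h"
      using gsb T X relT_in_relations unfolding groebner_shirshov_basis_def by blast
    then have "prj (lin nf ?h) = 0"
    proof (rule prj_trivial_modulo)
      show "word_degree w = 4" "breadth w = 3"
        using deg by (simp_all add: w)
      fix T' \<alpha>' \<beta>' \<gamma>' a' b' c'
      assume "T' \<in> {Inl, Inr}" "a' \<in> bwords X" "b' \<in> bwords X" "c' \<in> bwords X"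
        "word_degree a' + word_degree b' + word_degree c' = 1"
        "bracket (T' \<alpha>') a' + bracket (T' \<beta>') b' + bracket (T' \<gamma>') c' \<prec> w"
      then show "prj (defect (bracket (T' \<alpha>') a') (bracket (T' \<beta>') b') (bracket (T' \<gamma>') c') :: _ \<Rightarrow>\<^sub>0 'k) = 0"
        using X by (intro 1(1)) (simp_all add: w)
    qed
    moreover have "lin nf ?h = (- defect (bracket (T \<alpha>) a) (bracket (T \<beta>) b) (bracket (T \<gamma>) c) :: _ \<Rightarrow>\<^sub>0 'k)"
    proof -
      have low: "word_degree a \<le> 1" "word_degree b \<le> 1" "word_degree c \<le> 1"
        using deg by linarith+
      \<comment> \<open>The second relation has its extra factor on the left, where it is harmless;
        only the first one, followed by a factor, yields the associator.\<close>
      have "lin nf (mon (bracket (T \<alpha>) a) * ?g) = (0 :: _ \<Rightarrow>\<^sub>0 'k)"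
        using low breadth_le_degree[of b] T by (intro nf_mult_eq_0 nf_relT_low) simp_all
      then show ?thesis
        using nf_relT_mult[OF T low(1,2), of "bracket (T \<gamma>) c" \<alpha> \<beta>] low(3)
        by (simp add: klinear_diff[OF klinear_nf] nf_low)
    qed
    ultimately show ?case
      by (simp add: klinear_minus[OF klinear_prj])
  qed
  then show ?thesis using assms(2-) by blast
qed

text \<open>The conditions exclude every coincidence of \<open>a1\<close>, \<open>b1\<close>,
  \<open>c1\<close> with another word except the partner. So each comparison is between the
  coefficient 1 and a coefficient 0 or 1, and positive characteristic cannot hide a
  difference.\<close>

lemma mon_sum_eqD:
  assumes "mon a1 + mon b1 + mon c1 = (mon a2 + mon b2 + mon c2 :: _ \<Rightarrow>\<^sub>0 'k::comm_ring_1)"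
    and "a1 \<notin> {b1, c1, b2, c2}" "b1 \<notin> {c1, a2, c2}" "c1 \<notin> {a2, b2}"
  shows "a1 = a2 \<and> b1 = b2 \<and> c1 = c2"
proof -
  have "lookup (mon a1 + mon b1 + mon c1 :: _ \<Rightarrow>\<^sub>0 'k) w =
      lookup (mon a2 + mon b2 + mon c2 :: _ \<Rightarrow>\<^sub>0 'k) w" for w
    using assms(1) by simp
  from this[of a1] this[of b1] this[of c1] show ?thesis
    using assms(2-) by (auto simp: lookup_add lookup_single when_def split: if_splits)
qed

text \<open>Two overlaps of three \<open>R\<close>-brackets suffice, with one marker bracket placed
  inside the third or inside the first. In each case three of the five summands have breadth two
  inside and survive \<open>prj\<close>; their labels yield the axioms 1 to 9 and 10 to 15
  respectively.\<close>

theorem eds_necessary: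
  assumes gsb: "groebner_shirshov_basis X db
      (rb_relations X :: (('w, 'x, 'k::comm_ring_1) rb_poly) set)"
  shows "extended_diassociative_semigroup (\<^bold>\<leftarrow>) (\<^bold>\<rightarrow>) (\<^bold>\<lhd>) (\<^bold>\<rhd>)"
proof -
  \<comment> \<open>These instances, together with the ones without a clash below, are the
    hypotheses of \<open>triple_left\<close> and \<open>triple_right\<close>; they hold before any
    axiom is known.\<close>
  have unit1: "(mon x \<diamond> mon 0) \<diamond> mon y = (mon x \<diamond> (mon 0 \<diamond> mon y) :: _ \<Rightarrow>\<^sub>0 'k)"
    and unit2: "(mon 0 \<diamond> mon x) \<diamond> mon y = (mon 0 \<diamond> (mon x \<diamond> mon y) :: _ \<Rightarrow>\<^sub>0 'k)"
    and unit3: "(mon x \<diamond> mon y) \<diamond> mon 0 = (mon x \<diamond> (mon y \<diamond> mon 0) :: _ \<Rightarrow>\<^sub>0 'k)"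
    for x y :: "('w + 'w, 'x) bword"
    by simp_all
  have 1: "(\<alpha> \<^bold>\<rightarrow> \<beta>) \<^bold>\<rightarrow> \<gamma> = \<alpha> \<^bold>\<rightarrow> (\<beta> \<^bold>\<rightarrow> \<gamma>) \<and> (\<alpha> \<^bold>\<rightarrow> \<beta>) \<^bold>\<rhd> \<gamma> = (\<alpha> \<^bold>\<rhd> (\<beta> \<^bold>\<rightarrow> \<gamma>)) \<^bold>\<rightarrow> (\<beta> \<^bold>\<rhd> \<gamma>) \<and>
      \<alpha> \<^bold>\<rhd> \<beta> = (\<alpha> \<^bold>\<rhd> (\<beta> \<^bold>\<rightarrow> \<gamma>)) \<^bold>\<rhd> (\<beta> \<^bold>\<rhd> \<gamma>) \<and> (\<alpha> \<^bold>\<rightarrow> \<beta>) \<^bold>\<leftarrow> \<gamma> = \<alpha> \<^bold>\<rightarrow> (\<beta> \<^bold>\<leftarrow> \<gamma>) \<and>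
      \<alpha> \<^bold>\<rhd> (\<beta> \<^bold>\<leftarrow> \<gamma>) = \<alpha> \<^bold>\<rhd> \<beta> \<and> (\<alpha> \<^bold>\<rightarrow> \<beta>) \<^bold>\<lhd> \<gamma> = \<beta> \<^bold>\<lhd> \<gamma> \<and> (\<alpha> \<^bold>\<leftarrow> \<beta>) \<^bold>\<rightarrow> \<gamma> = \<alpha> \<^bold>\<rightarrow> (\<beta> \<^bold>\<rightarrow> \<gamma>) \<and>
      (\<alpha> \<^bold>\<rhd> (\<beta> \<^bold>\<rightarrow> \<gamma>)) \<^bold>\<leftarrow> (\<beta> \<^bold>\<rhd> \<gamma>) = (\<alpha> \<^bold>\<leftarrow> \<beta>) \<^bold>\<rhd> \<gamma> \<and>
      (\<alpha> \<^bold>\<rhd> (\<beta> \<^bold>\<rightarrow> \<gamma>)) \<^bold>\<lhd> (\<beta> \<^bold>\<rhd> \<gamma>) = \<alpha> \<^bold>\<lhd> \<beta>" for \<alpha> \<beta> \<gamma>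
  proof -
    \<comment> \<open>The label only names some element of the index set. As an
      \<open>S\<close>-bracket on the right the marker does not clash with the
      \<open>R\<close>-brackets that come to stand before it, so three contents keep breadth two; in
      the other two summands everything sits in one inner bracket.\<close>
    let ?z = "bracketS \<alpha> 0 :: ('w + 'w, 'x) bword"
    have noclash: "wp (bracketR \<delta> u) ?z = (mon (bracketR \<delta> u + ?z) :: _ \<Rightarrow>\<^sub>0 'k)" for \<delta> u
      using wp_noclash_pw[of "Bracket (Inl \<delta>) u" "Bracket (Inr \<alpha>) 0"] by (simp add: bracket_def)
    have noclash': "wp (bracketR \<delta> u) (bracketS \<epsilon> v) = (mon (bracketR \<delta> u + bracketS \<epsilon> v) :: _ \<Rightarrow>\<^sub>0 'k)"
      for \<delta> \<epsilon> and u v :: "('w + 'w, 'x) bword"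
      using wp_noclash_pw[of "Bracket (Inl \<delta>) u" "Bracket (Inr \<epsilon>) v"] by (simp add: bracket_def)
    have right: "(mon (bracketR \<delta> 0) \<diamond> mon (bracketR \<epsilon> 0)) \<diamond> mon ?z =
        (mon (bracketR \<delta> 0) \<diamond> (mon (bracketR \<epsilon> 0) \<diamond> mon ?z) :: _ \<Rightarrow>\<^sub>0 'k)" for \<delta> \<epsilon>
      unfolding bracket_def by (rule assoc_noclash_right) simp
    have "prj (defect (bracketR \<alpha> 0) (bracketR \<beta> 0) (bracketR \<gamma> ?z) :: _ \<Rightarrow>\<^sub>0 'k) = 0"
      by (rule prj_defect[OF gsb]) simp_all
    then have "prj ((mon (bracketR \<alpha> 0) \<diamond> mon (bracketR \<beta> 0)) \<diamond> mon (bracketR \<gamma> ?z)) =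
        (prj (mon (bracketR \<alpha> 0) \<diamond> (mon (bracketR \<beta> 0) \<diamond> mon (bracketR \<gamma> ?z))) :: _ \<Rightarrow>\<^sub>0 'k)"
      unfolding defect_def klinear_diff[OF klinear_prj] by simp
    then have "mon (bracketR ((\<alpha> \<^bold>\<rightarrow> \<beta>) \<^bold>\<rightarrow> \<gamma>) (bracketR ((\<alpha> \<^bold>\<rightarrow> \<beta>) \<^bold>\<rhd> \<gamma>) (bracketR (\<alpha> \<^bold>\<rhd> \<beta>) 0) + ?z))
        + mon (bracketR ((\<alpha> \<^bold>\<rightarrow> \<beta>) \<^bold>\<leftarrow> \<gamma>) (bracketR (\<alpha> \<^bold>\<rhd> \<beta>) 0 + bracketS ((\<alpha> \<^bold>\<rightarrow> \<beta>) \<^bold>\<lhd> \<gamma>) ?z))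
        + mon (bracketR ((\<alpha> \<^bold>\<leftarrow> \<beta>) \<^bold>\<rightarrow> \<gamma>) (bracketR ((\<alpha> \<^bold>\<leftarrow> \<beta>) \<^bold>\<rhd> \<gamma>) (bracketS (\<alpha> \<^bold>\<lhd> \<beta>) 0) + ?z))
      = (mon (bracketR (\<alpha> \<^bold>\<rightarrow> (\<beta> \<^bold>\<rightarrow> \<gamma>)) (bracketR ((\<alpha> \<^bold>\<rhd> (\<beta> \<^bold>\<rightarrow> \<gamma>)) \<^bold>\<rightarrow> (\<beta> \<^bold>\<rhd> \<gamma>))
          (bracketR ((\<alpha> \<^bold>\<rhd> (\<beta> \<^bold>\<rightarrow> \<gamma>)) \<^bold>\<rhd> (\<beta> \<^bold>\<rhd> \<gamma>)) 0) + ?z))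
        + mon (bracketR (\<alpha> \<^bold>\<rightarrow> (\<beta> \<^bold>\<leftarrow> \<gamma>)) (bracketR (\<alpha> \<^bold>\<rhd> (\<beta> \<^bold>\<leftarrow> \<gamma>)) 0 + bracketS (\<beta> \<^bold>\<lhd> \<gamma>) ?z))
        + mon (bracketR (\<alpha> \<^bold>\<rightarrow> (\<beta> \<^bold>\<rightarrow> \<gamma>)) (bracketR ((\<alpha> \<^bold>\<rhd> (\<beta> \<^bold>\<rightarrow> \<gamma>)) \<^bold>\<leftarrow> (\<beta> \<^bold>\<rhd> \<gamma>))
          (bracketS ((\<alpha> \<^bold>\<rhd> (\<beta> \<^bold>\<rightarrow> \<gamma>)) \<^bold>\<lhd> (\<beta> \<^bold>\<rhd> \<gamma>)) 0) + ?z)) :: _ \<Rightarrow>\<^sub>0 'k)"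
      unfolding triple_left[where T=Inl, OF insertI1 unit1 unit2] triple_right[where T=Inl, OF insertI1 right]
      by (simp add: klinear_add[OF klinear_prj] noclash noclash' wide_bracket)
    then show ?thesis
      by (rule mon_sum_eqD[elim_format]) (auto simp: bword_eq_iff)
  qed
  have 2: "(\<alpha> \<^bold>\<leftarrow> \<beta>) \<^bold>\<leftarrow> \<gamma> = \<alpha> \<^bold>\<leftarrow> (\<beta> \<^bold>\<rightarrow> \<gamma>) \<and>
      (\<alpha> \<^bold>\<lhd> \<beta>) \<^bold>\<rightarrow> ((\<alpha> \<^bold>\<leftarrow> \<beta>) \<^bold>\<lhd> \<gamma>) = \<alpha> \<^bold>\<lhd> (\<beta> \<^bold>\<rightarrow> \<gamma>) \<and>
      (\<alpha> \<^bold>\<lhd> \<beta>) \<^bold>\<rhd> ((\<alpha> \<^bold>\<leftarrow> \<beta>) \<^bold>\<lhd> \<gamma>) = \<beta> \<^bold>\<rhd> \<gamma> \<and> (\<alpha> \<^bold>\<leftarrow> \<beta>) \<^bold>\<leftarrow> \<gamma> = \<alpha> \<^bold>\<leftarrow> (\<beta> \<^bold>\<leftarrow> \<gamma>) \<and>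
      (\<alpha> \<^bold>\<lhd> \<beta>) \<^bold>\<leftarrow> ((\<alpha> \<^bold>\<leftarrow> \<beta>) \<^bold>\<lhd> \<gamma>) = \<alpha> \<^bold>\<lhd> (\<beta> \<^bold>\<leftarrow> \<gamma>) \<and>
      (\<alpha> \<^bold>\<lhd> \<beta>) \<^bold>\<lhd> ((\<alpha> \<^bold>\<leftarrow> \<beta>) \<^bold>\<lhd> \<gamma>) = \<beta> \<^bold>\<lhd> \<gamma>" for \<alpha> \<beta> \<gamma>
  proof -
    \<comment> \<open>On the left the marker is an \<open>R\<close>-bracket, since the factor after
      it in the surviving terms is an \<open>S\<close>-bracket.\<close>
    let ?z = "bracketR \<alpha> 0 :: ('w + 'w, 'x) bword"
    have noclash: "wp (bracketR \<delta> u) (bracketS \<epsilon> v) = (mon (bracketR \<delta> u + bracketS \<epsilon> v) :: _ \<Rightarrow>\<^sub>0 'k)"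
      for \<delta> \<epsilon> and u v :: "('w + 'w, 'x) bword"
      using wp_noclash_pw[of "Bracket (Inl \<delta>) u" "Bracket (Inr \<epsilon>) v"] by (simp add: bracket_def)
    have left: "(mon ?z \<diamond> mon (bracketS \<delta> 0)) \<diamond> mon (bracketS \<epsilon> 0) =
        (mon ?z \<diamond> (mon (bracketS \<delta> 0) \<diamond> mon (bracketS \<epsilon> 0)) :: _ \<Rightarrow>\<^sub>0 'k)" for \<delta> \<epsilon>
      unfolding bracket_def by (rule assoc_noclash_left) simp
    have "prj (defect (bracketR \<alpha> ?z) (bracketR \<beta> 0) (bracketR \<gamma> 0) :: _ \<Rightarrow>\<^sub>0 'k) = 0"
      by (rule prj_defect[OF gsb]) simp_all
    then have "prj ((mon (bracketR \<alpha> ?z) \<diamond> mon (bracketR \<beta> 0)) \<diamond> mon (bracketR \<gamma> 0)) =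
        (prj (mon (bracketR \<alpha> ?z) \<diamond> (mon (bracketR \<beta> 0) \<diamond> mon (bracketR \<gamma> 0))) :: _ \<Rightarrow>\<^sub>0 'k)"
      unfolding defect_def klinear_diff[OF klinear_prj] by simp
    then have "mon (bracketR ((\<alpha> \<^bold>\<rightarrow> \<beta>) \<^bold>\<leftarrow> \<gamma>) (bracketR (\<alpha> \<^bold>\<rhd> \<beta>) ?z + bracketS ((\<alpha> \<^bold>\<rightarrow> \<beta>) \<^bold>\<lhd> \<gamma>) 0))
        + mon (bracketR ((\<alpha> \<^bold>\<leftarrow> \<beta>) \<^bold>\<leftarrow> \<gamma>) (?z + bracketS ((\<alpha> \<^bold>\<lhd> \<beta>) \<^bold>\<rightarrow> ((\<alpha> \<^bold>\<leftarrow> \<beta>) \<^bold>\<lhd> \<gamma>))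
            (bracketR ((\<alpha> \<^bold>\<lhd> \<beta>) \<^bold>\<rhd> ((\<alpha> \<^bold>\<leftarrow> \<beta>) \<^bold>\<lhd> \<gamma>)) 0)))
        + mon (bracketR ((\<alpha> \<^bold>\<leftarrow> \<beta>) \<^bold>\<leftarrow> \<gamma>) (?z + bracketS ((\<alpha> \<^bold>\<lhd> \<beta>) \<^bold>\<leftarrow> ((\<alpha> \<^bold>\<leftarrow> \<beta>) \<^bold>\<lhd> \<gamma>))
            (bracketS ((\<alpha> \<^bold>\<lhd> \<beta>) \<^bold>\<lhd> ((\<alpha> \<^bold>\<leftarrow> \<beta>) \<^bold>\<lhd> \<gamma>)) 0)))
      = (mon (bracketR (\<alpha> \<^bold>\<rightarrow> (\<beta> \<^bold>\<leftarrow> \<gamma>)) (bracketR (\<alpha> \<^bold>\<rhd> (\<beta> \<^bold>\<leftarrow> \<gamma>)) ?z + bracketS (\<beta> \<^bold>\<lhd> \<gamma>) 0))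
        + mon (bracketR (\<alpha> \<^bold>\<leftarrow> (\<beta> \<^bold>\<rightarrow> \<gamma>)) (?z + bracketS (\<alpha> \<^bold>\<lhd> (\<beta> \<^bold>\<rightarrow> \<gamma>)) (bracketR (\<beta> \<^bold>\<rhd> \<gamma>) 0)))
        + mon (bracketR (\<alpha> \<^bold>\<leftarrow> (\<beta> \<^bold>\<leftarrow> \<gamma>)) (?z + bracketS (\<alpha> \<^bold>\<lhd> (\<beta> \<^bold>\<leftarrow> \<gamma>)) (bracketS (\<beta> \<^bold>\<lhd> \<gamma>) 0)))
          :: _ \<Rightarrow>\<^sub>0 'k)"
      unfolding triple_left[where T=Inl, OF insertI1 unit1 left] triple_right[where T=Inl, OF insertI1 unit3]
      by (simp add: klinear_add[OF klinear_prj] klinear_zero[OF klinear_prj] noclash wide_bracket)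
    then show ?thesis
      by (rule mon_sum_eqD[elim_format]) (auto simp: bword_eq_iff)
  qed
  show ?thesis
    by unfold_locales (use 1 2 in blast)+
qed

end

section \<open>The free operated algebra and its quotients\<close>

lemma free_algebra_simps [simp]:
  "carrier (free_algebra X) = {f. keys f \<subseteq> bwords X}"
  "mult (free_algebra X) = (*)" "one (free_algebra X) = 1" "zero (free_algebra X) = 0"
  "add (free_algebra X) = (+)" "smult (free_algebra X) = scale"
  by (simp_all add: free_algebra_def)

lemma scalar_ring_simps [simp]:
  "carrier scalar_ring = UNIV" "mult scalar_ring = (*)" "one scalar_ring = 1" "zero scalar_ring = 0"
  "add scalar_ring = (+)"
  by (simp_all add: scalar_ring_def)

lemma cring_scalar_ring: "cring (scalar_ring :: 'k::comm_ring_1 ring)"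
proof (rule cringI)
  show "abelian_group (scalar_ring :: 'k ring)"
    by (rule abelian_groupI) (auto simp: algebra_simps intro: exI[of _ "- _"])
  show "comm_monoid (scalar_ring :: 'k ring)"
    by (rule comm_monoidI) (auto simp: algebra_simps)
qed (auto simp: algebra_simps)

lemma keys_subset_simps:
  fixes f g :: "('l, 'x) bword \<Rightarrow>\<^sub>0 'k::comm_ring_1"
  assumes "keys f \<subseteq> bwords X"
  shows "keys g \<subseteq> bwords X \<Longrightarrow> keys (f + g) \<subseteq> bwords X"
    and "keys g \<subseteq> bwords X \<Longrightarrow> keys (f - g) \<subseteq> bwords X"
    and "keys g \<subseteq> bwords X \<Longrightarrow> keys (f * g) \<subseteq> bwords X"
    and "keys (- f) \<subseteq> bwords X"
    and "keys (scale c f) \<subseteq> bwords X"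
    and "keys (br l f) \<subseteq> bwords X"
proof -
  show "keys g \<subseteq> bwords X \<Longrightarrow> keys (f + g) \<subseteq> bwords X"
    using keys_add[of f g] assms by blast
  show "keys g \<subseteq> bwords X \<Longrightarrow> keys (f - g) \<subseteq> bwords X"
    using keys_diff_subset[of f g] assms by blast
  show "keys (f * g) \<subseteq> bwords X" if "keys g \<subseteq> bwords X"
  proof (rule order_trans[OF keys_mult])
    show "{a + b |a b. a \<in> keys f \<and> b \<in> keys g} \<subseteq> bwords X"
      using assms that by auto
  qed
  show "keys (- f) \<subseteq> bwords X"
    using assms by (auto simp: in_keys_iff)
  show "keys (scale c f) \<subseteq> bwords X"
    using keys_scale[of c f] assms by blast
  show "keys (br l f) \<subseteq> bwords X"
    by (rule order_trans[OF keys_linear_extension]) (use assms in auto)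
qed

lemma ring_free_algebra: "ring (free_algebra X)"
proof (rule ringI)
  show "abelian_group (free_algebra X)"
  proof (rule abelian_groupI)
    fix f assume "f \<in> carrier (free_algebra X)"
    then show "\<exists>g\<in>carrier (free_algebra X). g \<oplus>\<^bsub>free_algebra X\<^esub> f = \<zero>\<^bsub>free_algebra X\<^esub>"
      by (intro bexI[of _ "- f"]) (simp_all add: keys_subset_simps)
  qed (simp_all add: keys_subset_simps algebra_simps)
  show "Group.monoid (free_algebra X)"
    by (rule monoidI) (simp_all add: keys_subset_simps algebra_simps)
qed (simp_all add: algebra_simps)

lemma a_inv_free_algebra:
  assumes "f \<in> carrier (free_algebra X)"
  shows "\<ominus>\<^bsub>free_algebra X\<^esub> f = - f"
proof -
  interpret ring "free_algebra X" by (rule ring_free_algebra)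
  show ?thesis
    by (rule minus_equality) (use assms in \<open>simp_all add: keys_subset_simps\<close>)
qed

section \<open>Quotients by ideals closed under the brackets\<close>

locale operated_quotient =
  fixes X :: "'x set" and I :: "(('l, 'x) bword \<Rightarrow>\<^sub>0 'k::comm_ring_1) set"
  assumes I_ideal: "ideal I (free_algebra X)" and I_br: "f \<in> I \<Longrightarrow> br l f \<in> I"
begin

abbreviation A where "A \<equiv> free_algebra X :: ('k, ('l, 'x) bword \<Rightarrow>\<^sub>0 'k) module"

abbreviation Q where "Q \<equiv> quotient_algebra A I"

abbreviation cl where "cl f \<equiv> I +>\<^bsub>A\<^esub> f"

sublocale I: ideal I A by (rule I_ideal)

lemma I_carrier: "f \<in> I \<Longrightarrow> keys f \<subseteq> bwords X"
  using I.a_subset by auto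

lemma I_zero: "0 \<in> I"
  using additive_subgroup.zero_closed[OF ideal.axioms(1)[OF I_ideal]] by simp

lemma I_add: "f \<in> I \<Longrightarrow> g \<in> I \<Longrightarrow> f + g \<in> I"
  using additive_subgroup.a_closed[OF ideal.axioms(1)[OF I_ideal]] by simp

lemma I_minus: "f \<in> I \<Longrightarrow> - f \<in> I"
  using additive_subgroup.a_inv_closed[OF ideal.axioms(1)[OF I_ideal], of f] a_inv_free_algebra[of f X] I_carrier[of f] by simp

lemma I_diff: "f \<in> I \<Longrightarrow> g \<in> I \<Longrightarrow> f - g \<in> I"
  using I_add[OF _ I_minus] by fastforce

lemma I_mult_left: "f \<in> I \<Longrightarrow> keys g \<subseteq> bwords X \<Longrightarrow> g * f \<in> I"
  and I_mult_right: "f \<in> I \<Longrightarrow> keys g \<subseteq> bwords X \<Longrightarrow> f * g \<in> I"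
  using I.I_l_closed[of f g] I.I_r_closed[of f g] by simp_all

lemma I_scale: "f \<in> I \<Longrightarrow> scale c f \<in> I"
  using I_mult_left[of f "single 0 c"] by (simp add: scale_def mult_map_scale_conv_mult)

lemma I_sum: "(\<And>i. i \<in> F \<Longrightarrow> f i \<in> I) \<Longrightarrow> sum f F \<in> I"
  by (induction F rule: infinite_finite_induct) (simp_all add: I_zero I_add)

lemma I_klinear:
  assumes "klinear F" "\<And>w. w \<in> keys f \<Longrightarrow> F (mon w) \<in> I"
  shows "F f \<in> I"
  unfolding klinear_expand[OF assms(1), of f] lin_def by (intro I_sum I_scale assms(2))

text \<open>Closure under brackets supplies the nested positions; the ideal property alone covers
  only factors on the left and right.\<close>

lemma I_context: "\<phi> \<in> contexts X \<Longrightarrow> f \<in> I \<Longrightarrow> linear_extension \<phi> f \<in> I"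
proof (induction rule: contexts.induct)
  case hole
  then show ?case by (simp add: linear_extension_id)
next
  case (left \<phi> a)
  then show ?case by (simp add: linear_extension_plus_left I_mult_left)
next
  case (right \<phi> a)
  then show ?case by (simp add: linear_extension_plus_right I_mult_right)
next
  case (under \<phi> l)
  then show ?case using I_br[of "linear_extension \<phi> f" l] by (simp add: linear_extension_comp)
qed

lemma cl_alt: "cl f = (\<lambda>i. i + f) ` I"
  by (auto simp: a_r_coset_def r_coset_def)

lemma mem_cl: "g \<in> cl f \<longleftrightarrow> g - f \<in> I"
proof
  assume "g - f \<in> I"
  then have "(g - f) + f \<in> cl f" unfolding cl_alt by blast
  then show "g \<in> cl f" by simp
qed (auto simp: cl_alt)

lemma cl_eq_iff: "cl f = cl g \<longleftrightarrow> f - g \<in> I"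
proof
  assume "cl f = cl g"
  moreover have "f \<in> cl f" by (simp add: mem_cl I_zero)
  ultimately show "f - g \<in> I" by (simp add: mem_cl)
next
  assume *: "f - g \<in> I"
  have "h - f \<in> I \<longleftrightarrow> h - g \<in> I" for h
    using I_add[OF _ *, of "h - f"] I_diff[OF _ *, of "h - g"] by auto
  then show "cl f = cl g" by (auto simp: mem_cl)
qed

lemma cl_zero: "cl 0 = I"
  by (simp add: cl_alt)

text \<open>\<open>coset_map\<close> is a union of cosets over all representatives; under the
  hypothesis these are one and the same coset, so the union collapses.\<close>

lemma coset_map_cl:
  assumes "\<And>g. g - f \<in> I \<Longrightarrow> F g - F f \<in> I"
  shows "coset_map A I F (cl f) = cl (F f)"
proof -
  have "cl (F g) = cl (F f)" if "g \<in> cl f" for g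
    using assms[of g] that by (simp add: mem_cl cl_eq_iff)
  moreover have "f \<in> cl f" by (simp add: mem_cl I_zero)
  ultimately show ?thesis unfolding coset_map_def by blast
qed

lemma carrier_Q: "carrier Q = cl ` carrier A"
  by (auto simp: quotient_algebra_def FactRing_def A_RCOSETS_defs a_r_coset_def)

lemma mult_Q:
  assumes "keys f \<subseteq> bwords X" "keys g \<subseteq> bwords X"
  shows "cl f \<otimes>\<^bsub>Q\<^esub> cl g = cl (f * g)"
  using I.rcoset_mult_add[of f g] assms by (simp add: quotient_algebra_def FactRing_def)

lemma add_Q: "cl f \<oplus>\<^bsub>Q\<^esub> cl g = cl (f + g)"
proof -
  have *: "h - (f + g) \<in> I \<longleftrightarrow> (\<exists>x y. h = x + y \<and> x - f \<in> I \<and> y - g \<in> I)" for h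
  proof
    assume "h - (f + g) \<in> I"
    then show "\<exists>x y. h = x + y \<and> x - f \<in> I \<and> y - g \<in> I"
      by (intro exI[of _ "h - g"] exI[of _ g]) (simp add: I_zero algebra_simps)
  next
    assume "\<exists>x y. h = x + y \<and> x - f \<in> I \<and> y - g \<in> I"
    then obtain x y where "h = x + y" "x - f \<in> I" "y - g \<in> I" by blast
    then show "h - (f + g) \<in> I"
      using I_add[of "x - f" "y - g"] by (simp add: algebra_simps)
  qed
  have "cl f \<oplus>\<^bsub>Q\<^esub> cl g = {x + y | x y. x \<in> cl f \<and> y \<in> cl g}"
    by (auto simp: quotient_algebra_def FactRing_def set_add_def set_mult_def)
  also have "\<dots> = cl (f + g)"
    by (rule Set.set_eqI) (simp add: mem_cl *)
  finally show ?thesis .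
qed

lemma one_Q: "\<one>\<^bsub>Q\<^esub> = cl 1" and zero_Q: "\<zero>\<^bsub>Q\<^esub> = cl 0"
  by (simp_all add: quotient_algebra_def FactRing_def cl_zero)

lemma smult_Q: "c \<odot>\<^bsub>Q\<^esub> cl f = cl (scale c f)"
proof -
  have "scale c g - scale c f = scale c (g - f)" for g
    by (rule poly_mapping_eqI) (simp add: lookup_minus algebra_simps)
  then show ?thesis
    unfolding quotient_algebra_def by (simp add: coset_map_cl I_scale)
qed

lemma br_Q: "coset_map A I (br l) (cl f) = cl (br l f)"
  by (rule coset_map_cl) (simp add: I_br flip: klinear_diff[OF klinear_linear_extension])

lemma Q_cases:
  assumes "C \<in> carrier Q"
  obtains f where "C = cl f" "keys f \<subseteq> bwords X"
  using assms by (auto simp: carrier_Q)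

lemma cl_closed: "keys f \<subseteq> bwords X \<Longrightarrow> cl f \<in> carrier Q"
  by (auto simp: carrier_Q)

lemma abelian_group_Q: "abelian_group Q"
proof (rule abelian_groupI)
  fix x assume "x \<in> carrier Q"
  then obtain f where "x = cl f" "keys f \<subseteq> bwords X" by (rule Q_cases)
  then show "\<exists>y\<in>carrier Q. y \<oplus>\<^bsub>Q\<^esub> x = \<zero>\<^bsub>Q\<^esub>"
    by (intro bexI[of _ "cl (- f)"]) (simp_all add: add_Q zero_Q cl_closed keys_subset_simps)
qed (auto elim!: Q_cases simp: add_Q zero_Q algebra_simps cl_closed keys_subset_simps)

lemma ring_Q: "ring Q"
proof (rule ringI[OF abelian_group_Q])
  show "Group.monoid Q"
    by (rule monoidI) (auto elim!: Q_cases simp: mult_Q one_Q algebra_simps keys_subset_simps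
      cl_closed)
qed (auto elim!: Q_cases simp: mult_Q add_Q keys_subset_simps algebra_simps)

lemma assoc_algebra_Q: "assoc_algebra scalar_ring Q"
proof -
  have "Module.module scalar_ring Q"
    by (rule moduleI[OF cring_scalar_ring abelian_group_Q])
      (auto elim!: Q_cases simp: smult_Q add_Q scale_add_left scale_add_right keys_subset_simps cl_closed)
  then show ?thesis
    by (intro assoc_algebra.intro ring_Q assoc_algebra_axioms.intro)
      (auto elim!: Q_cases simp: smult_Q mult_Q keys_subset_simps scale_mult_left scale_mult_right)
qed

lemma linear_operator_br: "linear_operator scalar_ring Q (coset_map A I (br l))"
  unfolding linear_operator_def
  by (auto elim!: Q_cases simp: br_Q add_Q smult_Q klinear_add[OF klinear_linear_extension]
      klinear_scale[OF klinear_linear_extension] cl_closed keys_subset_simps)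

text \<open>Translates combinations of classes, in terms of which a basis is defined, into classes
  of polynomials, where the ideal can be tested.\<close>

lemma finsum_Q:
  assumes "finite F" "F \<subseteq> bwords X"
  shows "(\<Oplus>\<^bsub>Q\<^esub>i\<in>F. c i \<odot>\<^bsub>Q\<^esub> cl (mon i)) = cl (\<Sum>i\<in>F. single i (c i))"
  using assms
proof (induction F rule: finite_induct)
  case empty
  interpret abelian_group Q by (rule abelian_group_Q)
  show ?case by (simp add: zero_Q)
next
  case (insert i F)
  interpret abelian_group Q by (rule abelian_group_Q)
  have "c j \<odot>\<^bsub>Q\<^esub> cl (mon j) \<in> carrier Q" if "j \<in> insert i F" for j
  proof -
    have "j \<in> bwords X"
      using that insert.prems by blast
    then show ?thesis by (simp add: smult_Q cl_closed)
  qed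
  then have "(\<Oplus>\<^bsub>Q\<^esub>j\<in>insert i F. c j \<odot>\<^bsub>Q\<^esub> cl (mon j)) =
      c i \<odot>\<^bsub>Q\<^esub> cl (mon i) \<oplus>\<^bsub>Q\<^esub> (\<Oplus>\<^bsub>Q\<^esub>j\<in>F. c j \<odot>\<^bsub>Q\<^esub> cl (mon j))"
    using insert.hyps by (intro finsum_insert) auto
  then show ?case
    using insert by (simp add: smult_Q add_Q)
qed

end

lemma ideal_carrier: "ideal (carrier (free_algebra X)) (free_algebra X)"
  by (rule ring.oneideal[OF ring_free_algebra])

lemma operated_quotient_operated_ideal:
  assumes "S \<subseteq> carrier (free_algebra X)"
  shows "operated_quotient X (operated_ideal X S)"
proof (rule operated_quotient.intro)
  let ?F = "{J. ideal J (free_algebra X) \<and> (\<forall>l. \<forall>f\<in>J. br l f \<in> J) \<and> S \<subseteq> J}"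
  \<comment> \<open>The intersection must run over a nonempty family; over the empty one it would be
    the whole type.\<close>
  have "carrier (free_algebra X) \<in> ?F"
    using assms ideal_carrier[of X] by (simp add: keys_subset_simps)
  then have "?F \<noteq> {}" by blast
  then show "ideal (operated_ideal X S) (free_algebra X)"
    unfolding operated_ideal_def by (intro ring.i_Intersect[OF ring_free_algebra]) blast+
  show "br l f \<in> operated_ideal X S" if "f \<in> operated_ideal X S" for f l
    using that unfolding operated_ideal_def by blast
qed

lemma operated_ideal_least:
  assumes "ideal J (free_algebra X)" "\<And>l f. f \<in> J \<Longrightarrow> br l f \<in> J" "S \<subseteq> J"
  shows "operated_ideal X S \<subseteq> J"
  using assms unfolding operated_ideal_def by blast

lemma operated_ideal_superset: "S \<subseteq> operated_ideal X S"
  unfolding operated_ideal_def by blast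

section \<open>The quotient by the relations\<close>

lemma scale_diff_right: "scale c (f - g) = scale c f - scale c g"
  by (rule poly_mapping_eqI) (simp add: lookup_minus algebra_simps)

lemma klinear_diff_fun: "klinear F \<Longrightarrow> klinear G \<Longrightarrow> klinear (\<lambda>f. F f - G f)"
  by (simp add: klinear_def scale_diff_right)

context four_operations
begin

lemma rb_relations_carrier: "rb_relations X \<subseteq> carrier (free_algebra X)"
  by (auto simp: rb_relations_eq intro: relT_closed[THEN subsetD])

abbreviation rb_ideal where "rb_ideal X \<equiv> operated_ideal X (rb_relations X)"

lemma operated_quotient_rb_ideal: "operated_quotient X (rb_ideal X)"
  by (rule operated_quotient_operated_ideal[OF rb_relations_carrier])

lemma relT_in_ideal:
  "T \<in> {Inl, Inr} \<Longrightarrow> u \<in> bwords X \<Longrightarrow> v \<in> bwords X \<Longrightarrow> relT T \<alpha> \<beta> u v \<in> rb_ideal X"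
  by (rule subsetD[OF operated_ideal_superset relT_in_relations])

text \<open>The generators concern words only. The expression is linear in \<open>f\<close> and in
  \<open>g\<close> separately, so membership spreads from monomials to all polynomials.\<close>

lemma bilinear_relation_in_ideal:
  fixes f g :: "('w, 'x, 'k::comm_ring_1) rb_poly"
  assumes T: "T \<in> {Inl, Inr}" and f: "keys f \<subseteq> bwords X" and g: "keys g \<subseteq> bwords X"
  shows "br (T \<alpha>) f * br (T \<beta>) g - br (T (\<alpha> \<^bold>\<rightarrow> \<beta>)) (br (Inl (\<alpha> \<^bold>\<rhd> \<beta>)) f * g)
    - br (T (\<alpha> \<^bold>\<leftarrow> \<beta>)) (f * br (Inr (\<alpha> \<^bold>\<lhd> \<beta>)) g) \<in> rb_ideal X"
proof -
  interpret operated_quotient X "rb_ideal X :: ('w, 'x, 'k) rb_poly set"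
    by (rule operated_quotient_rb_ideal)
  let ?D = "\<lambda>f g. br (T \<alpha>) f * br (T \<beta>) g - br (T (\<alpha> \<^bold>\<rightarrow> \<beta>)) (br (Inl (\<alpha> \<^bold>\<rhd> \<beta>)) f * g)
    - br (T (\<alpha> \<^bold>\<leftarrow> \<beta>)) (f * br (Inr (\<alpha> \<^bold>\<lhd> \<beta>)) g) :: ('w, 'x, 'k) rb_poly"
  note br = klinear_linear_extension
  have left: "klinear (\<lambda>f. ?D f g)" for g
    by (rule klinear_diff_fun[OF klinear_diff_fun[OF klinear_comp[OF klinear_mult_right br]
      klinear_comp[OF br klinear_comp[OF klinear_mult_right br]]] klinear_comp[OF br klinear_mult_right]])
  have right: "klinear (\<lambda>g. ?D f g)" for f
    by (rule klinear_diff_fun[OF klinear_diff_fun[OF klinear_comp[OF klinear_mult_left br]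
      klinear_comp[OF br klinear_mult_left]] klinear_comp[OF br klinear_comp[OF klinear_mult_left br]]])
  show ?thesis
  proof (rule I_klinear[OF left])
    fix u assume "u \<in> keys f"
    then have u: "u \<in> bwords X" using f by blast
    show "?D (mon u) g \<in> rb_ideal X"
    proof (rule I_klinear[OF right])
      fix v assume "v \<in> keys g"
      then have v: "v \<in> bwords X" using g by blast
      have "?D (mon u) (mon v) = relT T \<alpha> \<beta> u v"
        by (simp add: relT_def mult_single)
      then show "?D (mon u) (mon v) \<in> rb_ideal X"
        using relT_in_ideal[OF T u v] by simp
    qed
  qed
qed

lemma rota_baxter_system_quotient:
  fixes X :: "'x set"
  defines "I \<equiv> rb_ideal X :: (('w, 'x, 'k::comm_ring_1) rb_poly) set"
  shows "rota_baxter_system (\<^bold>\<leftarrow>) (\<^bold>\<rightarrow>) (\<^bold>\<lhd>) (\<^bold>\<rhd>) scalar_ring (quotient_algebra (free_algebra X) I)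
    (\<lambda>\<omega>. coset_map (free_algebra X) I (br (Inl \<omega>))) (\<lambda>\<omega>. coset_map (free_algebra X) I (br (Inr \<omega>)))"
proof -
  interpret operated_quotient X I
    unfolding I_def by (rule operated_quotient_rb_ideal)
  show ?thesis
  proof (intro rota_baxter_system.intro assoc_algebra_Q rota_baxter_system_axioms.intro linear_operator_br)
    fix a b \<alpha> \<beta>
    assume "a \<in> carrier Q" "b \<in> carrier Q"
    then obtain f g where fg: "a = cl f" "keys f \<subseteq> bwords X" "b = cl g" "keys g \<subseteq> bwords X"
      by (auto elim!: Q_cases)
    have rel: "br (T \<alpha>) f * br (T \<beta>) g - (br (T (\<alpha> \<^bold>\<rightarrow> \<beta>)) (br (Inl (\<alpha> \<^bold>\<rhd> \<beta>)) f * g)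
      + br (T (\<alpha> \<^bold>\<leftarrow> \<beta>)) (f * br (Inr (\<alpha> \<^bold>\<lhd> \<beta>)) g)) \<in> I" if "T \<in> {Inl, Inr}" for T
      using bilinear_relation_in_ideal[OF that fg(2,4)] by (simp add: I_def diff_diff_eq)
    show "coset_map A I (br (Inl \<alpha>)) a \<otimes>\<^bsub>Q\<^esub> coset_map A I (br (Inl \<beta>)) b =
      coset_map A I (br (Inl (\<alpha> \<^bold>\<rightarrow> \<beta>))) (coset_map A I (br (Inl (\<alpha> \<^bold>\<rhd> \<beta>))) a \<otimes>\<^bsub>Q\<^esub> b) \<oplus>\<^bsub>Q\<^esub>
      coset_map A I (br (Inl (\<alpha> \<^bold>\<leftarrow> \<beta>))) (a \<otimes>\<^bsub>Q\<^esub> coset_map A I (br (Inr (\<alpha> \<^bold>\<lhd> \<beta>))) b)"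
      using rel[of Inl] by (simp add: fg br_Q mult_Q add_Q keys_subset_simps cl_eq_iff)
    show "coset_map A I (br (Inr \<alpha>)) a \<otimes>\<^bsub>Q\<^esub> coset_map A I (br (Inr \<beta>)) b =
      coset_map A I (br (Inr (\<alpha> \<^bold>\<rightarrow> \<beta>))) (coset_map A I (br (Inl (\<alpha> \<^bold>\<rhd> \<beta>))) a \<otimes>\<^bsub>Q\<^esub> b) \<oplus>\<^bsub>Q\<^esub>
      coset_map A I (br (Inr (\<alpha> \<^bold>\<leftarrow> \<beta>))) (a \<otimes>\<^bsub>Q\<^esub> coset_map A I (br (Inr (\<alpha> \<^bold>\<lhd> \<beta>))) b)"
      using rel[of Inr] by (simp add: fg br_Q mult_Q add_Q keys_subset_simps cl_eq_iff)
  qed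
qed

end

context ordered_operations
begin

text \<open>Rewriting a reducible word replaces it by two smaller ones.\<close>

lemma irreducible_spanning:
  fixes f :: "('w, 'x, 'k::comm_ring_1) rb_poly"
  assumes "keys f \<subseteq> bwords X"
  shows "\<exists>g. keys g \<subseteq> irreducible_words X db
      (rb_relations X :: ('w, 'x, 'k) rb_poly set) \<and> f - g \<in> rb_ideal X"
proof -
  interpret operated_quotient X "rb_ideal X :: ('w, 'x, 'k) rb_poly set"
    by (rule operated_quotient_rb_ideal)
  let ?J = "irreducible_words X db (rb_relations X :: ('w, 'x, 'k) rb_poly set)"
  let ?I = "rb_ideal X :: ('w, 'x, 'k) rb_poly set"
  have words: "w \<in> bwords X \<Longrightarrow> \<exists>g. keys g \<subseteq> ?J \<and> mon w - g \<in> ?I" for w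
  proof (induction w rule: wf_induct_rule[OF wf_db_less[OF rX rL]])
    case (1 w)
    show ?case
    proof (cases "w \<in> ?J")
      case True
      then show ?thesis
        by (intro exI[of _ "mon w"]) (simp add: I_zero)
    next
      case False
      then obtain q and s :: "('w, 'x, 'k) rb_poly" where q: "q \<in> star_bwords X" "s \<in> rb_relations X"
          "w = subst (lead db s) q"
        using 1(2) unfolding irreducible_words_def by blast
      then obtain T \<alpha> \<beta> u v where s: "s = relT T \<alpha> \<beta> u v" "T \<in> {Inl, Inr}" "u \<in> bwords X" "v \<in> bwords X"
        unfolding rb_relations_eq by blast
      define \<phi> where "\<phi> = (\<lambda>u :: ('w + 'w, 'x) bword. subst u q)"
      have \<phi>: "\<phi> \<in> contexts X"
        unfolding \<phi>_def by (rule subst_in_contexts[OF q(1)])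
      have w: "w = \<phi> (lt T \<alpha> \<beta> u v)"
        using q(3) unfolding s(1) lead_relT[OF s(3,4)] \<phi>_def .
      have less: "\<phi> (m1 T \<alpha> \<beta> u v) \<prec> w" "\<phi> (m2 T \<alpha> \<beta> u v) \<prec> w"
        unfolding w by (rule db_less_contexts[OF \<phi>] m1_less m2_less)+
      have X: "\<phi> (m1 T \<alpha> \<beta> u v) \<in> bwords X" "\<phi> (m2 T \<alpha> \<beta> u v) \<in> bwords X"
        using s by (simp_all add: contexts_closed[OF \<phi>])
      have IH: "\<exists>g. keys g \<subseteq> ?J \<and> mon y - g \<in> ?I" if "y \<prec> w" "y \<in> bwords X" for y
        by (rule 1(1)) (use that 1(2) in simp_all)
      from IH[OF less(1) X(1)] IH[OF less(2) X(2)]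
      obtain g1 g2 where g: "keys g1 \<subseteq> ?J" "mon (\<phi> (m1 T \<alpha> \<beta> u v)) - g1 \<in> ?I"
          "keys g2 \<subseteq> ?J" "mon (\<phi> (m2 T \<alpha> \<beta> u v)) - g2 \<in> ?I"
        by blast
      have "linear_extension \<phi> (relT T \<alpha> \<beta> u v) \<in> ?I"
        by (rule I_context[OF \<phi> relT_in_ideal[OF s(2-4)]])
      then have "linear_extension \<phi> (relT T \<alpha> \<beta> u v) + (mon (\<phi> (m1 T \<alpha> \<beta> u v)) - g1) + (mon (\<phi> (m2 T \<alpha> \<beta> u v)) - g2) \<in> ?I"
        using g by (intro I_add)
      then have "mon w - (g1 + g2) \<in> ?I"
        unfolding linear_extension_relT w by (simp add: algebra_simps)
      moreover have "keys (g1 + g2) \<subseteq> ?J"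
        using keys_add[of g1 g2] g by blast
      ultimately show ?thesis by blast
    qed
  qed
  \<comment> \<open>One reduced form is chosen for each word; \<open>lin G\<close> then reduces all
    terms of \<open>f\<close> at once.\<close>
  then obtain G where G: "\<And>w. w \<in> bwords X \<Longrightarrow> keys (G w) \<subseteq> ?J \<and> mon w - G w \<in> ?I"
    by metis
  show ?thesis
  proof (intro exI[of _ "lin G f"] conjI)
    show "keys (lin G f) \<subseteq> ?J"
      unfolding lin_def
    proof (intro order_trans[OF keys_sum] UN_least)
      fix w assume "w \<in> keys f"
      then have "keys (G w) \<subseteq> ?J"
        using G assms by blast
      then show "keys (scale (lookup f w) (G w)) \<subseteq> ?J"
        using keys_scale by (rule order_trans[rotated])
    qed
    show "f - lin G f \<in> ?I"
    proof (rule I_klinear[where F="\<lambda>f. f - lin G f", OF klinear_diff_fun[OF klinear_id klinear_lin]])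
      fix w assume "w \<in> keys f"
      then show "mon w - lin G (mon w) \<in> ?I"
        unfolding lin_single using G assms by blast
    qed
  qed
qed

end

context ordered_eds
begin

text \<open>Among polynomials with words over \<open>X\<close>, the kernel of \<open>lin nf\<close>
  is an ideal since \<open>nf\<close> carries products to \<open>\<diamond>\<close>, it is stable
  under brackets since \<open>nf\<close> commutes with them, and it contains the relations. Hence it
  contains the smallest such ideal.\<close>

lemma nf_ideal:
  fixes f :: "('w, 'x, 'k::comm_ring_1) rb_poly"
  assumes "f \<in> rb_ideal X"
  shows "lin nf f = 0"
proof -
  let ?J = "{f :: ('w, 'x, 'k) rb_poly. keys f \<subseteq> bwords X \<and> lin nf f = 0}"
  have "rb_ideal X \<subseteq> ?J"
  proof (rule operated_ideal_least)
    show "ideal ?J (free_algebra X)"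
    proof (rule idealI[OF ring_free_algebra])
      show "subgroup ?J (add_monoid (free_algebra X))"
      proof (rule group.subgroupI)
        show "Group.group (add_monoid (free_algebra X))"
          by (rule abelian_group.a_group[OF ring.is_abelian_group[OF ring_free_algebra]])
        fix f assume f: "f \<in> ?J"
        have "inv\<^bsub>add_monoid (free_algebra X)\<^esub> f = - f"
          using a_inv_free_algebra[of f X] f by (simp add: a_inv_def)
        then show "inv\<^bsub>add_monoid (free_algebra X)\<^esub> f \<in> ?J"
          using f by (simp add: keys_subset_simps klinear_minus[OF klinear_nf])
      qed (auto simp: klinear_add[OF klinear_nf] klinear_zero[OF klinear_nf] keys_subset_simps
          intro!: exI[of _ 0])
    qed (simp_all add: keys_subset_simps nf_mult klinear_zero[OF klinear_dm_left] klinear_zero[OF klinear_dm_right])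
    show "br l f \<in> ?J" if "f \<in> ?J" for l f
      using that by (simp add: keys_subset_simps nf_br klinear_zero[OF klinear_linear_extension])
    show "rb_relations X \<subseteq> ?J"
    proof
      fix s :: "('w, 'x, 'k) rb_poly"
      assume s: "s \<in> rb_relations X"
      then have "lin nf s = 0"
        unfolding rb_relations_eq using nf_relT[OF _ nf_plus] by blast
      then show "s \<in> ?J"
        using subsetD[OF rb_relations_carrier s] by simp
    qed
  qed
  then show "lin nf f = 0" using assms by blast
qed

lemma nf_irreducible_word:
  assumes "w \<in> irreducible_words X db (rb_relations X :: (('w, 'x, 'k::comm_ring_1) rb_poly) set)"
  shows "nf w = (mon w :: _ \<Rightarrow>\<^sub>0 'k)"
proof (rule nf_irreducible)
  show X: "w \<in> bwords X"
    using assms by (simp add: irreducible_words_def)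
  fix \<phi> :: "('w + 'w, 'x) bword \<Rightarrow> ('w + 'w, 'x) bword" and T :: "'w \<Rightarrow> 'w + 'w" and \<alpha> \<beta> u v
  assume \<phi>: "\<phi> \<in> contexts X" and T: "T \<in> {Inl, Inr}"
  show "w \<noteq> \<phi> (bracket (T \<alpha>) u + bracket (T \<beta>) v)"
  proof
    assume w: "w = \<phi> (lt T \<alpha> \<beta> u v)"
    then have uv: "u \<in> bwords X" "v \<in> bwords X"
      using X by (simp_all add: contexts_closed[OF \<phi>])
    obtain q where q: "q \<in> star_bwords X" "\<And>u. subst u q = \<phi> u"
      using contexts_subst[OF \<phi>] by blast
    have "w = subst (lead db (relT T \<alpha> \<beta> u v :: _ \<Rightarrow>\<^sub>0 'k)) q"
      unfolding lead_relT[OF uv] q(2) by (rule w)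
    moreover have "(relT T \<alpha> \<beta> u v :: _ \<Rightarrow>\<^sub>0 'k) \<in> rb_relations X"
      by (rule relT_in_relations[OF T uv])
    ultimately show False
      using assms q(1) unfolding irreducible_words_def by blast
  qed
qed

lemma irreducible_basis:
  defines "I \<equiv> rb_ideal X :: (('w, 'x, 'k::comm_ring_1) rb_poly) set"
  shows "module_basis scalar_ring (quotient_algebra (free_algebra X) I)
    (irreducible_words X db (rb_relations X :: ('w, 'x, 'k) rb_poly set))
    (\<lambda>w. I +>\<^bsub>free_algebra X\<^esub> mon w)"
proof -
  interpret operated_quotient X I
    unfolding I_def by (rule operated_quotient_rb_ideal)
  let ?J = "irreducible_words X db (rb_relations X :: ('w, 'x, 'k) rb_poly set)"
  have J: "?J \<subseteq> bwords X"
    by (auto simp: irreducible_words_def)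
  show ?thesis
    unfolding module_basis_def
  proof (intro conjI ballI allI impI)
    show "(\<lambda>w. cl (mon w)) \<in> ?J \<rightarrow> carrier Q"
      using J by (auto intro!: cl_closed)
  next
    fix m assume "m \<in> carrier Q"
    then obtain f where f: "m = cl f" "keys f \<subseteq> bwords X" by (rule Q_cases)
    obtain g where g: "keys g \<subseteq> ?J" "f - g \<in> I"
      using irreducible_spanning[OF f(2)] unfolding I_def by blast
    have "m = cl g"
      using g(2) by (simp add: f(1) cl_eq_iff)
    also have "g = (\<Sum>i\<in>keys g. single i (lookup g i))"
      using lin_mon_id[of g] by (simp add: lin_def)
    also have "cl \<dots> = (\<Oplus>\<^bsub>Q\<^esub>i\<in>keys g. lookup g i \<odot>\<^bsub>Q\<^esub> cl (mon i))"
      using g(1) J by (intro finsum_Q[symmetric]) auto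
    finally show "\<exists>F c. finite F \<and> F \<subseteq> ?J \<and> c \<in> F \<rightarrow> carrier scalar_ring \<and> m = (\<Oplus>\<^bsub>Q\<^esub>i\<in>F. c i \<odot>\<^bsub>Q\<^esub> cl (mon i))"
      using g(1) by (intro exI[of _ "keys g"] exI[of _ "lookup g"]) auto
  next
    fix F c i
    assume *: "finite F \<and> F \<subseteq> ?J \<and> c \<in> F \<rightarrow> carrier scalar_ring \<and> (\<Oplus>\<^bsub>Q\<^esub>i\<in>F. c i \<odot>\<^bsub>Q\<^esub> cl (mon i)) = \<zero>\<^bsub>Q\<^esub>"
      and i: "i \<in> F"
    let ?f = "\<Sum>i\<in>F. single i (c i)"
    have "cl ?f = cl 0"
    proof -
      have "F \<subseteq> bwords X" using * J by blast
      then show ?thesis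
        using * finsum_Q[of F c] by (simp add: zero_Q)
    qed
    then have "?f \<in> I"
      by (simp add: cl_eq_iff)
    then have "lin nf ?f = 0"
      unfolding I_def by (rule nf_ideal)
    \<comment> \<open>The support lies in \<open>F\<close> and so consists of irreducible words.
      Being both fixed and annihilated by \<open>lin nf\<close>, the sum is zero.\<close>
    moreover have "lin nf ?f = ?f"
    proof (rule klinear_eqI[OF klinear_nf klinear_id])
      fix w assume "w \<in> keys ?f"
      then have "w \<in> F"
        using keys_sum[of "\<lambda>i. single i (c i)" F] by (auto split: if_splits)
      then show "lin nf (mon w) = (mon w :: _ \<Rightarrow>\<^sub>0 'k)"
        using * nf_irreducible_word by auto
    qed
    ultimately have "lookup ?f i = 0" by simp
    then show "c i = \<zero>\<^bsub>scalar_ring\<^esub>"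
      using * i by (simp add: lookup_sum lookup_single when_def)
  qed
qed

end

section \<open>The universal property\<close>

lemma (in abelian_monoid) finsum_mono_neutral:
  assumes "finite F" "E \<subseteq> F" "\<And>i. i \<in> F - E \<Longrightarrow> h i = \<zero>" "h \<in> F \<rightarrow> carrier G"
  shows "finsum G h E = finsum G h F"
  by (rule add.finprod_mono_neutral_cong_left) (use assms in auto)

lemma (in abelian_group) add_eq_self:
  assumes "x \<in> carrier G" "y \<in> carrier G" "x \<oplus> y = y"
  shows "x = \<zero>"
  using assms by (metis add.r_cancel_one)

text \<open>Takes the place of \<open>klinear_eqI\<close> when the target is an abstract module with
  a carrier. The added word may already occur in \<open>q\<close>, which suits additive
  maps.\<close>

lemma poly_carrier_induct [consumes 1, case_names zero add]:
  fixes p :: "'a \<Rightarrow>\<^sub>0 'k::comm_ring_1"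
  assumes "keys p \<subseteq> Y" "P 0"
    and step: "\<And>q w c. keys q \<subseteq> Y \<Longrightarrow> w \<in> Y \<Longrightarrow> P q \<Longrightarrow> P (q + single w c)"
  shows "P p"
proof -
  let ?s = "\<lambda>F. \<Sum>w\<in>F. single w (lookup p w)"
  have "finite F \<Longrightarrow> F \<subseteq> Y \<Longrightarrow> P (?s F)" for F
  proof (induction F rule: finite_induct)
    case (insert w F)
    have "keys (?s F) \<subseteq> Y"
      by (rule order_trans[OF keys_sum]) (use insert.prems in auto)
    then have "P (?s F + single w (lookup p w))"
      using insert by (intro step) auto
    then show ?case
      using insert.hyps by (simp add: add.commute)
  qed (use assms(2) in simp)
  from this[of "keys p"] show ?thesis
    using assms(1) lin_mon_id[of p] by (simp add: lin_def)
qed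

lemma linear_extension_single_coeff [simp]:
  "linear_extension \<phi> (single w c) = single (\<phi> w) c"
  by (simp add: linear_extension_def)

section \<open>Evaluation in an arbitrary Rota-Baxter system\<close>

locale rb_evaluation = rota_baxter_system larr rarr ltri rtri "scalar_ring :: 'k::comm_ring_1 ring" B R S
  for larr :: "'w \<Rightarrow> 'w \<Rightarrow> 'w" (infix \<open>\<^bold>\<leftarrow>\<close> 70)
    and rarr :: "'w \<Rightarrow> 'w \<Rightarrow> 'w" (infix \<open>\<^bold>\<rightarrow>\<close> 70)
    and ltri :: "'w \<Rightarrow> 'w \<Rightarrow> 'w" (infix \<open>\<^bold>\<lhd>\<close> 70)
    and rtri :: "'w \<Rightarrow> 'w \<Rightarrow> 'w" (infix \<open>\<^bold>\<rhd>\<close> 70)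
    and B :: "('k::comm_ring_1, 'b) module" and R S :: "'w \<Rightarrow> 'b \<Rightarrow> 'b" +
  fixes X :: "'x set" and f :: "'x \<Rightarrow> 'b"
  assumes f_closed: "f \<in> X \<rightarrow> carrier B"
begin

lemma f_mem: "x \<in> X \<Longrightarrow> f x \<in> carrier B"
  using f_closed by blast

lemma B_algebra: "assoc_algebra scalar_ring B"
  by (rule assoc_algebra_axioms)

lemma B_ring: "ring B" and B_module: "Module.module scalar_ring B"
  using B_algebra by (simp_all add: assoc_algebra_def)

lemma B_group: "abelian_group B" and B_monoid: "abelian_monoid B"
  using B_ring ring.is_abelian_group abelian_group.axioms(1) by blast+

lemmas B_closed = ring.ring_simprules(2,5,6)[OF B_ring]

definition op :: "'w + 'w \<Rightarrow> 'b \<Rightarrow> 'b" where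
  "op l = (case l of Inl \<omega> \<Rightarrow> R \<omega> | Inr \<omega> \<Rightarrow> S \<omega>)"

lemma op_simps [simp]: "op (Inl \<omega>) = R \<omega>" "op (Inr \<omega>) = S \<omega>"
  by (simp_all add: op_def)

lemma op_linear: "linear_operator scalar_ring B (op l)"
  using R_linear S_linear by (cases l) simp_all

lemma op_closed: "x \<in> carrier B \<Longrightarrow> op l x \<in> carrier B"
  and op_add: "x \<in> carrier B \<Longrightarrow> y \<in> carrier B \<Longrightarrow> op l (x \<oplus>\<^bsub>B\<^esub> y) = op l x \<oplus>\<^bsub>B\<^esub> op l y"
  and op_smult: "x \<in> carrier B \<Longrightarrow> op l (c \<odot>\<^bsub>B\<^esub> x) = c \<odot>\<^bsub>B\<^esub> op l x"
  using op_linear[of l] by (auto simp: linear_operator_def)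

lemma zero_smult: "x \<in> carrier B \<Longrightarrow> 0 \<odot>\<^bsub>B\<^esub> x = \<zero>\<^bsub>B\<^esub>"
  using module.smult_l_null[OF B_module, of x] by simp

lemma op_zero: "op l \<zero>\<^bsub>B\<^esub> = \<zero>\<^bsub>B\<^esub>"
  using op_smult[of "\<zero>\<^bsub>B\<^esub>" l 0] by (simp add: zero_smult B_closed op_closed)

primrec ev_prime :: "('w + 'w, 'x) bprime \<Rightarrow> 'b" and ev :: "('w + 'w, 'x) bword \<Rightarrow> 'b" where
  "ev_prime (Letter x) = f x"
| "ev_prime (Bracket l w) = op l (ev w)"
| "ev (BWord ps) = foldr (\<lambda>x y. x \<otimes>\<^bsub>B\<^esub> y) (map ev_prime ps) \<one>\<^bsub>B\<^esub>"

lemma ev_factors: "ev w = foldr (\<lambda>x y. x \<otimes>\<^bsub>B\<^esub> y) (map ev_prime (factors w)) \<one>\<^bsub>B\<^esub>"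
  by (cases w) simp

lemma ev_simps: "ev 0 = \<one>\<^bsub>B\<^esub>" "ev (letter x + w) = f x \<otimes>\<^bsub>B\<^esub> ev w" "ev (bracket l v + w) = op l (ev v) \<otimes>\<^bsub>B\<^esub> ev w"
  by (simp_all add: ev_factors)

lemma ev_closed: "w \<in> bwords X \<Longrightarrow> ev w \<in> carrier B"
  by (induction w rule: bword_induct) (auto simp: ev_simps B_closed op_closed f_mem)

lemma ev_plus: "u \<in> bwords X \<Longrightarrow> v \<in> bwords X \<Longrightarrow> ev (u + v) = ev u \<otimes>\<^bsub>B\<^esub> ev v"
proof (induction u rule: bword_induct)
  case zero
  then show ?case
    using ring.ring_simprules(12)[OF B_ring] by (simp add: ev_simps ev_closed)
next
  case (plus_letter x u)
  then show ?case
    by (simp add: ev_simps add.assoc ev_closed f_mem monoid.m_assoc[OF ring.is_monoid[OF B_ring]])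
next
  case (plus_bracket l u w)
  then show ?case
    by (simp add: ev_simps add.assoc ev_closed op_closed monoid.m_assoc[OF ring.is_monoid[OF B_ring]])
qed

lemma ev_bracket: "w \<in> bwords X \<Longrightarrow> ev (bracket l w) = op l (ev w)"
  and ev_letter: "x \<in> X \<Longrightarrow> ev (letter x) = f x"
  using ev_simps(3)[of l w 0] ev_simps(2)[of x 0]
  by (simp_all add: f_mem ev_simps(1) monoid.r_one[OF ring.is_monoid[OF B_ring]] ev_closed op_closed)

definition EV :: "('w, 'x, 'k) rb_poly \<Rightarrow> 'b" where
  "EV p = (\<Oplus>\<^bsub>B\<^esub>w\<in>keys p. lookup p w \<odot>\<^bsub>B\<^esub> ev w)"

text \<open>\<open>EV\<close> sums over the support, which changes under addition. Enlarging the
  index set by zero terms puts several polynomials over a common one.\<close>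

lemma EV_superset:
  assumes "finite F" "keys p \<subseteq> F" "F \<subseteq> bwords X"
  shows "EV p = (\<Oplus>\<^bsub>B\<^esub>w\<in>F. lookup p w \<odot>\<^bsub>B\<^esub> ev w)"
  unfolding EV_def
proof (rule abelian_monoid.finsum_mono_neutral[OF B_monoid assms(1,2)])
  show "lookup p w \<odot>\<^bsub>B\<^esub> ev w = \<zero>\<^bsub>B\<^esub>" if "w \<in> F - keys p" for w
  proof -
    have "w \<in> bwords X" "lookup p w = 0"
      using that assms(3) by (auto simp: in_keys_iff)
    then show ?thesis by (simp add: zero_smult ev_closed)
  qed
qed (use assms(3) in \<open>auto simp: ev_closed\<close>)

lemma EV_closed: "keys p \<subseteq> bwords X \<Longrightarrow> EV p \<in> carrier B"
  unfolding EV_def by (rule abelian_monoid.finsum_closed[OF B_monoid]) (auto simp: ev_closed)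

lemma EV_add:
  assumes "keys p \<subseteq> bwords X" "keys q \<subseteq> bwords X"
  shows "EV (p + q) = EV p \<oplus>\<^bsub>B\<^esub> EV q"
proof -
  let ?F = "keys p \<union> keys q"
  have F: "w \<in> ?F \<Longrightarrow> w \<in> bwords X" for w
    using assms by blast
  have "EV (p + q) = (\<Oplus>\<^bsub>B\<^esub>w\<in>?F. lookup (p + q) w \<odot>\<^bsub>B\<^esub> ev w)"
    using F by (intro EV_superset) (auto dest: subsetD[OF keys_add])
  also have "\<dots> = (\<Oplus>\<^bsub>B\<^esub>w\<in>?F. lookup p w \<odot>\<^bsub>B\<^esub> ev w \<oplus>\<^bsub>B\<^esub> lookup q w \<odot>\<^bsub>B\<^esub> ev w)"
  proof (rule abelian_monoid.finsum_cong'[OF B_monoid refl])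
    fix w assume "w \<in> ?F"
    then show "lookup (p + q) w \<odot>\<^bsub>B\<^esub> ev w =
        lookup p w \<odot>\<^bsub>B\<^esub> ev w \<oplus>\<^bsub>B\<^esub> lookup q w \<odot>\<^bsub>B\<^esub> ev w"
      using module.smult_l_distr[OF B_module, of _ _ "ev w"] F ev_closed by (simp add: lookup_add)
  qed (use F in \<open>auto simp: ev_closed B_closed\<close>)
  also have "\<dots> = (\<Oplus>\<^bsub>B\<^esub>w\<in>?F. lookup p w \<odot>\<^bsub>B\<^esub> ev w) \<oplus>\<^bsub>B\<^esub>
      (\<Oplus>\<^bsub>B\<^esub>w\<in>?F. lookup q w \<odot>\<^bsub>B\<^esub> ev w)"
    by (rule abelian_monoid.finsum_addf[OF B_monoid]) (use F in \<open>auto simp: ev_closed\<close>)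
  also have "\<dots> = EV p \<oplus>\<^bsub>B\<^esub> EV q"
    using F by (subst (1 2) EV_superset[of ?F]) auto
  finally show ?thesis .
qed

lemma EV_single:
  assumes "w \<in> bwords X"
  shows "EV (single w c) = c \<odot>\<^bsub>B\<^esub> ev w"
proof -
  have "EV (single w c) = (\<Oplus>\<^bsub>B\<^esub>v\<in>{w}. lookup (single w c) v \<odot>\<^bsub>B\<^esub> ev v)"
    using assms by (intro EV_superset) auto
  also have "\<dots> = c \<odot>\<^bsub>B\<^esub> ev w"
    using assms abelian_monoid.finsum_insert[OF B_monoid, of "{}" w "\<lambda>v. lookup (single w c) v \<odot>\<^bsub>B\<^esub> ev v"]
    by (simp add: ev_closed abelian_monoid.finsum_empty[OF B_monoid] abelian_monoid.r_zero[OF B_monoid])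
  finally show ?thesis .
qed

lemma EV_mon: "w \<in> bwords X \<Longrightarrow> EV (mon w) = ev w"
  using module.smult_one[OF B_module, of "ev w"] by (simp add: EV_single ev_closed)

lemma EV_zero: "EV 0 = \<zero>\<^bsub>B\<^esub>"
  by (simp add: EV_def abelian_monoid.finsum_empty[OF B_monoid])

lemma keys_single_subset: "w \<in> bwords X \<Longrightarrow> keys (single w c) \<subseteq> bwords X"
  by simp

lemma EV_scale:
  assumes "keys p \<subseteq> bwords X"
  shows "EV (scale c p) = c \<odot>\<^bsub>B\<^esub> EV p"
  using assms
proof (induction p rule: poly_carrier_induct)
  case zero
  then show ?case
    using module.smult_r_null[OF B_module, of c] by (simp add: EV_zero)
next
  case (add q w d)
  then show ?case
    using module.smult_r_distr[OF B_module, of c "EV q" "d \<odot>\<^bsub>B\<^esub> ev w"] module.smult_assoc1[OF B_module, of c d "ev w"]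
    by (simp add: scale_add_right EV_add keys_subset_simps EV_single EV_closed ev_closed)
qed

lemma EV_single_mult:
  assumes "keys q \<subseteq> bwords X" "w \<in> bwords X"
  shows "EV (single w c * q) = (c \<odot>\<^bsub>B\<^esub> ev w) \<otimes>\<^bsub>B\<^esub> EV q"
  using assms(1)
proof (induction q rule: poly_carrier_induct)
  case zero
  then show ?case
    using ring.ring_simprules(25)[OF B_ring] assms(2) by (simp add: EV_zero ev_closed)
next
  case (add q v d)
  have "(c \<odot>\<^bsub>B\<^esub> ev w) \<otimes>\<^bsub>B\<^esub> (d \<odot>\<^bsub>B\<^esub> ev v) = (c * d) \<odot>\<^bsub>B\<^esub> ev (w + v)"
    using add assms(2) assoc_algebra.smult_mult_left[OF B_algebra, of c "ev w" "d \<odot>\<^bsub>B\<^esub> ev v"]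
      assoc_algebra.smult_mult_right[OF B_algebra, of d "ev w" "ev v"]
      module.smult_assoc1[OF B_module, of c d "ev w \<otimes>\<^bsub>B\<^esub> ev v"]
    by (simp add: ev_plus ev_closed B_closed)
  then show ?case
    using add assms(2) ring.ring_simprules(23)[OF B_ring, of "EV q" "d \<odot>\<^bsub>B\<^esub> ev v" "c \<odot>\<^bsub>B\<^esub> ev w"]
    by (simp add: distrib_left mult_single EV_add keys_subset_simps EV_single EV_closed ev_closed)
qed

lemma EV_mult:
  assumes "keys p \<subseteq> bwords X" "keys q \<subseteq> bwords X"
  shows "EV (p * q) = EV p \<otimes>\<^bsub>B\<^esub> EV q"
  using assms(1)
proof (induction p rule: poly_carrier_induct)
  case zero
  then show ?case
    using ring.ring_simprules(24)[OF B_ring] assms(2) by (simp add: EV_zero EV_closed)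
next
  case (add p w c)
  then show ?case
    using assms(2) ring.ring_simprules(13)[OF B_ring, of "EV p" "c \<odot>\<^bsub>B\<^esub> ev w" "EV q"]
    by (simp add: distrib_right EV_add EV_single_mult keys_subset_simps EV_single EV_closed ev_closed)
qed

lemma EV_br:
  assumes "keys p \<subseteq> bwords X"
  shows "EV (br l p) = op l (EV p)"
  using assms
proof (induction p rule: poly_carrier_induct)
  case zero
  then show ?case
    by (simp add: EV_zero op_zero klinear_zero[OF klinear_linear_extension])
next
  case (add p w c)
  then show ?case
    by (simp add: klinear_add[OF klinear_linear_extension] EV_add keys_subset_simps EV_single ev_bracket
      op_add op_smult EV_closed ev_closed)
qed

text \<open>The equations of \<open>B\<close> say that the leading word and the sum
  \<open>?m\<close> of the lower words have the same value. Adding \<open>?m\<close> to the relation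
  leaves the leading word, so the claim follows by cancellation, without subtraction in
  \<open>B\<close>.\<close>

lemma EV_relT:
  assumes T: "T \<in> {Inl, Inr}" and X: "u \<in> bwords X" "v \<in> bwords X"
  shows "EV (relT T \<alpha> \<beta> u v) = \<zero>\<^bsub>B\<^esub>"
proof (rule abelian_group.add_eq_self[OF B_group])
  let ?r = "relT T \<alpha> \<beta> u v :: _ \<Rightarrow>\<^sub>0 'k" and ?m = "mon (m1 T \<alpha> \<beta> u v) + mon (m2 T \<alpha> \<beta> u v) :: _ \<Rightarrow>\<^sub>0 'k"
  have m: "keys ?m \<subseteq> bwords X"
    using X by (intro keys_subset_simps keys_single_subset) simp_all
  show "EV ?r \<in> carrier B" "EV ?m \<in> carrier B"
    using EV_closed relT_closed[OF X] m by blast+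
  have "EV ?r \<oplus>\<^bsub>B\<^esub> EV ?m = EV (?r + ?m)"
    by (rule EV_add[OF relT_closed[OF X] m, symmetric])
  also have "?r + ?m = mon (lt T \<alpha> \<beta> u v)"
    by (simp add: relT_def)
  also have "EV \<dots> = op (T \<alpha>) (ev u) \<otimes>\<^bsub>B\<^esub> op (T \<beta>) (ev v)"
    using X by (simp add: EV_mon ev_plus ev_bracket)
  also have "\<dots> = op (T (\<alpha> \<^bold>\<rightarrow> \<beta>)) (R (\<alpha> \<^bold>\<rhd> \<beta>) (ev u) \<otimes>\<^bsub>B\<^esub> ev v) \<oplus>\<^bsub>B\<^esub>
      op (T (\<alpha> \<^bold>\<leftarrow> \<beta>)) (ev u \<otimes>\<^bsub>B\<^esub> S (\<alpha> \<^bold>\<lhd> \<beta>) (ev v))"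
    using T R_mult[of "ev u" "ev v" \<alpha> \<beta>] S_mult[of "ev u" "ev v" \<alpha> \<beta>] X by (auto simp: ev_closed)
  also have "\<dots> = EV ?m"
    using X by (simp add: EV_add EV_mon ev_plus ev_bracket)
  finally show "EV ?r \<oplus>\<^bsub>B\<^esub> EV ?m = EV ?m" .
qed

text \<open>The kernel argument of \<open>nf_ideal\<close>, with the multiplication and operators of
  \<open>B\<close> in place of \<open>\<diamond>\<close> and the brackets.\<close>

lemma EV_ideal:
  assumes "p \<in> rb_ideal X"
  shows "EV p = \<zero>\<^bsub>B\<^esub>"
proof -
  let ?J = "{p. keys p \<subseteq> bwords X \<and> EV p = \<zero>\<^bsub>B\<^esub>}"
  have "rb_ideal X \<subseteq> ?J"
  proof (rule operated_ideal_least)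
    show "ideal ?J (free_algebra X)"
    proof (rule idealI[OF ring_free_algebra])
      show "subgroup ?J (add_monoid (free_algebra X))"
      proof (rule group.subgroupI)
        show "Group.group (add_monoid (free_algebra X :: ('k, _) module))"
          by (rule abelian_group.a_group[OF ring.is_abelian_group[OF ring_free_algebra]])
        fix p assume p: "p \<in> ?J"
        have "inv\<^bsub>add_monoid (free_algebra X)\<^esub> p = scale (- 1) p"
          using a_inv_free_algebra[of p X] p by (simp add: a_inv_def scale_minus_one)
        then show "inv\<^bsub>add_monoid (free_algebra X)\<^esub> p \<in> ?J"
          using p module.smult_r_null[OF B_module, of "- 1"] by (simp add: keys_subset_simps EV_scale)
      qed (auto simp: EV_add EV_zero keys_subset_simps B_closed abelian_monoid.r_zero[OF B_monoid]
          intro!: exI[of _ 0])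
    qed (simp_all add: keys_subset_simps EV_mult EV_closed ring.ring_simprules(24,25)[OF B_ring])
    show "br l p \<in> ?J" if "p \<in> ?J" for l p
      using that by (simp add: keys_subset_simps EV_br op_zero)
    show "rb_relations X \<subseteq> ?J"
    proof
      fix s :: "('w, 'x, 'k) rb_poly"
      assume s: "s \<in> rb_relations X"
      then have "EV s = \<zero>\<^bsub>B\<^esub>"
        unfolding rb_relations_eq using EV_relT by blast
      then show "s \<in> ?J"
        using subsetD[OF rb_relations_carrier s] by simp
    qed
  qed
  then show ?thesis using assms by blast
qed

sublocale quot: operated_quotient X "rb_ideal X :: ('w, 'x, 'k) rb_poly set"
  by (rule operated_quotient_rb_ideal)

text \<open>An arbitrary representative is evaluated; the choice is harmless because
  \<open>EV\<close> vanishes on the ideal (\<open>lift_cl\<close>).\<close>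

definition lift :: "('w, 'x, 'k) rb_poly set \<Rightarrow> 'b" where
  "lift C = EV (SOME p. p \<in> C)"

lemma lift_cl:
  assumes "keys p \<subseteq> bwords X"
  shows "lift (quot.cl p) = EV p"
proof -
  define q where "q = (SOME q. q \<in> quot.cl p)"
  have "p \<in> quot.cl p"
    by (simp add: quot.mem_cl quot.I_zero)
  then have "q \<in> quot.cl p"
    unfolding q_def by (rule someI)
  then have q: "q - p \<in> rb_ideal X"
    by (simp add: quot.mem_cl)
  have "EV q = EV ((q - p) + p)" by simp
  also have "\<dots> = EV (q - p) \<oplus>\<^bsub>B\<^esub> EV p"
    by (rule EV_add[OF quot.I_carrier[OF q] assms])
  also have "\<dots> = EV p"
    using EV_ideal[OF q] EV_closed[OF assms] abelian_monoid.l_zero[OF B_monoid] by simp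
  finally show ?thesis
    by (simp add: lift_def q_def)
qed

lemma lift_hom:
  "lift \<in> rb_hom scalar_ring quot.Q (\<lambda>\<omega>. coset_map quot.A (rb_ideal X) (br (Inl \<omega>)))
    (\<lambda>\<omega>. coset_map quot.A (rb_ideal X) (br (Inr \<omega>))) B R S"
  unfolding rb_hom_def
proof (intro CollectI conjI ring_hom_memI ballI allI)
  show "lift \<one>\<^bsub>quot.Q\<^esub> = \<one>\<^bsub>B\<^esub>"
    using EV_mon[of 0] by (simp add: quot.one_Q lift_cl ev_simps)
qed (auto elim!: quot.Q_cases simp: quot.mult_Q quot.add_Q quot.smult_Q quot.br_Q lift_cl keys_subset_simps
    EV_closed EV_mult EV_add EV_scale EV_br)

lemma lift_letter: "x \<in> X \<Longrightarrow> lift (quot.cl (mon (letter x))) = f x"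
  by (simp add: lift_cl EV_mon ev_letter)

text \<open>A homomorphism that respects the operators is determined on classes of words by
  induction on the word, and then on all classes by linearity.\<close>

lemma lift_unique:
  assumes h: "h \<in> rb_hom scalar_ring quot.Q (\<lambda>\<omega>. coset_map quot.A (rb_ideal X) (br (Inl \<omega>)))
      (\<lambda>\<omega>. coset_map quot.A (rb_ideal X) (br (Inr \<omega>))) B R S"
    and letters: "\<And>x. x \<in> X \<Longrightarrow> h (quot.cl (mon (letter x))) = f x"
    and C: "C \<in> carrier quot.Q"
  shows "h C = lift C"
proof -
  have ring: "h \<in> ring_hom quot.Q B"
    and smult: "\<And>c C. C \<in> carrier quot.Q \<Longrightarrow> h (c \<odot>\<^bsub>quot.Q\<^esub> C) = c \<odot>\<^bsub>B\<^esub> h C"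
    and op: "\<And>l C. C \<in> carrier quot.Q \<Longrightarrow> h (coset_map quot.A (rb_ideal X) (br l) C) = op l (h C)"
  proof -
    show "h (coset_map quot.A (rb_ideal X) (br l) C) = op l (h C)" if "C \<in> carrier quot.Q" for l C
      using h that by (cases l) (simp_all add: rb_hom_def)
  qed (use h in \<open>simp_all add: rb_hom_def\<close>)
  have mult: "h (quot.cl (p * q)) = h (quot.cl p) \<otimes>\<^bsub>B\<^esub> h (quot.cl q)"
    if "keys p \<subseteq> bwords X" "keys q \<subseteq> bwords X" for p q
    using ring_hom_mult[OF ring quot.cl_closed[OF that(1)] quot.cl_closed[OF that(2)]] that
    by (simp add: quot.mult_Q)
  have h_add: "h (quot.cl (p + q)) = h (quot.cl p) \<oplus>\<^bsub>B\<^esub> h (quot.cl q)"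
    if "keys p \<subseteq> bwords X" "keys q \<subseteq> bwords X" for p q
    using ring_hom_add[OF ring quot.cl_closed[OF that(1)] quot.cl_closed[OF that(2)]]
    by (simp add: quot.add_Q)
  have scale: "h (quot.cl (scale c p)) = c \<odot>\<^bsub>B\<^esub> h (quot.cl p)" if "keys p \<subseteq> bwords X" for c p
    using smult[OF quot.cl_closed[OF that], of c] by (simp add: quot.smult_Q)
  have br: "h (quot.cl (br l p)) = op l (h (quot.cl p))" if "keys p \<subseteq> bwords X" for l p
    using op[OF quot.cl_closed[OF that], of l] by (simp add: quot.br_Q)
  have word: "w \<in> bwords X \<Longrightarrow> h (quot.cl (mon w)) = ev w" for w
  proof (induction w rule: bword_induct)
    case zero
    then show ?case
      using ring_hom_one[OF ring] by (simp add: quot.one_Q ev_simps)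
  next
    case (plus_letter x u)
    then show ?case
      using mult[of "mon (letter x)" "mon u"] by (simp add: mult_single ev_simps letters)
  next
    case (plus_bracket l u v)
    then show ?case
      using mult[of "mon (bracket l u)" "mon v"] br[of "mon u" l] by (simp add: mult_single ev_simps)
  qed
  have "h (quot.cl p) = EV p" if "keys p \<subseteq> bwords X" for p
    using that
  proof (induction p rule: poly_carrier_induct)
    case zero
    \<comment> \<open>The zero polynomial is \<open>scale 0 0\<close>, so its value is the scalar 0
      times an element of the carrier.\<close>
    have "h (quot.cl 0) \<in> carrier B"
      by (rule ring_hom_closed[OF ring quot.cl_closed]) simp
    then show ?case
      using scale[of 0 0] by (simp add: EV_zero zero_smult)
  next
    case (add q w c)
    then show ?case
      using scale[of "mon w" c] by (simp add: h_add EV_add EV_single word)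
  qed
  then show ?thesis
    using C by (auto elim!: quot.Q_cases simp: lift_cl)
qed

end

theorem (in four_operations) free_rota_baxter_system_quotient:
  fixes X :: "'x set"
  defines "I \<equiv> rb_ideal X :: (('w, 'x, 'k::comm_ring_1) rb_poly) set"
  shows "free_rota_baxter_system TYPE('b) (\<^bold>\<leftarrow>) (\<^bold>\<rightarrow>) (\<^bold>\<lhd>) (\<^bold>\<rhd>) scalar_ring X
    (quotient_algebra (free_algebra X) I)
    (\<lambda>\<omega>. coset_map (free_algebra X) I (br (Inl \<omega>))) (\<lambda>\<omega>. coset_map (free_algebra X) I (br (Inr \<omega>)))
    (\<lambda>x. I +>\<^bsub>free_algebra X\<^esub> mon (letter x))"
  unfolding free_rota_baxter_system_def
proof (intro conjI allI impI)
  interpret operated_quotient X I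
    unfolding I_def by (rule operated_quotient_rb_ideal)
  show "rota_baxter_system (\<^bold>\<leftarrow>) (\<^bold>\<rightarrow>) (\<^bold>\<lhd>) (\<^bold>\<rhd>) scalar_ring Q
      (\<lambda>\<omega>. coset_map A I (br (Inl \<omega>))) (\<lambda>\<omega>. coset_map A I (br (Inr \<omega>)))"
    unfolding I_def by (rule rota_baxter_system_quotient)
  show "(\<lambda>x. cl (mon (letter x))) \<in> X \<rightarrow> carrier Q"
    by (auto intro!: cl_closed)
next
  fix B :: "('k, 'b) module" and R S f
  assume *: "rota_baxter_system (\<^bold>\<leftarrow>) (\<^bold>\<rightarrow>) (\<^bold>\<lhd>) (\<^bold>\<rhd>) scalar_ring B R S \<and> f \<in> X \<rightarrow> carrier B"
  then interpret rb: rb_evaluation "(\<^bold>\<leftarrow>)" "(\<^bold>\<rightarrow>)" "(\<^bold>\<lhd>)" "(\<^bold>\<rhd>)" B R S X f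
    by (simp add: rb_evaluation_def rb_evaluation_axioms_def)
  show "\<exists>h\<in>rb_hom scalar_ring (quotient_algebra (free_algebra X) I) (\<lambda>\<omega>. coset_map (free_algebra X) I (br (Inl \<omega>)))
      (\<lambda>\<omega>. coset_map (free_algebra X) I (br (Inr \<omega>))) B R S.
      (\<forall>x\<in>X. h (I +>\<^bsub>free_algebra X\<^esub> mon (letter x)) = f x) \<and>
      (\<forall>h'\<in>rb_hom scalar_ring (quotient_algebra (free_algebra X) I) (\<lambda>\<omega>. coset_map (free_algebra X) I (br (Inl \<omega>)))
        (\<lambda>\<omega>. coset_map (free_algebra X) I (br (Inr \<omega>))) B R S.
        (\<forall>x\<in>X. h' (I +>\<^bsub>free_algebra X\<^esub> mon (letter x)) = f x) \<longrightarrow>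
        (\<forall>a\<in>carrier (quotient_algebra (free_algebra X) I). h' a = h a))"
    unfolding I_def using rb.lift_hom rb.lift_letter rb.lift_unique by blast
qed

theorem theorem2p17:
  fixes X :: "'x set" and rX :: "'x rel" and rL :: "('w + 'w) rel"
    and larr rarr ltri rtri :: "'w \<Rightarrow> 'w \<Rightarrow> 'w"
  assumes "well_order_on X rX" and "well_order_on UNIV rL"
  shows "monomial_order X (db_order X rX rL) \<and>
    (let S = (four_operations.rb_relations larr rarr ltri rtri X
                :: (('w + 'w, 'x) bword \<Rightarrow>\<^sub>0 'k::comm_ring_1) set);
         K = (scalar_ring :: 'k ring);
         A = free_algebra X;
         I = operated_ideal X S;
         Q = quotient_algebra A I
     in
       (groebner_shirshov_basis X (db_order X rX rL) S \<longleftrightarrow>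
          extended_diassociative_semigroup larr rarr ltri rtri) \<and>
       (extended_diassociative_semigroup larr rarr ltri rtri \<longrightarrow>
          free_rota_baxter_system TYPE('b) larr rarr ltri rtri K X Q
            (\<lambda>\<omega>. coset_map A I (linear_extension (bracketR \<omega>)))
            (\<lambda>\<omega>. coset_map A I (linear_extension (bracketS \<omega>)))
            (\<lambda>x. I +>\<^bsub>A\<^esub> mon (letter x)) \<and>
          module_basis K Q (irreducible_words X (db_order X rX rL) S)
            (\<lambda>w. I +>\<^bsub>A\<^esub> mon w)))"
proof -
  interpret ordered_operations larr rarr ltri rtri X rX rL
    using assms by unfold_locales
  have eds: "ordered_eds larr rarr ltri rtri X rX rL"
    if "extended_diassociative_semigroup larr rarr ltri rtri"
    using that ordered_operations_axioms by (simp add: ordered_eds_def)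
  show ?thesis
    unfolding Let_def
    using monomial_order_db[OF assms] eds_necessary ordered_eds.groebner_shirshov_basis_relations[OF eds]
      free_rota_baxter_system_quotient ordered_eds.irreducible_basis[OF eds]
    by blast
qed

end
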